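(* In the operator setting, let $A\in L(\mathcal{X},\mathcal{Y})$ be $\mathcal{T}_{\mathcal{X}\mathcal{Y}}$-continuous with $\Lambda(A,\mathcal{T}_{\mathcal{X}\mathcal{Y}})\subseteq\overline{\mathbb{R}^d_+}$ (respectively $\subseteq\overline{\mathbb{R}^d_-}$), and suppose $A$ is invertible with $B=A^{-1}\in L(\mathcal{Y},\mathcal{X})$. Then there is $\alpha\in\mathbb{R}^d$ with all coordinates positive such that $B$ is $\mathcal{T}_{\mathcal{Y}\mathcal{X}}$-continuous and $B\in D(\mathbf{e}_{-\alpha})$ (respectively $B\in D(\mathbf{e}_{\alpha})$).
   Context: $\mathbb{R}^d_\pm$ denotes the set of vectors all of whose coordinates are positive (resp. negative). Fourier transform $\hat f(\lambda)=\int f(t)e^{-it\cdot\lambda}dt$. A Banach $L^1(\mathbb{R}^d)$-module structure on a Banach space $\mathcal{M}$ associated with a representation $\mathcal{T}:\mathbb{R}^d\to B(\mathcal{M})$ by invertible isometries is a bilinear map $(f,x)\mapsto fx$ with $(f*g)x=f(gx)$, $\|fx\|\le\|f\|_1\|x\|$, $\mathcal{T}(t)(fx)=(f(\cdot+t))x=f(\mathcal{T}(t)x)$, non-degenerate; $x$ is $\mathcal{T}$-continuous if $t\mapsto\mathcal{T}(t)x$ is norm continuous, and then $fx=\int f(t)\mathcal{T}(-t)x\,dt$. Beurling spectrum $\Lambda(x,\mathcal{T})$: set of $\gamma$ with $\hat f(\gamma)=0$ for all $f$ with $fx=0$. Operator setting: $\mathcal{X},\mathcal{Y}$ complex Banach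 spaces; each of $L(\mathcal{X},\mathcal{Y}),L(\mathcal{Y},\mathcal{X}),B(\mathcal{X}),B(\mathcal{Y})$ carries such a module structure with representations $\mathcal{T}_{\mathcal{U}\mathcal{V}}$ satisfying $\mathcal{T}_{\mathcal{U}\mathcal{W}}(t)(BA)=(\mathcal{T}_{\mathcal{V}\mathcal{W}}(t)B)(\mathcal{T}_{\mathcal{U}\mathcal{V}}(t)A)$, and coupled: $A,B$ mutually inverse iff $\mathcal{T}_{\mathcal{X}\mathcal{Y}}(t)A$, $\mathcal{T}_{\mathcal{Y}\mathcal{X}}(t)B$ are, for all $t$. Functional calculus: for $h$ such that $h\hat\varphi$ is an $L^1$-Fourier transform whenever $\hat\varphi$ is compactly supported, set $h\diamond x=(h\hat\varphi)^\vee x$ for $x$ of compact spectrum ($\hat\varphi$ compactly supported, $\equiv1$ near $\Lambda(x)$); $D(h)$ is the domain of the closure. $\mathbf{e}_\alpha(\lambda)=e^{\alpha\cdot\lambda}$. *)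

theory Defs
  imports "HOL-Analysis.Analysis"
begin

text \<open>A complex Banach space is a real Banach space together with the operator J of
multiplication by the imaginary unit; complex scalar multiplication is
c v = Re c v + Im c (J v), and the norm must be complex-homogeneous.\<close>

definition complex_structure :: "('a::real_normed_vector \<Rightarrow> 'a) \<Rightarrow> bool" where
  "complex_structure J \<longleftrightarrow> bounded_linear J \<and> (\<forall>v. J (J v) = - v) \<and>
     (\<forall>c v. norm (Re c *\<^sub>R v + Im c *\<^sub>R J v) = cmod c * norm v)"

text \<open>L(X,Y): bounded complex-linear operators (bounded real-linear operators commuting with J).\<close>
definition cops :: "('a::real_normed_vector \<Rightarrow> 'a) \<Rightarrow> ('b::real_normed_vector \<Rightarrow> 'b)
    \<Rightarrow> ('a \<Rightarrow>\<^sub>L 'b) set" where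
  "cops JX JY = {A. \<forall>v. blinfun_apply A (JX v) = JY (blinfun_apply A v)}"

definition opsc :: "('b::real_normed_vector \<Rightarrow> 'b) \<Rightarrow> complex \<Rightarrow> ('a::real_normed_vector \<Rightarrow>\<^sub>L 'b)
    \<Rightarrow> ('a \<Rightarrow>\<^sub>L 'b)" where
  "opsc JY c A = Re c *\<^sub>R A + Im c *\<^sub>R (Blinfun JY o\<^sub>L A)"

definition fourier :: "(real^'n \<Rightarrow> complex) \<Rightarrow> real^'n \<Rightarrow> complex" where
  "fourier f l = (LINT t|lborel. f t * cis (- (t \<bullet> l)))"

definition l1norm :: "(real^'n \<Rightarrow> complex) \<Rightarrow> real" where
  "l1norm f = (LINT t|lborel. cmod (f t))"

definition conv :: "(real^'n \<Rightarrow> complex) \<Rightarrow> (real^'n \<Rightarrow> complex) \<Rightarrow> real^'n \<Rightarrow> complex" where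
  "conv f g s = (LINT t|lborel. f (s - t) * g t)"

text \<open>M is the carrier (a complex Banach space inside a real normed type, with complex
scalar multiplication sc); T is a representation of R^d by invertible (complex-linear) isometries.\<close>
definition isometric_rep :: "'m::real_normed_vector set \<Rightarrow> (complex \<Rightarrow> 'm \<Rightarrow> 'm)
    \<Rightarrow> (real^'n \<Rightarrow> 'm \<Rightarrow> 'm) \<Rightarrow> bool" where
  "isometric_rep M sc T \<longleftrightarrow>
     (\<forall>t. \<forall>x\<in>M. T t x \<in> M) \<and>
     (\<forall>t. \<forall>x\<in>M. \<forall>y\<in>M. T t (x + y) = T t x + T t y) \<and>
     (\<forall>t c. \<forall>x\<in>M. T t (sc c x) = sc c (T t x)) \<and>
     (\<forall>t. \<forall>x\<in>M. norm (T t x) = norm x) \<and>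
     (\<forall>x\<in>M. T 0 x = x) \<and>
     (\<forall>s t. \<forall>x\<in>M. T (s + t) x = T s (T t x))"

definition l1_module :: "'m::real_normed_vector set \<Rightarrow> (complex \<Rightarrow> 'm \<Rightarrow> 'm)
    \<Rightarrow> (real^'n \<Rightarrow> 'm \<Rightarrow> 'm) \<Rightarrow> ((real^'n \<Rightarrow> complex) \<Rightarrow> 'm \<Rightarrow> 'm) \<Rightarrow> bool" where
  "l1_module M sc T act \<longleftrightarrow> isometric_rep M sc T \<and>
     (\<forall>f. integrable lborel f \<longrightarrow> (\<forall>x\<in>M. act f x \<in> M)) \<and>
     (\<forall>f g. integrable lborel f \<longrightarrow> integrable lborel g \<longrightarrow>
        (\<forall>x\<in>M. act (\<lambda>t. f t + g t) x = act f x + act g x)) \<and>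
     (\<forall>f c. integrable lborel f \<longrightarrow> (\<forall>x\<in>M. act (\<lambda>t. c * f t) x = sc c (act f x))) \<and>
     (\<forall>f. integrable lborel f \<longrightarrow> (\<forall>x\<in>M. \<forall>y\<in>M. act f (x + y) = act f x + act f y)) \<and>
     (\<forall>f c. integrable lborel f \<longrightarrow> (\<forall>x\<in>M. act f (sc c x) = sc c (act f x))) \<and>
     (\<forall>f g. integrable lborel f \<longrightarrow> integrable lborel g \<longrightarrow>
        (\<forall>x\<in>M. act (conv f g) x = act f (act g x))) \<and>
     (\<forall>f. integrable lborel f \<longrightarrow> (\<forall>x\<in>M. norm (act f x) \<le> l1norm f * norm x)) \<and>
     (\<forall>f t. integrable lborel f \<longrightarrow> (\<forall>x\<in>M.
        T t (act f x) = act (\<lambda>s. f (s + t)) x \<and> T t (act f x) = act f (T t x))) \<and>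
     (\<forall>x\<in>M. (\<forall>f. integrable lborel f \<longrightarrow> act f x = 0) \<longrightarrow> x = 0) \<and>
     (\<forall>x\<in>M. continuous_on UNIV (\<lambda>t. T t x) \<longrightarrow>
        (\<forall>f. integrable lborel f \<longrightarrow> ((\<lambda>t. sc (f t) (T (- t) x)) has_integral act f x) UNIV))"

definition beurling_spec :: "((real^'n \<Rightarrow> complex) \<Rightarrow> 'm \<Rightarrow> 'm::real_normed_vector) \<Rightarrow> 'm
    \<Rightarrow> (real^'n) set" where
  "beurling_spec act x = {\<gamma>. \<forall>f. integrable lborel f \<and> act f x = 0 \<longrightarrow> fourier f \<gamma> = 0}"

definition diamond_graph :: "'m::real_normed_vector set \<Rightarrow> ((real^'n \<Rightarrow> complex) \<Rightarrow> 'm \<Rightarrow> 'm)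
    \<Rightarrow> (real^'n \<Rightarrow> complex) \<Rightarrow> ('m \<times> 'm) set" where
  "diamond_graph M act h = {(x, act g x) | x g.
     x \<in> M \<and> compact (beurling_spec act x) \<and> integrable lborel g \<and>
     (\<exists>\<phi> U. integrable lborel \<phi> \<and> compact (closure {l. fourier \<phi> l \<noteq> 0}) \<and>
        open U \<and> beurling_spec act x \<subseteq> U \<and> (\<forall>l\<in>U. fourier \<phi> l = 1) \<and>
        (\<forall>l. fourier g l = h l * fourier \<phi> l))}"

definition fc_domain :: "'m::real_normed_vector set \<Rightarrow> ((real^'n \<Rightarrow> complex) \<Rightarrow> 'm \<Rightarrow> 'm)
    \<Rightarrow> (real^'n \<Rightarrow> complex) \<Rightarrow> 'm set" where
  "fc_domain M act h = {x. \<exists>y. (x, y) \<in> closure (diamond_graph M act h)}"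

definition expo :: "real^'n \<Rightarrow> real^'n \<Rightarrow> complex" where
  "expo \<alpha> l = complex_of_real (exp (\<alpha> \<bullet> l))"

end

theory Submission
  imports Defs "HOL-Probability.Sinc_Integral" "HOL-Real_Asymp.Real_Asymp"
begin

text \<open>
  Write \<open>v = (1, \<dots>, 1)\<close> and take the spectrum of \<open>A\<close> in the positive orthant. For a band-limited \<open>\<phi>\<close>
  (integrable, with compactly supported Fourier transform) the orbit \<open>r \<mapsto> T(r v) (\<phi> A)\<close> extends to an entire
  function of \<open>r\<close>. Its value at \<open>i \<sigma>\<close> has the multiplier \<open>exp (- \<sigma> v \<bullet> \<lambda>)\<close>, which near the
  orthant agrees with the transform of a Poisson-type kernel whose \<open>L\<^sup>1\<close> norm stays bounded for \<open>\<sigma> \<le> 1\<close>;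
  hence this value is controlled by \<open>\<phi> A\<close> uniformly in \<open>\<phi>\<close>. With an approximate identity \<open>\<phi>\<^sub>n\<close>, the continuations of
  \<open>\<phi>\<^sub>n A\<close> stay within the radius of invertibility around \<open>A\<close> on a common strip \<open>0 \<le> \<sigma> \<le> s\<close>. Their
  inverses \<open>b\<^sub>n\<close> satisfy the Cauchy--Riemann equation along the orbits, so a contour shift gives
  \<open>(e \<diamondop> \<phi>) b\<^sub>n(0) = \<phi> b\<^sub>n(s)\<close> with \<open>e = exp (- s v \<bullet> \<lambda>)\<close> for every band-limited \<open>\<phi>\<close>. Letting \<open>n\<close> and then \<open>\<phi>\<close> run
  along the approximate identity exhibits \<open>(B, lim b\<^sub>n(s))\<close> as a limit of points of the graph.
\<close>

section \<open>Fourier inversion on the real line\<close>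

text \<open>The obstacle is uniformity. For a fixed \<open>\<phi>\<close> the continuation exists by
  band-limitation alone, but its growth constant depends on the band, which widens along an
  approximate identity. The one-sided spectrum supplies a second bound in which only
  \<open>\<sigma>\<close> and the dimension enter. It comes from an identity of multipliers, and
  this has to hold near the spectrum and not only on it, since otherwise a question of spectral
  synthesis would arise. Hence the Poisson symbols are tilted so as to agree with the exponential on
  an open set around the closed orthant. No theory of vector-valued holomorphic functions is used.
  First-order expansions with quadratic error take its place, and the Cauchy-Riemann equation for
  the inverses results from comparison with real translations, where the coupling identifies the
  inverse as a translate. Bounding differences at height \<open>\<sigma>\<close> by differences at
  height 0 serves twice: a single reference index fixes the width of the strip for all later ones,
  and Cauchy sequences at height 0 stay Cauchy at height \<open>s\<close>. The sign \<open>e\<close>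
  treats both orthants at once.\<close>

lemma integrable_inverse_1_plus_square_UNIV: "integrable lborel (\<lambda>x::real. inverse (1 + x\<^sup>2))"
  using integrable_inverse_1_plus_square by (simp add: set_integrable_def)

lemma integral_inverse_1_plus_square_UNIV: "(LINT x|lborel. inverse (1 + x\<^sup>2)) = pi"
  using LBINT_inverse_1_plus_square
  by (simp add: interval_lebesgue_integral_def set_lebesgue_integral_def einterval_iff)

lemma borel_measurable_cis [measurable]: "cis \<in> borel_measurable borel"
  by (intro borel_measurable_continuous_onI continuous_intros)

lemma integrable_exp_abs:
  fixes s :: real assumes "s > 0" shows "integrable lborel (\<lambda>x. exp (- (s * \<bar>x\<bar>)))"
proof (rule Bochner_Integration.integrable_bound)
  show "integrable lborel (\<lambda>x. (1 + 2 / s\<^sup>2) * inverse (1 + x\<^sup>2))"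
    using integrable_inverse_1_plus_square_UNIV by simp
  show "AE x in lborel. norm (exp (- (s * \<bar>x\<bar>))) \<le> norm ((1 + 2 / s\<^sup>2) * inverse (1 + x\<^sup>2))"
  proof (rule AE_I2)
    fix x :: real
    have e: "exp (s * \<bar>x\<bar>) \<ge> 1 + (s * \<bar>x\<bar>)\<^sup>2 / 2"
    proof -
      have "0 \<le> s * \<bar>x\<bar>" using assms by simp
      then show ?thesis using exp_lower_Taylor_quadratic[of "s * \<bar>x\<bar>"] by linarith
    qed
    have "1 + x\<^sup>2 \<le> (1 + 2 / s\<^sup>2) * (1 + (s * \<bar>x\<bar>)\<^sup>2 / 2)"
      using assms by (simp add: field_simps power2_eq_square)
    also have "\<dots> \<le> (1 + 2 / s\<^sup>2) * exp (s * \<bar>x\<bar>)"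
      by (intro mult_left_mono e) (use assms in auto)
    finally have "1 + x\<^sup>2 \<le> (1 + 2 / s\<^sup>2) * exp (s * \<bar>x\<bar>)" .
    moreover have "1 + x\<^sup>2 > 0" by (simp add: add_pos_nonneg)
    ultimately show "norm (exp (- (s * \<bar>x\<bar>))) \<le> norm ((1 + 2 / s\<^sup>2) * inverse (1 + x\<^sup>2))"
      by (simp add: exp_minus field_simps abs_mult)
  qed
qed simp

text \<open>This Fourier pair enters twice: as the Abel factor in
  \<open>fourier_inversion_1d\<close> and as the symbol of the Poisson kernel. On each half-line the
  integrand is a single exponential, with exponent \<open>p\<close> on the right and
  \<open>q\<close> on the left, so \<open>exp (c x) / c\<close> is an antiderivative.\<close>

lemma exp_abs_transform:
  fixes s u :: real assumes s: "s > 0"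
  shows "(LINT x|lborel. complex_of_real (exp (- (s * \<bar>x\<bar>))) * cis (u * x)) = of_real (2 * s / (s\<^sup>2 + u\<^sup>2))"
proof -
  define h where "h = (\<lambda>x. complex_of_real (exp (- (s * \<bar>x\<bar>))) * cis (u * x))"
  have hI: "integrable lborel h"
  proof (rule Bochner_Integration.integrable_bound[OF integrable_exp_abs[OF s]])
    show "h \<in> borel_measurable lborel" unfolding h_def by measurable
  qed (auto simp: h_def norm_mult)
  have lim: "((\<lambda>x. exp (c * of_real x) / c) \<longlongrightarrow> 0) at_top" if "Re c < 0" for c :: complex
  proof -
    have "((\<lambda>x. exp (Re c * x)) \<longlongrightarrow> 0) at_top"
      using that by real_asymp
    then have "((\<lambda>x. norm (exp (c * of_real x))) \<longlongrightarrow> 0) at_top" by simp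
    then have "((\<lambda>x. exp (c * of_real x)) \<longlongrightarrow> 0) at_top" by (rule tendsto_norm_zero_cancel)
    then show ?thesis by (rule tendsto_divide_zero)
  qed
  have ch: "isCont h x" for x
  proof -
    have "continuous_on UNIV h" unfolding h_def by (intro continuous_intros)
    then show ?thesis by (simp add: continuous_on_eq_continuous_at)
  qed
  define p where "p = Complex (-s) u"
  define q where "q = Complex s u"
  have pq: "p \<noteq> 0" "q \<noteq> 0" using s by (auto simp: p_def q_def complex_eq_iff)
  have hp: "h x = exp (p * of_real x)" if "x \<ge> 0" for x
    using that by (simp add: h_def p_def exp_eq_polar cis.ctr complex_eq_iff)
  have hq: "h x = exp (q * of_real x)" if "x \<le> 0" for x
    using that by (simp add: h_def q_def exp_eq_polar cis.ctr complex_eq_iff)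
  have D: "((\<lambda>x. exp (c * of_real x) / c) has_vector_derivative exp (c * of_real x)) (at x)" if "c \<noteq> 0" for c :: complex and x
    by (rule has_vector_derivative_real_field[of "\<lambda>z. exp (c * z) / c"])
       (use that in \<open>auto intro!: derivative_eq_intros\<close>)
  have lim0: "((\<lambda>x. exp (c * of_real x) / c) \<longlongrightarrow> exp (c * of_real 0) / c) (at 0 within S)" if "c \<noteq> 0" for c :: complex and S
    using has_vector_derivative_continuous[OF D[OF that, of 0]] tendsto_within_subset[OF _ subset_UNIV]
    unfolding continuous_within by blast
  have 1: "(LBINT x=0..\<infinity>. h x) = - (1 / p)"
  proof -
    have "(LBINT x=0..\<infinity>. h x) = 0 - exp (p * of_real 0) / p"
    proof (rule interval_integral_FTC_integrable[where F = "\<lambda>x. exp (p * of_real x) / p"])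
      fix x assume "0 < ereal x"
      then have x: "x > 0" by simp
      show "((\<lambda>x. exp (p * of_real x) / p) has_vector_derivative h x) (at x)"
        using D[of p x] pq hp[of x] x by simp
      show "isCont h x" using ch by simp
    next
      show "set_integrable lborel (einterval 0 \<infinity>) h"
        unfolding set_integrable_def using hI by (simp add: integrable_mult_indicator)
      show "(((\<lambda>x. exp (p * of_real x) / p) \<circ> real_of_ereal) \<longlongrightarrow> exp (p * of_real 0) / p) (at_right 0)"
        unfolding zero_ereal_def ereal_tendsto_simps by (rule lim0) (rule pq)
      show "(((\<lambda>x. exp (p * of_real x) / p) \<circ> real_of_ereal) \<longlongrightarrow> 0) (at_left \<infinity>)"
        unfolding ereal_tendsto_simps using lim[of p] s by (simp add: p_def)
    qed simp
    then show ?thesis by simp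
  qed
  have 2: "(LBINT x=-\<infinity>..0. h x) = 1 / q"
  proof -
    have "(LBINT x=-\<infinity>..0. h x) = exp (q * of_real 0) / q - 0"
    proof (rule interval_integral_FTC_integrable[where F = "\<lambda>x. exp (q * of_real x) / q"])
      fix x assume "ereal x < 0"
      then have x: "x < 0" by simp
      show "((\<lambda>x. exp (q * of_real x) / q) has_vector_derivative h x) (at x)"
        using D[of q x] pq hq[of x] x by simp
      show "isCont h x" using ch by simp
    next
      show "set_integrable lborel (einterval (-\<infinity>) 0) h"
        unfolding set_integrable_def using hI by (simp add: integrable_mult_indicator)
      show "(((\<lambda>x. exp (q * of_real x) / q) \<circ> real_of_ereal) \<longlongrightarrow> exp (q * of_real 0) / q) (at_left 0)"
        unfolding zero_ereal_def ereal_tendsto_simps by (rule lim0) (rule pq)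
      have "((\<lambda>x. exp ((-q) * of_real x) / (-q)) \<longlongrightarrow> 0) at_top" using lim[of "-q"] s by (simp add: q_def)
      then have "((\<lambda>x. exp (q * of_real x) / q) \<longlongrightarrow> 0) at_bot"
        using tendsto_minus[of _ 0] by (fastforce simp: filterlim_at_bot_mirror)
      then show "(((\<lambda>x. exp (q * of_real x) / q) \<circ> real_of_ereal) \<longlongrightarrow> 0) (at_right (-\<infinity>))"
        unfolding ereal_tendsto_simps .
    qed simp
    then show ?thesis by simp
  qed
  have "(LINT x|lborel. h x) = (LBINT x=-\<infinity>..\<infinity>. h x)"
    by (simp add: interval_lebesgue_integral_def set_lebesgue_integral_def einterval_iff)
  also have "\<dots> = (LBINT x=-\<infinity>..0. h x) + (LBINT x=0..\<infinity>. h x)"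
    by (rule interval_integral_sum[symmetric])
       (use hI in \<open>simp add: interval_lebesgue_integrable_def set_integrable_def einterval_iff\<close>)
  also have "\<dots> = 1 / q - 1 / p" using 1 2 by simp
  also have "\<dots> = of_real (2 * s / (s\<^sup>2 + u\<^sup>2))"
  proof -
    have "p - q = - of_real (2 * s)" "p * q = - of_real (s\<^sup>2 + u\<^sup>2)"
      by (simp_all add: p_def q_def complex_eq_iff power2_eq_square)
    moreover have "1 / q - 1 / p = (p - q) / (p * q)" using pq by (simp add: field_simps)
    ultimately show ?thesis by (simp only: minus_divide_divide of_real_divide)
  qed
  finally show ?thesis by (simp add: h_def)
qed

lemma integrable_lborel_prod_mult:
  fixes f :: "'a::euclidean_space \<Rightarrow> complex" and g :: "'b::euclidean_space \<Rightarrow> complex"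
  assumes f: "integrable lborel f" and g: "integrable lborel g"
  shows "integrable (lborel \<Otimes>\<^sub>M lborel) (\<lambda>(x, y). f x * g y)"
proof -
  have [measurable]: "f \<in> borel_measurable borel" "g \<in> borel_measurable borel"
    using f g borel_measurable_integrable by auto
  show ?thesis
    by (rule lborel_pair.Fubini_integrable) (use f g in \<open>auto simp: norm_mult\<close>)
qed

text \<open>Abel summation: damp the inverse integral by \<open>exp (- e |u|)\<close> and exchange
  the integrals. The damped value is an average of \<open>a\<close> at scale \<open>e\<close> around
  \<open>l\<close> with density \<open>2 / (1 + w^2)\<close>. As \<open>e\<close> tends to 0 both
  sides converge by domination, and the mass of the density is the constant
  \<open>2 * pi\<close>.\<close>

lemma fourier_inversion_1d:
  fixes a F :: "real \<Rightarrow> complex"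
  assumes cont: "continuous_on UNIV a" and bound: "\<And>x. cmod (a x) \<le> C"
    and ia: "integrable lborel a"
    and F: "\<And>u. F u = (LINT x|lborel. a x * cis (u * x))" and iF: "integrable lborel F"
  shows "(LINT u|lborel. F u * cis (- (u * l))) = 2 * pi * a l"
proof -
  have [measurable]: "a \<in> borel_measurable borel" "F \<in> borel_measurable borel"
    using ia iF borel_measurable_integrable by auto
  have abel: "(LINT u|lborel. F u * cis (- (u * l)) * of_real (exp (- (e * \<bar>u\<bar>))))
      = (LINT w|lborel. a (l + e * w) * of_real (2 * inverse (1 + w\<^sup>2)))" if e: "e > 0" for e :: real
  proof -
    have "(LINT u|lborel. F u * cis (- (u * l)) * of_real (exp (- (e * \<bar>u\<bar>))))
      = (LINT u|lborel. (LINT x|lborel. a x * cis (u * (x - l)) * of_real (exp (- (e * \<bar>u\<bar>)))))"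
    proof (intro Bochner_Integration.integral_cong refl)
      fix u
      have "cis (u * (x - l)) = cis (u * x) * cis (- (u * l))" for x
        by (simp add: cis_mult algebra_simps)
      then have "(LINT x|lborel. a x * cis (u * (x - l)) * of_real (exp (- (e * \<bar>u\<bar>))))
        = (LINT x|lborel. (a x * cis (u * x)) * (cis (- (u * l)) * of_real (exp (- (e * \<bar>u\<bar>)))))"
        by (simp only: mult.assoc)
      then show "F u * cis (- (u * l)) * of_real (exp (- (e * \<bar>u\<bar>))) = (LINT x|lborel. a x * cis (u * (x - l)) * of_real (exp (- (e * \<bar>u\<bar>))))"
        unfolding F by simp
    qed
    also have "\<dots> = (LINT x|lborel. (LINT u|lborel. a x * cis (u * (x - l)) * of_real (exp (- (e * \<bar>u\<bar>)))))"
    proof (rule lborel_pair.Fubini_integral)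
      have i: "integrable (lborel \<Otimes>\<^sub>M lborel) (\<lambda>(x, u). a x * complex_of_real (exp (- (e * \<bar>u\<bar>))))"
        by (rule integrable_lborel_prod_mult) (use ia integrable_exp_abs[OF e] in \<open>auto intro!: integrable_of_real\<close>)
      show "integrable (lborel \<Otimes>\<^sub>M lborel) (\<lambda>(x, u). a x * cis (u * (x - l)) * of_real (exp (- (e * \<bar>u\<bar>))))"
        by (rule Bochner_Integration.integrable_bound[OF i]) (auto simp: norm_mult)
    qed
    also have "\<dots> = (LINT x|lborel. a x * of_real (2 * e / (e\<^sup>2 + (x - l)\<^sup>2)))"
    proof (intro Bochner_Integration.integral_cong refl)
      fix x
      show "(LINT u|lborel. a x * cis (u * (x - l)) * of_real (exp (- (e * \<bar>u\<bar>)))) = a x * of_real (2 * e / (e\<^sup>2 + (x - l)\<^sup>2))"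
        unfolding exp_abs_transform[OF e, of "x - l", symmetric] integral_mult_right_zero[symmetric]
        by (intro Bochner_Integration.integral_cong refl) (simp add: mult_ac)
    qed
    also have "\<dots> = e *\<^sub>R (LINT w|lborel. a (l + e * w) * of_real (2 * e / (e\<^sup>2 + (e * w)\<^sup>2)))"
      by (subst lborel_integral_real_affine[where t = l and c = e]) (use e in auto)
    also have "\<dots> = (LINT w|lborel. a (l + e * w) * of_real (2 * inverse (1 + w\<^sup>2)))"
    proof -
      have *: "e * (2 * e / (e\<^sup>2 + (e * w)\<^sup>2)) = 2 * inverse (1 + w\<^sup>2)" for w
      proof -
        have "e\<^sup>2 + (e * w)\<^sup>2 = e\<^sup>2 * (1 + w\<^sup>2)" by (simp add: algebra_simps power2_eq_square)
        then show ?thesis using e by (simp add: power2_eq_square divide_inverse[symmetric])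
      qed
      show ?thesis
        unfolding integral_scaleR_right[symmetric]
        by (intro Bochner_Integration.integral_cong refl)
           (simp only: *[symmetric] scaleR_conv_of_real of_real_mult mult_ac)
    qed
    finally show ?thesis .
  qed
  define en where "en n = inverse (real (Suc n))" for n
  have en: "en \<longlonglongrightarrow> 0" "\<And>n. en n > 0"
    using LIMSEQ_inverse_real_of_nat by (auto simp: en_def[abs_def])
  have L: "(\<lambda>n. LINT u|lborel. F u * cis (- (u * l)) * of_real (exp (- (en n * \<bar>u\<bar>)))) \<longlonglongrightarrow> (LINT u|lborel. F u * cis (- (u * l)))"
  proof (rule integral_dominated_convergence[where w = "\<lambda>u. cmod (F u)"])
    show "AE u in lborel. (\<lambda>n. F u * cis (- (u * l)) * of_real (exp (- (en n * \<bar>u\<bar>)))) \<longlonglongrightarrow> F u * cis (- (u * l))"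
    proof (rule AE_I2)
      fix u
      have "(\<lambda>n. F u * cis (- (u * l)) * of_real (exp (- (en n * \<bar>u\<bar>)))) \<longlonglongrightarrow> F u * cis (- (u * l)) * of_real (exp (- (0 * \<bar>u\<bar>)))"
        by (intro tendsto_intros en)
      then show "(\<lambda>n. F u * cis (- (u * l)) * of_real (exp (- (en n * \<bar>u\<bar>)))) \<longlonglongrightarrow> F u * cis (- (u * l))" by simp
    qed
    show "AE u in lborel. cmod (F u * cis (- (u * l)) * of_real (exp (- (en n * \<bar>u\<bar>)))) \<le> cmod (F u)" for n
      using en(2)[of n] by (intro AE_I2) (simp add: norm_mult mult_left_le)
  qed (use iF in auto)
  have R: "(\<lambda>n. LINT w|lborel. a (l + en n * w) * of_real (2 * inverse (1 + w\<^sup>2))) \<longlonglongrightarrow> (LINT w|lborel. a l * of_real (2 * inverse (1 + w\<^sup>2)))"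
  proof (rule integral_dominated_convergence[where w = "\<lambda>w. C * (2 * inverse (1 + w\<^sup>2))"])
    show "AE w in lborel. (\<lambda>n. a (l + en n * w) * of_real (2 * inverse (1 + w\<^sup>2))) \<longlonglongrightarrow> a l * of_real (2 * inverse (1 + w\<^sup>2))"
    proof (rule AE_I2)
      fix w
      have "(\<lambda>n. l + en n * w) \<longlonglongrightarrow> l + 0 * w" by (intro tendsto_intros en)
      then have "(\<lambda>n. a (l + en n * w)) \<longlonglongrightarrow> a l"
        using cont by (intro isCont_tendsto_compose[of _ a]) (auto simp: continuous_on_eq_continuous_at)
      then show "(\<lambda>n. a (l + en n * w) * of_real (2 * inverse (1 + w\<^sup>2))) \<longlonglongrightarrow> a l * of_real (2 * inverse (1 + w\<^sup>2))"
        by (intro tendsto_intros)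
    qed
    show "AE w in lborel. cmod (a (l + en n * w) * of_real (2 * inverse (1 + w\<^sup>2))) \<le> C * (2 * inverse (1 + w\<^sup>2))" for n
    proof (rule AE_I2)
      fix w :: real
      have "\<bar>2 * inverse (1 + w\<^sup>2)\<bar> = 2 * inverse (1 + w\<^sup>2)" by (intro abs_of_nonneg) auto
      then show "cmod (a (l + en n * w) * of_real (2 * inverse (1 + w\<^sup>2))) \<le> C * (2 * inverse (1 + w\<^sup>2))"
        unfolding norm_mult norm_of_real by (intro mult_mono bound) (use order_trans[OF norm_ge_zero bound] in auto)
    qed
    show "integrable lborel (\<lambda>w. C * (2 * inverse (1 + w\<^sup>2)))"
      using integrable_inverse_1_plus_square_UNIV by auto
  qed auto
  have "(LINT w|lborel. a l * of_real (2 * inverse (1 + w\<^sup>2))) = a l * of_real (LINT w|lborel. 2 * inverse (1 + w\<^sup>2))"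
    by (simp only: integral_mult_right_zero integral_complex_of_real)
  also have "\<dots> = 2 * pi * a l"
    using integral_inverse_1_plus_square_UNIV by simp
  finally have "(LINT w|lborel. a l * of_real (2 * inverse (1 + w\<^sup>2))) = 2 * pi * a l" .
  with LIMSEQ_unique[OF L] R abel[OF en(2)] show ?thesis by simp
qed

section \<open>Affine changes of variable and convolution of integrable functions\<close>

lemma
  fixes f :: "'a::euclidean_space \<Rightarrow> 'b::{banach,second_countable_topology}"
  assumes c: "c \<noteq> 0"
  shows lborel_integrable_affine: "integrable lborel f \<Longrightarrow> integrable lborel (\<lambda>x. f (t + c *\<^sub>R x))"
    and lborel_integral_affine: "integrable lborel f \<Longrightarrow> (LINT x|lborel. f x) = \<bar>c\<bar> ^ DIM('a) *\<^sub>R (LINT x|lborel. f (t + c *\<^sub>R x))"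
proof -
  assume f: "integrable lborel f"
  then have [measurable]: "f \<in> borel_measurable borel" using borel_measurable_integrable by auto
  have "integrable (density (distr lborel borel (\<lambda>x. t + c *\<^sub>R x)) (\<lambda>_. \<bar>c\<bar> ^ DIM('a))) f"
    using f lborel_affine[OF c, of t] by simp
  then have "integrable lborel (\<lambda>x. \<bar>c\<bar> ^ DIM('a) *\<^sub>R f (t + c *\<^sub>R x))"
    by (simp add: integrable_density integrable_distr_eq)
  from integrable_scaleR_right[OF this, of "inverse (\<bar>c\<bar> ^ DIM('a))"]
  show "integrable lborel (\<lambda>x. f (t + c *\<^sub>R x))" using c by simp
  have "(LINT x|lborel. f x) = (LINT x|density (distr lborel borel (\<lambda>x. t + c *\<^sub>R x)) (\<lambda>_. \<bar>c\<bar> ^ DIM('a)). f x)"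
    using lborel_affine[OF c, of t] by simp
  also have "\<dots> = \<bar>c\<bar> ^ DIM('a) *\<^sub>R (LINT x|lborel. f (t + c *\<^sub>R x))"
    by (simp add: integral_density integral_distr)
  finally show "(LINT x|lborel. f x) = \<bar>c\<bar> ^ DIM('a) *\<^sub>R (LINT x|lborel. f (t + c *\<^sub>R x))" .
qed

lemma
  fixes f :: "'a::euclidean_space \<Rightarrow> 'b::{banach,second_countable_topology}"
  assumes f: "integrable lborel f"
  shows lborel_integrable_translate: "integrable lborel (\<lambda>x. f (x + t))"
    and lborel_integral_translate: "(LINT x|lborel. f (x + t)) = (LINT x|lborel. f x)"
    and lborel_integral_reflect: "(LINT x|lborel. f (t - x)) = (LINT x|lborel. f x)"
  using lborel_integrable_affine[of 1, OF _ f, of t] lborel_integral_affine[of 1, OF _ f, of t]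
    lborel_integral_affine[of "-1", OF _ f, of t]
  by (simp_all add: add.commute)

lemma integrable_lborel_conv_pair:
  fixes f g :: "'a::euclidean_space \<Rightarrow> complex"
  assumes f: "integrable lborel f" and g: "integrable lborel g"
  shows "integrable (lborel \<Otimes>\<^sub>M lborel) (\<lambda>(t, s). f (s - t) * g t)"
proof -
  have [measurable]: "f \<in> borel_measurable borel" "g \<in> borel_measurable borel"
    using f g borel_measurable_integrable by auto
  have fn: "integrable lborel (\<lambda>s. norm (f s))" using f by simp
  have 1: "integrable lborel (\<lambda>s. f (s - t))" "integrable lborel (\<lambda>s. norm (f (s - t)))"
    "(LINT s|lborel. norm (f (s - t))) = (LINT s|lborel. norm (f s))" for t
    using lborel_integrable_translate[OF f, of "-t"] lborel_integrable_translate[OF fn, of "-t"] lborel_integral_translate[OF fn, of "-t"] by auto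
  show ?thesis
    by (rule lborel_pair.Fubini_integrable) (use g 1 in \<open>auto simp: norm_mult\<close>)
qed

text \<open>Everything is Fubini for the kernel of \<open>integrable_lborel_conv_pair\<close>. The
  setting is an arbitrary Euclidean space because the result serves on the line for
  \<open>smoothed_window\<close>, where the inner product is the ordinary product, and on
  \<open>real^'n\<close> for \<open>conv\<close>.\<close>

lemma
  fixes f g :: "'a::euclidean_space \<Rightarrow> complex"
  assumes f: "integrable lborel f" and g: "integrable lborel g"
  shows integrable_lborel_conv: "integrable lborel (\<lambda>s. LINT t|lborel. f (s - t) * g t)"
    and integral_norm_lborel_conv:
      "(LINT s|lborel. cmod (LINT t|lborel. f (s - t) * g t)) \<le> (LINT s|lborel. cmod (f s)) * (LINT s|lborel. cmod (g s))"
    and integral_cis_lborel_conv: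
      "(LINT s|lborel. (LINT t|lborel. f (s - t) * g t) * cis (u \<bullet> s))
        = (LINT s|lborel. f s * cis (u \<bullet> s)) * (LINT s|lborel. g s * cis (u \<bullet> s))"
proof -
  have [measurable]: "f \<in> borel_measurable borel" "g \<in> borel_measurable borel"
    using f g borel_measurable_integrable by auto
  let ?h = "\<lambda>(t, s). f (s - t) * g t"
  have hI: "integrable (lborel \<Otimes>\<^sub>M lborel) ?h" by (rule integrable_lborel_conv_pair[OF f g])
  have hN: "integrable (lborel \<Otimes>\<^sub>M lborel) (\<lambda>(t, s). cmod (f (s - t) * g t))"
    using integrable_norm[OF hI] by (simp add: case_prod_unfold)
  show i1: "integrable lborel (\<lambda>s. LINT t|lborel. f (s - t) * g t)"
    using lborel_pair.integrable_snd[OF hI] by simp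
  have i2: "integrable lborel (\<lambda>s. LINT t|lborel. cmod (f (s - t) * g t))"
    using lborel_pair.integrable_snd[OF hN] by simp
  have fn: "integrable lborel (\<lambda>s. cmod (f s))" using f by simp
  have "(LINT s|lborel. cmod (LINT t|lborel. f (s - t) * g t)) \<le> (LINT s|lborel. LINT t|lborel. cmod (f (s - t) * g t))"
    by (intro integral_mono integrable_norm i1 i2 integral_norm_bound)
  also have "\<dots> = (LINT t|lborel. LINT s|lborel. cmod (f (s - t) * g t))"
    using lborel_pair.Fubini_integral[OF hN] by simp
  also have "\<dots> = (LINT t|lborel. (LINT s|lborel. cmod (f s)) * cmod (g t))"
    using lborel_integral_translate[OF fn, of "- t" for t] by (simp add: norm_mult)
  finally show "(LINT s|lborel. cmod (LINT t|lborel. f (s - t) * g t)) \<le> (LINT s|lborel. cmod (f s)) * (LINT s|lborel. cmod (g s))"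
    by simp
  have cI: "integrable (lborel \<Otimes>\<^sub>M lborel) (\<lambda>(t, s). f (s - t) * g t * cis (u \<bullet> s))"
    by (rule Bochner_Integration.integrable_bound[OF hI]) (auto simp: norm_mult)
  have fc: "integrable lborel (\<lambda>s. f s * cis (u \<bullet> s))"
    by (rule Bochner_Integration.integrable_bound[OF f]) (auto simp: norm_mult)
  have "(LINT s|lborel. (LINT t|lborel. f (s - t) * g t) * cis (u \<bullet> s)) = (LINT s|lborel. LINT t|lborel. f (s - t) * g t * cis (u \<bullet> s))"
    by simp
  also have "\<dots> = (LINT t|lborel. LINT s|lborel. f (s - t) * g t * cis (u \<bullet> s))"
    by (rule lborel_pair.Fubini_integral[OF cI])
  also have "\<dots> = (LINT t|lborel. (LINT s|lborel. f s * cis (u \<bullet> s)) * (g t * cis (u \<bullet> t)))"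
  proof (intro Bochner_Integration.integral_cong refl)
    fix t
    have "(LINT s|lborel. f (s - t) * g t * cis (u \<bullet> s)) = (LINT s|lborel. (f (s + - t) * cis (u \<bullet> (s + - t))) * (g t * cis (u \<bullet> t)))"
      by (intro Bochner_Integration.integral_cong refl) (simp add: cis_mult inner_diff_right mult_ac)
    also have "\<dots> = (LINT s|lborel. f s * cis (u \<bullet> s)) * (g t * cis (u \<bullet> t))"
      unfolding integral_mult_left_zero using lborel_integral_translate[OF fc, of "-t"] by simp
    finally show "(LINT s|lborel. f (s - t) * g t * cis (u \<bullet> s)) = (LINT s|lborel. f s * cis (u \<bullet> s)) * (g t * cis (u \<bullet> t))" .
  qed
  finally show "(LINT s|lborel. (LINT t|lborel. f (s - t) * g t) * cis (u \<bullet> s))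
        = (LINT s|lborel. f s * cis (u \<bullet> s)) * (LINT s|lborel. g s * cis (u \<bullet> s))"
    by simp
qed

section \<open>One-dimensional kernels\<close>

text \<open>The affine factor covers two needs: \<open>p = 1\<close>, \<open>q = 0\<close> leads to
  cutoffs, \<open>p = 0\<close>, \<open>q = 1\<close> to a localized coordinate function, the
  multiplier of a derivative.\<close>

definition affine_window :: "real \<Rightarrow> real \<Rightarrow> real \<Rightarrow> real \<Rightarrow> real \<Rightarrow> complex" where
  "affine_window a b p q x = indicator {a..b} x * of_real (p + q * x)"

lemma affine_window_measurable [measurable]: "affine_window a b p q \<in> borel_measurable borel"
  unfolding affine_window_def by measurable

lemma affine_window_bound: "cmod (affine_window a b p q x) \<le> (\<bar>p\<bar> + \<bar>q\<bar> * (\<bar>a\<bar> + \<bar>b\<bar>)) * indicator {a..b} x"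
proof (cases "x \<in> {a..b}")
  case True
  then have "\<bar>q * x\<bar> \<le> \<bar>q\<bar> * (\<bar>a\<bar> + \<bar>b\<bar>)" by (auto simp: abs_mult intro!: mult_left_mono)
  moreover have "cmod (of_real p + of_real q * of_real x) = \<bar>p + q * x\<bar>"
    by (metis norm_of_real of_real_add of_real_mult)
  ultimately show ?thesis using True abs_triangle_ineq[of p "q * x"] by (simp add: affine_window_def)
qed (simp add: affine_window_def)

lemma integrable_affine_window: "integrable lborel (affine_window a b p q)"
proof (rule Bochner_Integration.integrable_bound)
  show "integrable lborel (\<lambda>x. (\<bar>p\<bar> + \<bar>q\<bar> * (\<bar>a\<bar> + \<bar>b\<bar>)) * indicator {a..b} x :: real)"
    by (intro integrable_mult_right integrable_real_indicator) (auto simp: emeasure_lborel_Icc_eq)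
  show "AE x in lborel. cmod (affine_window a b p q x) \<le> norm ((\<bar>p\<bar> + \<bar>q\<bar> * (\<bar>a\<bar> + \<bar>b\<bar>)) * indicator {a..b} x :: real)"
    using affine_window_bound[of a b p q] by (intro AE_I2) (auto intro: order_trans)
qed simp

text \<open>One integration by parts: the boundary values and the transform of the constant slope
  \<open>q\<close> bound \<open>u\<close> times the transform. The jumps at the ends prevent faster
  decay in general, so integrability needs a second factor of this kind.\<close>

lemma affine_window_transform_bound:
  assumes "a \<le> b"
  obtains M where "\<And>u. (1 + \<bar>u\<bar>) * cmod (LINT x|lborel. affine_window a b p q x * cis (u * x)) \<le> M"
proof -
  define N where "N = (LINT x|lborel. cmod (affine_window a b p q x))"
  define M where "M = N + (\<bar>p + q * a\<bar> + \<bar>p + q * b\<bar> + \<bar>q\<bar> * (b - a))"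
  have "(1 + \<bar>u\<bar>) * cmod (LINT x|lborel. affine_window a b p q x * cis (u * x)) \<le> M" for u
  proof -
    define I where "I = (LINT x|lborel. affine_window a b p q x * cis (u * x))"
    have ic: "integrable lborel (\<lambda>x. affine_window a b p q x * cis (u * x))"
      by (rule Bochner_Integration.integrable_bound[OF integrable_affine_window[of a b p q]]) (auto simp: norm_mult)
    have "cmod I \<le> (LINT x|lborel. cmod (affine_window a b p q x * cis (u * x)))"
      unfolding I_def by (rule integral_norm_bound)
    then have 1: "cmod I \<le> N" by (simp add: norm_mult N_def)
    define c where "c x = complex_of_real (p + q * x)" for x
    define F where "F x = c x * cis (u * x)" for x
    have D: "(F has_vector_derivative (of_real q * cis (u * x) + \<i> * of_real u * (c x * cis (u * x)))) (at x within {a..b})" for x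
    proof -
      have "((\<lambda>z. (of_real p + of_real q * z) * exp (\<i> * (of_real u * z))) has_field_derivative
         (of_real q * exp (\<i> * (of_real u * of_real x)) + \<i> * of_real u * ((of_real p + of_real q * of_real x) * exp (\<i> * (of_real u * of_real x))))) (at (of_real x))"
        by (auto intro!: derivative_eq_intros simp: algebra_simps)
      from has_vector_derivative_real_field[OF this] show ?thesis
        unfolding F_def c_def cis_conv_exp of_real_add of_real_mult .
    qed
    have "(LINT x|lborel. indicator {a..b} x *\<^sub>R (of_real q * cis (u * x) + \<i> * of_real u * (c x * cis (u * x)))) = F b - F a"
      by (rule integral_FTC_Icc[OF assms D]) (auto simp: c_def intro!: continuous_intros)
    moreover have "(LINT x|lborel. indicator {a..b} x *\<^sub>R (of_real q * cis (u * x) + \<i> * of_real u * (c x * cis (u * x))))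
       = (LINT x|lborel. affine_window a b q 0 x * cis (u * x)) + \<i> * of_real u * I"
    proof -
      have iq: "integrable lborel (\<lambda>x. affine_window a b q 0 x * cis (u * x))"
        by (rule Bochner_Integration.integrable_bound[OF integrable_affine_window[of a b q 0]]) (auto simp: norm_mult)
      have ic2: "integrable lborel (\<lambda>x. \<i> * of_real u * (affine_window a b p q x * cis (u * x)))"
        by (rule integrable_mult_right) (rule ic)
      have "(LINT x|lborel. indicator {a..b} x *\<^sub>R (of_real q * cis (u * x) + \<i> * of_real u * (c x * cis (u * x))))
        = (LINT x|lborel. affine_window a b q 0 x * cis (u * x) + \<i> * of_real u * (affine_window a b p q x * cis (u * x)))"
        by (intro Bochner_Integration.integral_cong refl) (auto simp: affine_window_def c_def split: split_indicator)
      also have "\<dots> = (LINT x|lborel. affine_window a b q 0 x * cis (u * x)) + (LINT x|lborel. \<i> * of_real u * (affine_window a b p q x * cis (u * x)))"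
        by (rule Bochner_Integration.integral_add[OF iq ic2])
      finally show ?thesis unfolding I_def by (simp only: integral_mult_right_zero)
    qed
    moreover have "cmod (LINT x|lborel. affine_window a b q 0 x * cis (u * x)) \<le> \<bar>q\<bar> * (b - a)"
    proof -
      have "cmod (LINT x|lborel. affine_window a b q 0 x * cis (u * x)) \<le> (LINT x|lborel. cmod (affine_window a b q 0 x * cis (u * x)))"
        by (rule integral_norm_bound)
      also have "\<dots> = (LINT x|lborel. \<bar>q\<bar> * indicator {a..b} x)"
        by (intro Bochner_Integration.integral_cong refl) (auto simp: affine_window_def norm_mult split: split_indicator)
      finally show ?thesis using assms by simp
    qed
    moreover have "cmod (F a) = \<bar>p + q * a\<bar>" "cmod (F b) = \<bar>p + q * b\<bar>"
      by (simp_all add: F_def c_def norm_mult del: of_real_add of_real_mult)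
    ultimately have "cmod (\<i> * of_real u * I) \<le> \<bar>p + q * a\<bar> + \<bar>p + q * b\<bar> + \<bar>q\<bar> * (b - a)"
    proof -
      let ?J = "LINT x|lborel. affine_window a b q 0 x * cis (u * x)"
      assume "(LINT x|lborel. indicator {a..b} x *\<^sub>R (of_real q * cis (u * x) + \<i> * of_real u * (c x * cis (u * x)))) = F b - F a"
       "(LINT x|lborel. indicator {a..b} x *\<^sub>R (of_real q * cis (u * x) + \<i> * of_real u * (c x * cis (u * x)))) = ?J + \<i> * of_real u * I"
       and b: "cmod ?J \<le> \<bar>q\<bar> * (b - a)" "cmod (F a) = \<bar>p + q * a\<bar>" "cmod (F b) = \<bar>p + q * b\<bar>"
      then have "\<i> * of_real u * I = F b - F a - ?J" by (metis add_diff_cancel_left')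
      moreover have "cmod (F b - F a - ?J) \<le> cmod (F b) + cmod (F a) + cmod ?J"
        by (meson norm_triangle_ineq4 norm_triangle_mono order_refl order_trans add_mono)
      ultimately show ?thesis using b by simp
    qed
    then have "\<bar>u\<bar> * cmod I \<le> \<bar>p + q * a\<bar> + \<bar>p + q * b\<bar> + \<bar>q\<bar> * (b - a)" by (simp add: norm_mult)
    with 1 have "(1 + \<bar>u\<bar>) * cmod I \<le> M" by (simp add: M_def algebra_simps)
    then show ?thesis by (simp only: I_def)
  qed
  then show ?thesis by (rule that)
qed

text \<open>The average of the affine window over \<open>[l - r, l + r]\<close>. A single averaging
  is enough here: the result is continuous, still exactly affine in the interior, compactly
  supported, and its transform is a product of two factors of order \<open>1 / (1 + |u|)\<close>,
  hence integrable. It takes the place of a smooth bump function.\<close>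

definition smoothed_window :: "real \<Rightarrow> real \<Rightarrow> real \<Rightarrow> real \<Rightarrow> real \<Rightarrow> real \<Rightarrow> complex" where
  "smoothed_window r a b p q l = (LINT t|lborel. affine_window a b p q (l - t) * affine_window (- r) r (1 / (2 * r)) 0 t)"

text \<open>The inverse transform of \<open>smoothed_window\<close>, written as a product of
  transforms so that integrability can be read off from the decay of the factors.\<close>

definition window_kernel :: "real \<Rightarrow> real \<Rightarrow> real \<Rightarrow> real \<Rightarrow> real \<Rightarrow> real \<Rightarrow> complex" where
  "window_kernel r a b p q u = (LINT x|lborel. affine_window a b p q x * cis (u * x)) *
     (LINT x|lborel. affine_window (- r) r (1 / (2 * r)) 0 x * cis (u * x)) / (2 * pi)"

lemma integrable_smoothed_window: "integrable lborel (smoothed_window r a b p q)"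
  unfolding smoothed_window_def
  by (rule integrable_lborel_conv) (rule integrable_affine_window)+

lemma smoothed_window_transform:
  "(LINT l|lborel. smoothed_window r a b p q l * cis (u * l)) = 2 * pi * window_kernel r a b p q u"
  using integral_cis_lborel_conv[OF integrable_affine_window[of a b p q] integrable_affine_window[of "-r" r "1 / (2 * r)" 0], of u]
  by (simp add: smoothed_window_def window_kernel_def)

lemma integrable_window_kernel:
  assumes "a \<le> b" "r > 0"
  shows "integrable lborel (window_kernel r a b p q)"
proof -
  define F where "F u = (LINT x|lborel. affine_window a b p q x * cis (u * x))" for u
  define G where "G u = (LINT x|lborel. affine_window (- r) r (1 / (2 * r)) 0 x * cis (u * x))" for u
  obtain M where M: "\<And>u. (1 + \<bar>u\<bar>) * cmod (F u) \<le> M"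
    by (rule affine_window_transform_bound[OF assms(1), of p q, folded F_def], rule that)
  have le: "- r \<le> r" using assms by simp
  obtain N where N: "\<And>u. (1 + \<bar>u\<bar>) * cmod (G u) \<le> N"
    by (rule affine_window_transform_bound[OF le, of "1 / (2 * r)" 0, folded G_def], rule that)
  have [measurable]: "F \<in> borel_measurable borel" "G \<in> borel_measurable borel"
    unfolding F_def G_def by measurable
  have "integrable lborel (\<lambda>u. F u * G u)"
  proof (rule Bochner_Integration.integrable_bound)
    show "integrable lborel (\<lambda>u. (M * N) * inverse (1 + u\<^sup>2))"
      using integrable_inverse_1_plus_square_UNIV by simp
    show "AE u in lborel. cmod (F u * G u) \<le> norm ((M * N) * inverse (1 + u\<^sup>2))"
    proof (rule AE_I2)
      fix u :: real
      have "(1 + u\<^sup>2) \<le> (1 + \<bar>u\<bar>) * (1 + \<bar>u\<bar>)" by (simp add: algebra_simps power2_eq_square)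
      then have "(1 + u\<^sup>2) * cmod (F u * G u) \<le> ((1 + \<bar>u\<bar>) * (1 + \<bar>u\<bar>)) * cmod (F u * G u)"
        by (rule mult_right_mono) simp
      also have "\<dots> = ((1 + \<bar>u\<bar>) * cmod (F u)) * ((1 + \<bar>u\<bar>) * cmod (G u))" by (simp add: norm_mult)
      also have "\<dots> \<le> M * N" by (intro mult_mono M N) (use order_trans[OF _ M[of u]] in auto)
      finally have "cmod (F u * G u) \<le> (M * N) * inverse (1 + u\<^sup>2)"
        by (simp add: field_simps add_pos_nonneg)
      then show "cmod (F u * G u) \<le> norm ((M * N) * inverse (1 + u\<^sup>2))"
        by (metis abs_ge_self order_trans real_norm_def)
    qed
  qed simp
  then show ?thesis unfolding window_kernel_def F_def G_def by simp
qed

text \<open>Averaging over a symmetric interval reproduces affine functions, because the linear part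
  is odd around the centre (\<open>odd\<close>).\<close>

lemma smoothed_window_inside:
  assumes "r > 0" "a + r \<le> l" "l \<le> b - r"
  shows "smoothed_window r a b p q l = of_real (p + q * l)"
proof -
  have odd: "(LINT t|lborel. indicator {-r..r} t *\<^sub>R t) = (0::real)"
  proof -
    have "(LINT t|lborel. indicator {-r..r} t *\<^sub>R t) = r\<^sup>2 / 2 - (- r)\<^sup>2 / 2"
      by (rule integral_FTC_Icc)
         (use assms in \<open>auto intro!: derivative_eq_intros simp: has_real_derivative_iff_has_vector_derivative[symmetric]\<close>)
    then show ?thesis by simp
  qed
  have it: "integrable lborel (\<lambda>t. indicator {-r..r} t *\<^sub>R t :: real)"
    using borel_integrable_atLeastAtMost'[of "-r" r "\<lambda>t. t"] by (simp add: set_integrable_def continuous_on_id)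
  have "smoothed_window r a b p q l = (LINT t|lborel. complex_of_real (((p + q * l) * indicator {-r..r} t - q * (indicator {-r..r} t *\<^sub>R t)) / (2 * r)))"
    unfolding smoothed_window_def affine_window_def using assms
    by (intro Bochner_Integration.integral_cong refl) (auto simp: field_simps split: split_indicator)
  also have "\<dots> = of_real ((p + q * l) * (2 * r) / (2 * r))"
  proof -
    have "(LINT t|lborel. ((p + q * l) * indicator {-r..r} t - q * (indicator {-r..r} t *\<^sub>R t)) / (2 * r))
      = ((p + q * l) * (2 * r) - q * 0) / (2 * r)"
      unfolding integral_divide_zero
      by (subst Bochner_Integration.integral_diff) (use odd it assms in \<open>simp_all add: emeasure_lborel_Icc_eq\<close>)
    then show ?thesis by (simp only: integral_complex_of_real) simp
  qed
  finally show ?thesis using assms by simp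
qed

lemma smoothed_window_outside:
  assumes "r > 0" "l < a - r \<or> b + r < l"
  shows "smoothed_window r a b p q l = 0"
proof -
  have "affine_window a b p q (l - t) * affine_window (- r) r (1 / (2 * r)) 0 t = 0" for t
    using assms by (auto simp: affine_window_def split: split_indicator)
  then show ?thesis unfolding smoothed_window_def by (simp only: integral_zero)
qed

lemma smoothed_window_bound: "\<exists>C. \<forall>l. cmod (smoothed_window r a b p q l) \<le> C"
proof -
  let ?C = "\<bar>p\<bar> + \<bar>q\<bar> * (\<bar>a\<bar> + \<bar>b\<bar>)" let ?v = "affine_window (- r) r (1 / (2 * r)) 0"
  have b: "cmod (affine_window a b p q x) \<le> ?C" for x
    using affine_window_bound[of a b p q x] by (rule order_trans) (simp split: split_indicator)
  have "cmod (smoothed_window r a b p q l) \<le> (LINT t|lborel. ?C * cmod (?v t))" for l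
    unfolding smoothed_window_def
  proof (rule Bochner_Integration.integral_norm_bound_integral)
    show i: "integrable lborel (\<lambda>t. ?C * cmod (?v t))" using integrable_affine_window[of "-r" r] by simp
    show "integrable lborel (\<lambda>t. affine_window a b p q (l - t) * ?v t)"
      by (rule Bochner_Integration.integrable_bound[OF i]) (auto simp: norm_mult intro!: mult_right_mono order_trans[OF b])
  qed (auto simp: norm_mult intro!: mult_right_mono b)
  then show ?thesis by blast
qed

lemma continuous_smoothed_window: "continuous_on UNIV (smoothed_window r a b p q)"
proof -
  let ?C = "\<bar>p\<bar> + \<bar>q\<bar> * (\<bar>a\<bar> + \<bar>b\<bar>)" let ?v = "affine_window (- r) r (1 / (2 * r)) 0"
  have b: "cmod (affine_window a b p q x) \<le> ?C" for x
    using affine_window_bound[of a b p q x] by (rule order_trans) (simp split: split_indicator)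
  have isC: "isCont (affine_window a b p q) x" if "x \<noteq> a" "x \<noteq> b" for x
  proof -
    have "x < a \<or> b < x \<or> (a < x \<and> x < b)" using that by auto
    then consider "x \<in> {..<a} \<union> {b<..}" | "x \<in> {a<..<b}" by auto
    then show ?thesis
    proof cases
      case 1
      have "continuous_on ({..<a} \<union> {b<..}) (affine_window a b p q) \<longleftrightarrow> continuous_on ({..<a} \<union> {b<..}) (\<lambda>_. 0::complex)"
        by (intro continuous_on_cong refl) (auto simp: affine_window_def)
      then show ?thesis using 1 by (subst (asm) continuous_on_eq_continuous_at) auto
    next
      case 2
      have "continuous_on {a<..<b} (affine_window a b p q) \<longleftrightarrow> continuous_on {a<..<b} (\<lambda>x. complex_of_real (p + q * x))"
        by (intro continuous_on_cong refl) (auto simp: affine_window_def)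
      moreover have "continuous_on {a<..<b} (\<lambda>x. complex_of_real (p + q * x))" by (intro continuous_intros)
      ultimately show ?thesis using 2 by (subst (asm) (1) continuous_on_eq_continuous_at) auto
    qed
  qed
  show ?thesis
    unfolding continuous_on_sequentially
  proof (intro allI impI ballI, elim conjE)
    fix x :: "nat \<Rightarrow> real" and l assume x: "x \<longlonglongrightarrow> l"
    have "(\<lambda>n. LINT t|lborel. affine_window a b p q (x n - t) * ?v t) \<longlonglongrightarrow> (LINT t|lborel. affine_window a b p q (l - t) * ?v t)"
    proof (rule integral_dominated_convergence[where w = "\<lambda>t. ?C * cmod (?v t)"])
      \<comment> \<open>Pointwise convergence can fail only if \<open>l - t\<close> is one of the
        jumps \<open>a\<close>, \<open>b\<close>. These two values of \<open>t\<close> form a null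
        set, so the convolution is continuous although both windows jump.\<close>
      show "AE t in lborel. (\<lambda>n. affine_window a b p q (x n - t) * ?v t) \<longlonglongrightarrow> affine_window a b p q (l - t) * ?v t"
        using AE_lborel_singleton[of "l - a"] AE_lborel_singleton[of "l - b"]
      proof eventually_elim
        case (elim t)
        have "(\<lambda>n. x n - t) \<longlonglongrightarrow> l - t" by (intro tendsto_intros x)
        then have "(\<lambda>n. affine_window a b p q (x n - t)) \<longlonglongrightarrow> affine_window a b p q (l - t)"
          by (rule isCont_tendsto_compose[rotated]) (rule isC, use elim in auto)
        then show ?case by (intro tendsto_intros)
      qed
      show "AE t in lborel. cmod (affine_window a b p q (x n - t) * ?v t) \<le> ?C * cmod (?v t)" for n
        by (intro AE_I2) (auto simp: norm_mult intro!: mult_right_mono b)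
    qed (use integrable_affine_window[of "-r" r] in auto)
    then show "(smoothed_window r a b p q \<circ> x) \<longlonglongrightarrow> smoothed_window r a b p q l"
      by (simp add: smoothed_window_def o_def)
  qed
qed

text \<open>Inversion with the roles exchanged: the smoothed window is the function, and the kernel,
  up to \<open>2 * pi\<close>, its transform.\<close>

lemma window_kernel_fourier:
  assumes "a \<le> b" "r > 0"
  shows "(LINT u|lborel. window_kernel r a b p q u * cis (- (u * l))) = smoothed_window r a b p q l"
proof -
  obtain C where C: "\<And>l. cmod (smoothed_window r a b p q l) \<le> C" using smoothed_window_bound by blast
  have "(LINT u|lborel. (2 * pi * window_kernel r a b p q u) * cis (- (u * l))) = 2 * pi * smoothed_window r a b p q l"
    by (rule fourier_inversion_1d[OF continuous_smoothed_window C integrable_smoothed_window])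
       (use smoothed_window_transform[of r a b p q] integrable_window_kernel[OF assms] in auto)
  then show ?thesis by (simp add: mult.assoc)
qed

section \<open>The Poisson kernel on the line\<close>

definition poisson_kernel :: "real \<Rightarrow> real \<Rightarrow> complex" where
  "poisson_kernel s t = of_real (s / (pi * (s\<^sup>2 + t\<^sup>2)))"

lemma integrable_poisson_kernel:
  assumes "s > 0" shows "integrable lborel (poisson_kernel s)"
proof -
  have "integrable lborel (\<lambda>x::real. inverse (1 + (inverse s * x)\<^sup>2))"
    using lborel_integrable_affine[OF _ integrable_inverse_1_plus_square_UNIV, of "inverse s" 0] assms by simp
  then have "integrable lborel (\<lambda>x. inverse (pi * s) * inverse (1 + (inverse s * x)\<^sup>2))" by simp
  also have "(\<lambda>x. inverse (pi * s) * inverse (1 + (inverse s * x)\<^sup>2)) = (\<lambda>x. s / (pi * (s\<^sup>2 + x\<^sup>2)))"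
  proof
    fix x
    have "s\<^sup>2 + x\<^sup>2 = s\<^sup>2 * (1 + (inverse s * x)\<^sup>2)" using assms by (simp add: field_simps)
    then show "inverse (pi * s) * inverse (1 + (inverse s * x)\<^sup>2) = s / (pi * (s\<^sup>2 + x\<^sup>2))"
      using assms by (simp add: power2_eq_square divide_inverse)
  qed
  finally show ?thesis unfolding poisson_kernel_def by (rule integrable_of_real)
qed

lemma poisson_kernel_fourier:
  assumes s: "s > 0"
  shows "(LINT u|lborel. poisson_kernel s u * cis (- (u * l))) = of_real (exp (- (s * \<bar>l\<bar>)))"
proof -
  have "(LINT u|lborel. (2 * pi * poisson_kernel s u) * cis (- (u * l))) = 2 * pi * complex_of_real (exp (- (s * \<bar>l\<bar>)))"
  proof (rule fourier_inversion_1d)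
    show "continuous_on UNIV (\<lambda>l. complex_of_real (exp (- (s * \<bar>l\<bar>))))" by (intro continuous_intros)
    show "cmod (complex_of_real (exp (- (s * \<bar>x\<bar>)))) \<le> 1" for x using s by simp
    show "integrable lborel (\<lambda>l. complex_of_real (exp (- (s * \<bar>l\<bar>))))"
      by (intro integrable_of_real integrable_exp_abs s)
    show "2 * pi * poisson_kernel s u = (LINT x|lborel. of_real (exp (- (s * \<bar>x\<bar>))) * cis (u * x))" for u
      unfolding exp_abs_transform[OF s] by (simp add: poisson_kernel_def)
    show "integrable lborel (\<lambda>u. 2 * pi * poisson_kernel s u)" using integrable_poisson_kernel[OF s] by simp
  qed
  then show ?thesis by (simp add: mult.assoc)
qed

text \<open>The kernel is positive, so its norm is its integral, which is the transform at 0. The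
  value 1 for every \<open>s\<close> keeps the norm of \<open>tilted_poisson\<close> bounded as
  \<open>s\<close> tends to 0.\<close>

lemma poisson_kernel_l1norm:
  assumes s: "s > 0" shows "(LINT u|lborel. cmod (poisson_kernel s u)) = 1"
proof -
  have "(LINT u|lborel. poisson_kernel s u) = 1"
    using poisson_kernel_fourier[OF s, of 0] by simp
  moreover have "poisson_kernel s u = of_real (cmod (poisson_kernel s u))" for u
    using s by (simp add: poisson_kernel_def add_pos_nonneg less_imp_le del: of_real_divide of_real_mult of_real_add)
  ultimately have "complex_of_real (LINT u|lborel. cmod (poisson_kernel s u)) = 1"
    by (metis (no_types, lifting) Bochner_Integration.integral_cong integral_complex_of_real)
  then show ?thesis by simp
qed

section \<open>Band-limited functions\<close>

lemma
  fixes f :: "'n::finite \<Rightarrow> real \<Rightarrow> 'b::{real_normed_field,banach,second_countable_topology}"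
  assumes f: "\<And>i. integrable lborel (f i)"
  shows integrable_lborel_vec_prod: "integrable lborel (\<lambda>x::real^'n. \<Prod>i\<in>UNIV. f i (x $ i))"
    and integral_lborel_vec_prod: "(LINT x|lborel. (\<Prod>i\<in>UNIV. f i (x $ i :: real))) = (\<Prod>i\<in>UNIV. LINT x|lborel. f i x)"
proof -
  interpret product_sigma_finite "\<lambda>b::real^'n. lborel :: real measure" ..
  \<comment> \<open>\<open>lborel\<close> on \<open>real^'n\<close> is the image of a product
    measure indexed by \<open>Basis\<close>; \<open>ax\<close> translates between coordinates in
    \<open>'n\<close> and basis vectors.\<close>
  define ax where "ax i = (axis i 1 :: real^'n)" for i
  have inj: "inj ax" by (auto simp: inj_def ax_def axis_eq_axis)
  have B: "(Basis :: (real^'n) set) = range ax"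
    by (auto simp: Basis_vec_def ax_def)
  define g where "g b = f (inv ax b)" for b
  have gI: "integrable lborel (g b)" for b by (simp add: g_def f)
  have [measurable]: "f i \<in> borel_measurable borel" for i
    using f borel_measurable_integrable by auto
  have comp: "(\<Sum>b\<in>Basis. x b *\<^sub>R b :: real^'n) $ i = x (ax i)" for x i
  proof -
    have "(\<Sum>b\<in>Basis. x b *\<^sub>R b :: real^'n) $ i = (\<Sum>b\<in>Basis. x b *\<^sub>R b) \<bullet> ax i"
      by (simp add: ax_def inner_axis)
    also have "\<dots> = x (ax i)"
      by (subst inner_sum_left_Basis) (auto simp: B)
    finally show ?thesis .
  qed
  have pr: "(\<Prod>i\<in>UNIV. f i ((\<Sum>b\<in>Basis. x b *\<^sub>R b :: real^'n) $ i)) = (\<Prod>b\<in>Basis. g b (x b))" for x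
  proof -
    have "(\<Prod>b\<in>Basis. g b (x b)) = (\<Prod>i\<in>UNIV. f i (x (ax i)))"
      unfolding B g_def using inj by (subst prod.reindex) auto
    then show ?thesis by (simp only: comp)
  qed
  have meas: "(\<lambda>x. \<Sum>b\<in>Basis. x b *\<^sub>R b :: real^'n) \<in> (\<Pi>\<^sub>M b\<in>(Basis::(real^'n) set). (lborel::real measure)) \<rightarrow>\<^sub>M borel"
    by measurable
  have m2: "(\<lambda>x::real^'n. \<Prod>i\<in>UNIV. f i (x $ i)) \<in> borel_measurable borel" by measurable
  show "integrable lborel (\<lambda>x::real^'n. \<Prod>i\<in>UNIV. f i (x $ i))"
    by (subst lborel_eq, subst integrable_distr_eq[OF meas m2], unfold pr)
       (rule product_integrable_prod, auto simp: gI)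
  have "(LINT x|lborel. (\<Prod>i\<in>UNIV. f i ((x::real^'n) $ i))) = (\<Prod>b\<in>(Basis::(real^'n) set). LINT x|lborel. g b x)"
    by (subst lborel_eq, subst integral_distr[OF meas m2], unfold pr)
       (rule product_integral_prod, auto simp: gI)
  also have "\<dots> = (\<Prod>i\<in>UNIV. LINT x|lborel. f i x)"
    unfolding B g_def using inj by (subst prod.reindex) auto
  finally show "(LINT x|lborel. (\<Prod>i\<in>UNIV. f i ((x::real^'n) $ i))) = (\<Prod>i\<in>UNIV. LINT x|lborel. f i x)" .
qed

lemma cis_sum: "cis (\<Sum>i\<in>I. f i) = (\<Prod>i\<in>I. cis (f i))"
  by (induction I rule: infinite_finite_induct) (auto simp: cis_mult[symmetric])

lemma cis_inner_vec: "cis ((t::real^'n) \<bullet> l) = (\<Prod>i\<in>UNIV. cis (t $ i * l $ i))"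
  by (simp add: inner_vec_def cis_sum)

lemma integrable_mult_cis:
  fixes f :: "'a::euclidean_space \<Rightarrow> complex"
  assumes "integrable lborel f" and [measurable]: "p \<in> borel_measurable borel"
  shows "integrable lborel (\<lambda>t. f t * cis (p t))"
proof -
  have [measurable]: "f \<in> borel_measurable borel" using assms borel_measurable_integrable by auto
  show ?thesis by (rule Bochner_Integration.integrable_bound[OF assms(1)]) (auto simp: norm_mult)
qed

section \<open>Band-limited functions and their convolution\<close>

definition inv_fourier :: "(real^'n \<Rightarrow> complex) \<Rightarrow> real^'n \<Rightarrow> complex" where
  "inv_fourier a t = (LINT l|lborel. a l * cis (t \<bullet> l)) / of_real ((2 * pi) ^ CARD('n))"

text \<open>Recovery from the transform is demanded at every point, not almost everywhere, so that
  equal transforms give equal functions (\<open>band_limited_eqI\<close>). Identities between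
  multipliers thereby become identities between arguments of the module action, without any appeal
  to its behaviour on null sets. \<open>S\<close> is any bounded set containing the frequencies, not
  their exact support.\<close>

definition band_limited :: "(real^'n) set \<Rightarrow> (real^'n \<Rightarrow> complex) \<Rightarrow> bool" where
  "band_limited S f \<longleftrightarrow> bounded S \<and> integrable lborel f \<and> (\<forall>l. l \<notin> S \<longrightarrow> fourier f l = 0) \<and>
     (\<forall>t. f t = inv_fourier (fourier f) t)"

lemma band_limitedD:
  assumes "band_limited S f"
  shows "bounded S" "integrable lborel f" "l \<notin> S \<Longrightarrow> fourier f l = 0" "f t = inv_fourier (fourier f) t"
  using assms by (auto simp: band_limited_def)

lemma band_limited_eqI:
  assumes "band_limited S f" "band_limited S' g" "\<And>l. fourier f l = fourier g l"
  shows "f = g"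
  using assms(1,2) unfolding band_limited_def by (metis assms(3) ext)

lemma l1norm_nonneg: "0 \<le> l1norm f"
  by (simp add: l1norm_def)

lemma l1norm_add:
  assumes "integrable lborel f" "integrable lborel g"
  shows "l1norm (\<lambda>t. f t + g t) \<le> l1norm f + l1norm g"
proof -
  have "(LINT t|lborel. cmod (f t + g t)) \<le> (LINT t|lborel. cmod (f t) + cmod (g t))"
    by (intro integral_mono norm_triangle_ineq) (use assms in auto)
  then show ?thesis using assms by (simp add: l1norm_def)
qed

lemma l1norm_cmult: "l1norm (\<lambda>t. c * f t) = cmod c * l1norm f"
  by (simp add: l1norm_def norm_mult)

lemma continuous_fourier:
  fixes f :: "real^'n \<Rightarrow> complex"
  assumes f: "integrable lborel f" shows "continuous_on UNIV (fourier f)"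
  unfolding continuous_on_sequentially
proof (intro allI impI ballI, elim conjE)
  fix x :: "nat \<Rightarrow> real^'n" and l assume x: "x \<longlonglongrightarrow> l"
  have [measurable]: "f \<in> borel_measurable borel" using f borel_measurable_integrable by auto
  have "(\<lambda>n. LINT t|lborel. f t * cis (- (t \<bullet> x n))) \<longlonglongrightarrow> (LINT t|lborel. f t * cis (- (t \<bullet> l)))"
  proof (rule integral_dominated_convergence[where w = "\<lambda>t. cmod (f t)"])
    show "AE t in lborel. (\<lambda>n. f t * cis (- (t \<bullet> x n))) \<longlonglongrightarrow> f t * cis (- (t \<bullet> l))"
      by (intro AE_I2 tendsto_intros tendsto_cis x)
  qed (use f in \<open>auto simp: norm_mult\<close>)
  then show "(fourier f \<circ> x) \<longlonglongrightarrow> fourier f l" by (simp add: fourier_def o_def)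
qed

lemma fourier_add:
  assumes "integrable lborel f" "integrable lborel g"
  shows "fourier (\<lambda>t. f t + g t) l = fourier f l + fourier g l"
  unfolding fourier_def distrib_right
  by (rule Bochner_Integration.integral_add) (rule integrable_mult_cis, use assms in auto)+

lemma fourier_cmult: "fourier (\<lambda>t. c * f t) l = c * fourier f l"
  by (simp add: fourier_def mult.assoc)

lemma l1norm_translate:
  assumes "integrable lborel f" shows "l1norm (\<lambda>t. f (t + v)) = l1norm f"
  unfolding l1norm_def by (rule lborel_integral_translate) (use assms in auto)

lemma integrable_continuous_bounded_support:
  fixes g :: "'a::euclidean_space \<Rightarrow> complex"
  assumes "continuous_on UNIV g" "bounded S" "\<And>l. l \<notin> S \<Longrightarrow> g l = 0"
  shows "integrable lborel g"
proof -
  obtain a where a: "S \<subseteq> cbox (- a) a" using bounded_subset_cbox_symmetric[OF assms(2)] by blast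
  have "integrable lborel (\<lambda>x. indicator (cbox (- a) a) x *\<^sub>R g x)"
    by (rule borel_integrable_compact) (use assms(1) continuous_on_subset in auto)
  also have "(\<lambda>x. indicator (cbox (- a) a) x *\<^sub>R g x) = g"
    using a assms(3) by (auto simp: fun_eq_iff split: split_indicator)
  finally show ?thesis .
qed

lemma band_limited_integrable_symbol:
  assumes "band_limited S f" "continuous_on UNIV p"
  shows "integrable lborel (\<lambda>l. p l * fourier f l)"
  by (rule integrable_continuous_bounded_support[of _ S])
     (use assms in \<open>auto intro!: continuous_intros continuous_fourier simp: band_limited_def\<close>)

lemma integrable_conv: "integrable lborel f \<Longrightarrow> integrable lborel g \<Longrightarrow> integrable lborel (conv f g)"
  unfolding conv_def[abs_def] by (rule integrable_lborel_conv)

lemma l1norm_conv: "integrable lborel f \<Longrightarrow> integrable lborel g \<Longrightarrow> l1norm (conv f g) \<le> l1norm f * l1norm g"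
  unfolding conv_def[abs_def] l1norm_def by (rule integral_norm_lborel_conv)

lemma fourier_conv:
  assumes "integrable lborel f" "integrable lborel g"
  shows "fourier (conv f g) l = fourier f l * fourier g l"
  using integral_cis_lborel_conv[OF assms, of "- l"] by (simp add: fourier_def conv_def inner_commute)

lemma conv_commute:
  fixes f g :: "real^'n \<Rightarrow> complex"
  shows "conv f g = conv g f"
proof
  fix s
  have *: "(LINT t|lborel. f (s - t) * g t) = (LINT t|lborel. g (s - t) * f t)"
    if "integrable lborel (\<lambda>t. f (s - t) * g t)" for f g :: "real^'n \<Rightarrow> complex"
    using lborel_integral_reflect[OF that, of s] by (simp add: mult.commute)
  \<comment> \<open>No integrability is assumed: if one of the integrands is integrable, the
    reflection applies; if neither is, both integrals have the default value 0.\<close>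
  show "conv f g s = conv g f s"
    unfolding conv_def
    by (metis (no_types, lifting) * not_integrable_integral_eq)
qed

text \<open>Only \<open>g\<close> comes with an inversion formula; inserting it and exchanging the
  integrals gives one for the convolution. Hence convolution with any integrable \<open>f\<close>
  preserves band-limitation, which is the fact behind \<open>conv_eqI\<close> and
  \<open>conv_absorb\<close>.\<close>

lemma conv_eq_inv_fourier:
  fixes f g :: "real^'n \<Rightarrow> complex"
  assumes f: "integrable lborel f" and g: "band_limited S g"
  shows "conv f g s = inv_fourier (\<lambda>l. fourier f l * fourier g l) s"
proof -
  let ?c = "complex_of_real ((2 * pi) ^ CARD('n))"
  have [measurable]: "f \<in> borel_measurable borel" using f borel_measurable_integrable by auto
  have G: "integrable lborel (fourier g)" using band_limited_integrable_symbol[OF g, of "\<lambda>_. 1"] by simp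
  then have [measurable]: "fourier g \<in> borel_measurable borel" using borel_measurable_integrable by auto
  have gt: "g t = (LINT l|lborel. fourier g l * cis (t \<bullet> l)) / ?c" for t
    using band_limitedD(4)[OF g, of t] by (simp only: inv_fourier_def)
  have "conv f g s = conv g f s" by (simp add: conv_commute)
  also have "\<dots> = (LINT t|lborel. (LINT l|lborel. f t * fourier g l * cis ((s - t) \<bullet> l)) / ?c)"
    unfolding conv_def
  proof (intro Bochner_Integration.integral_cong refl)
    fix t
    show "g (s - t) * f t = (LINT l|lborel. f t * fourier g l * cis ((s - t) \<bullet> l)) / ?c"
      unfolding gt[of "s - t"] mult.assoc integral_mult_right_zero by (simp add: mult.commute)
  qed
  also have "\<dots> = (LINT t|lborel. (LINT l|lborel. f t * fourier g l * cis ((s - t) \<bullet> l))) / ?c"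
    by (rule integral_divide_zero)
  also have "(LINT t|lborel. (LINT l|lborel. f t * fourier g l * cis ((s - t) \<bullet> l)))
    = (LINT l|lborel. (LINT t|lborel. f t * fourier g l * cis ((s - t) \<bullet> l)))"
  proof (rule lborel_pair.Fubini_integral)
    show "integrable (lborel \<Otimes>\<^sub>M lborel) (\<lambda>(l, t). f t * fourier g l * cis ((s - t) \<bullet> l))"
      by (rule Bochner_Integration.integrable_bound[OF integrable_lborel_prod_mult[OF G f]]) (auto simp: norm_mult)
  qed
  also have "\<dots> = (LINT l|lborel. fourier f l * fourier g l * cis (s \<bullet> l))"
  proof (intro Bochner_Integration.integral_cong refl)
    fix l
    have "(LINT t|lborel. f t * fourier g l * cis ((s - t) \<bullet> l)) = (LINT t|lborel. (f t * cis (- (t \<bullet> l))) * (fourier g l * cis (s \<bullet> l)))"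
      by (intro Bochner_Integration.integral_cong refl) (simp add: cis_mult inner_diff_left mult_ac)
    also have "\<dots> = fourier f l * (fourier g l * cis (s \<bullet> l))"
      unfolding integral_mult_left_zero by (simp only: fourier_def[of f])
    finally show "(LINT t|lborel. f t * fourier g l * cis ((s - t) \<bullet> l)) = fourier f l * fourier g l * cis (s \<bullet> l)"
      by (simp only: mult.assoc)
  qed
  finally show ?thesis by (simp add: inv_fourier_def)
qed

lemma band_limited_conv:
  assumes f: "integrable lborel f" and g: "band_limited S g"
  shows "band_limited S (conv f g)"
  using assms conv_eq_inv_fourier[OF f g]
  by (auto simp: band_limited_def integrable_conv fourier_conv inv_fourier_def)

text \<open>Turns an identity between multipliers into one between kernels; through
  \<open>act_conv\<close> it becomes an identity in the module.\<close>

lemma conv_eqI: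
  assumes f: "integrable lborel f" and g: "band_limited S g" and h: "band_limited S' h"
    and eq: "\<And>l. fourier h l = fourier f l * fourier g l"
  shows "conv f g = h"
  by (rule band_limited_eqI[OF band_limited_conv[OF f g] h])
     (use eq f g in \<open>simp add: fourier_conv band_limited_def\<close>)

lemma conv_absorb:
  assumes f: "integrable lborel f" and g: "band_limited S g" and one: "\<And>l. l \<in> S \<Longrightarrow> fourier f l = 1"
  shows "conv f g = g"
  by (rule conv_eqI[OF f g g]) (metis one band_limitedD(3)[OF g] mult_1 mult_zero_right)

lemma band_limited_add:
  assumes f: "band_limited S f" and g: "band_limited S g"
  shows "band_limited S (\<lambda>t. f t + g t)"
proof -
  have F: "fourier (\<lambda>t. f t + g t) = (\<lambda>l. fourier f l + fourier g l)"
    by (intro ext fourier_add band_limitedD(2)[OF f] band_limitedD(2)[OF g])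
  have "integrable lborel (fourier f)" "integrable lborel (fourier g)"
    using band_limited_integrable_symbol[of S _ "\<lambda>_. 1"] f g by auto
  then have "inv_fourier (\<lambda>l. fourier f l + fourier g l) t = inv_fourier (fourier f) t + inv_fourier (fourier g) t" for t
    by (simp add: inv_fourier_def distrib_right integrable_mult_cis add_divide_distrib)
  then show ?thesis unfolding band_limited_def F
    using band_limitedD[OF f] band_limitedD[OF g] by (metis Bochner_Integration.integrable_add add_0)
qed

lemma band_limited_cmult:
  assumes f: "band_limited S f" shows "band_limited S (\<lambda>t. c * f t)"
proof -
  have F: "fourier (\<lambda>t. c * f t) = (\<lambda>l. c * fourier f l)" by (simp add: fun_eq_iff fourier_cmult)
  have "inv_fourier (\<lambda>l. c * fourier f l) t = c * inv_fourier (fourier f) t" for t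
    by (simp add: inv_fourier_def mult.assoc)
  then show ?thesis using f unfolding band_limited_def F by (metis integrable_mult_right mult_zero_right)
qed

section \<open>Product kernels, plateaus and coordinate multipliers\<close>

lemma fourier_prod:
  fixes k :: "'n::finite \<Rightarrow> real \<Rightarrow> complex"
  assumes k: "\<And>i. integrable lborel (k i)"
  shows "fourier (\<lambda>t::real^'n. \<Prod>i\<in>UNIV. k i (t $ i)) l = (\<Prod>i\<in>UNIV. LINT u|lborel. k i u * cis (- (u * l $ i)))"
proof -
  have "fourier (\<lambda>t::real^'n. \<Prod>i\<in>UNIV. k i (t $ i)) l = (LINT t|lborel. (\<Prod>i\<in>UNIV. k i (t $ i) * cis (- (t $ i * l $ i))))"
  proof -
    have "cis (- ((t::real^'n) \<bullet> l)) = (\<Prod>i\<in>UNIV. cis (- (t $ i * l $ i)))" for t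
      using cis_inner_vec[of t "- l"] by simp
    then show ?thesis by (simp only: fourier_def prod.distrib)
  qed
  also have "\<dots> = (\<Prod>i\<in>UNIV. LINT u|lborel. k i u * cis (- (u * l $ i)))"
    by (rule integral_lborel_vec_prod) (rule integrable_mult_cis, use k in auto)
  finally show ?thesis .
qed

lemma l1norm_prod:
  fixes k :: "'n::finite \<Rightarrow> real \<Rightarrow> complex"
  assumes k: "\<And>i. integrable lborel (k i)"
  shows "l1norm (\<lambda>t::real^'n. \<Prod>i\<in>UNIV. k i (t $ i)) = (\<Prod>i\<in>UNIV. LINT u|lborel. cmod (k i u))"
  unfolding l1norm_def prod_norm[symmetric] by (rule integral_lborel_vec_prod) (use k in auto)

lemma band_limited_prod:
  fixes k \<alpha> :: "'n::finite \<Rightarrow> real \<Rightarrow> complex" and A B :: "real^'n"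
  assumes k: "\<And>i. integrable lborel (k i)" and a: "\<And>i. integrable lborel (\<alpha> i)"
    and ft: "\<And>i x. (LINT u|lborel. k i u * cis (- (u * x))) = \<alpha> i x"
    and inv: "\<And>i u. (LINT x|lborel. \<alpha> i x * cis (u * x)) = 2 * pi * k i u"
    and supp: "\<And>i x. x < A $ i \<or> B $ i < x \<Longrightarrow> \<alpha> i x = 0"
  shows "band_limited (cbox A B) (\<lambda>t. \<Prod>i\<in>UNIV. k i (t $ i))" (is "band_limited _ ?f")
    and "fourier (\<lambda>t. \<Prod>i\<in>UNIV. k i (t $ i)) l = (\<Prod>i\<in>UNIV. \<alpha> i (l $ i))"
proof -
  show F: "fourier ?f l = (\<Prod>i\<in>UNIV. \<alpha> i (l $ i))" for l
    by (simp add: fourier_prod[OF k] ft)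
  have fi: "integrable lborel ?f" by (rule integrable_lborel_vec_prod) (rule k)
  have "?f t = inv_fourier (fourier ?f) t" for t
  proof -
    have "(LINT l|lborel. fourier ?f l * cis (t \<bullet> l)) = (LINT l|lborel. (\<Prod>i\<in>UNIV. \<alpha> i (l $ i) * cis (t $ i * l $ i)))"
      by (simp only: F cis_inner_vec prod.distrib)
    also have "\<dots> = (\<Prod>i\<in>UNIV. LINT x|lborel. \<alpha> i x * cis (t $ i * x))"
      by (rule integral_lborel_vec_prod) (rule integrable_mult_cis, use a in auto)
    also have "\<dots> = of_real ((2 * pi) ^ CARD('n)) * ?f t"
      by (simp add: inv prod.distrib)
    finally show ?thesis by (simp add: inv_fourier_def)
  qed
  moreover have "fourier ?f l = 0" if nl: "l \<notin> cbox A B" for l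
  proof -
    obtain i where "l $ i < A $ i \<or> B $ i < l $ i" using nl by (auto simp: mem_box_cart not_le)
    then have "\<alpha> i (l $ i) = 0" by (rule supp)
    then have "\<exists>i\<in>UNIV. \<alpha> i (l $ i) = 0" by (rule bexI) simp
    then show ?thesis unfolding F by (intro prod_zero finite)
  qed
  ultimately show "band_limited (cbox A B) ?f"
    unfolding band_limited_def using fi bounded_cbox by blast
qed

definition box_kernel :: "real \<Rightarrow> real^'n \<Rightarrow> real^'n \<Rightarrow> real^'n \<Rightarrow> complex" where
  "box_kernel r a b t = (\<Prod>i\<in>UNIV. window_kernel r (a $ i) (b $ i) 1 0 (t $ i))"

lemma
  fixes a b :: "real^'n"
  assumes r: "r > 0" and ab: "\<And>i. a $ i \<le> b $ i"
  shows band_limited_box_kernel: "band_limited (cbox (\<chi> i. a $ i - r) (\<chi> i. b $ i + r)) (box_kernel r a b)"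
    and fourier_box_kernel_inside: "l \<in> cbox (\<chi> i. a $ i + r) (\<chi> i. b $ i - r) \<Longrightarrow> fourier (box_kernel r a b) l = 1"
proof -
  note * = band_limited_prod[of "\<lambda>i. window_kernel r (a $ i) (b $ i) 1 0" "\<lambda>i. smoothed_window r (a $ i) (b $ i) 1 0"
       "\<chi> i. a $ i - r" "\<chi> i. b $ i + r", OF integrable_window_kernel[OF ab r] integrable_smoothed_window
       window_kernel_fourier[OF ab r] smoothed_window_transform]
  have bk: "box_kernel r a b = (\<lambda>t. \<Prod>i\<in>UNIV. window_kernel r (a $ i) (b $ i) 1 0 (t $ i))"
    by (simp add: box_kernel_def fun_eq_iff)
  show "band_limited (cbox (\<chi> i. a $ i - r) (\<chi> i. b $ i + r)) (box_kernel r a b)"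
    unfolding bk by (rule *(1)) (auto intro: smoothed_window_outside[OF r])
  assume l: "l \<in> cbox (\<chi> i. a $ i + r) (\<chi> i. b $ i - r)"
  have "fourier (box_kernel r a b) l = (\<Prod>i\<in>UNIV. smoothed_window r (a $ i) (b $ i) 1 0 (l $ i))"
    unfolding bk by (rule *(2)) (auto intro: smoothed_window_outside[OF r])
  also have "\<dots> = 1"
    by (rule prod.neutral) (use l smoothed_window_inside[OF r, of _ _ _ 1 0] in \<open>auto simp: mem_box_cart\<close>)
  finally show "fourier (box_kernel r a b) l = 1" .
qed

lemma band_limited_plateau:
  fixes S :: "(real^'n) set"
  assumes "bounded S"
  obtains \<psi> S' where "band_limited S' \<psi>" "\<And>l. l \<in> S \<Longrightarrow> fourier \<psi> l = 1"
proof -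
  obtain c where c: "\<And>l. l \<in> S \<Longrightarrow> norm l \<le> c" using assms by (auto simp: bounded_iff)
  \<comment> \<open>The margin 1 is the averaging radius, so the plateau still covers the cube of
    half-side \<open>max c 0\<close>. The maximum takes care of an empty \<open>S\<close>, for which
    \<open>c\<close> could be negative.\<close>
  define a where "a = (\<chi> i::'n. max c 0 + 1)"
  have "fourier (box_kernel 1 (- a) a) l = 1" if "l \<in> S" for l
  proof (rule fourier_box_kernel_inside)
    have "\<bar>l $ i\<bar> \<le> c" for i using c[OF that] component_le_norm_cart[of l i] by simp
    then show "l \<in> cbox (\<chi> i. (- a) $ i + 1) (\<chi> i. a $ i - 1)"
      by (auto simp: mem_box_cart a_def abs_le_iff minus_le_iff max.coboundedI1)
  qed (auto simp: a_def)
  moreover have "band_limited (cbox (\<chi> i. (- a) $ i - 1) (\<chi> i. a $ i + 1)) (box_kernel 1 (- a) a)"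
    by (rule band_limited_box_kernel) (auto simp: a_def)
  ultimately show ?thesis using that by blast
qed

text \<open>The source of Bernstein's inequality in L1: convolving a function with frequencies in
  \<open>S\<close> with \<open>N\<close> gives \<open>- \<i>\<close> times its derivative along
  \<open>v\<close>, at a cost linear in \<open>norm v\<close>.\<close>

lemma coordinate_multiplier:
  fixes S :: "(real^'n) set"
  assumes "bounded S"
  obtains K where "K \<ge> 0" "\<And>v. \<exists>N. integrable lborel N \<and> l1norm N \<le> K * norm v \<and> (\<forall>l\<in>S. fourier N l = of_real (v \<bullet> l))"
proof -
  obtain c where c: "\<And>l. l \<in> S \<Longrightarrow> norm l \<le> c" using assms by (auto simp: bounded_iff)
  define R where "R = max c 0 + 1"
  have R: "R \<ge> 1" by (simp add: R_def)
  \<comment> \<open>Coordinate \<open>i\<close> receives the identity window and every other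
    coordinate the constant one, so on \<open>S\<close> the transform of the product is
    \<open>l $ i\<close>.\<close>
  define k where "k i j = window_kernel 1 (- R) R (if j = i then 0 else 1) (if j = i then 1 else 0)" for i j :: 'n
  have ki: "integrable lborel (k i j)" for i j unfolding k_def by (rule integrable_window_kernel) (use R in auto)
  define N where "N i t = (\<Prod>j\<in>UNIV. k i j (t $ j))" for i and t :: "real^'n"
  have Ni: "integrable lborel (N i)" for i unfolding N_def by (rule integrable_lborel_vec_prod) (rule ki)
  have NF: "fourier (N i) l = of_real (l $ i)" if "l \<in> S" for i l
  proof -
    have "\<bar>l $ j\<bar> \<le> c" for j using c[OF that] component_le_norm_cart[of l j] by simp
    then have lj: "- R + 1 \<le> l $ j" "l $ j \<le> R - 1" for j
      by (smt (verit) R_def)+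
    have "fourier (N i) l = (\<Prod>j\<in>UNIV. LINT u|lborel. k i j u * cis (- (u * l $ j)))"
      unfolding N_def by (rule fourier_prod) (rule ki)
    also have "\<dots> = (\<Prod>j\<in>UNIV. of_real ((if j = i then 0 else 1) + (if j = i then 1 else 0) * l $ j))"
      unfolding k_def using R lj
      by (intro prod.cong refl) (simp only: window_kernel_fourier[of "-R" R 1] smoothed_window_inside[of 1 "-R" _ R])
    also have "\<dots> = (\<Prod>j\<in>UNIV. if j = i then of_real (l $ j) else 1)"
      by (intro prod.cong refl) auto
    finally show ?thesis by simp
  qed
  define K where "K = (\<Sum>i\<in>UNIV. l1norm (N i))"
  show ?thesis
  proof (rule that[of K])
    show "K \<ge> 0" unfolding K_def by (intro sum_nonneg l1norm_nonneg)
    fix v :: "real^'n"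
    define M where "M t = (\<Sum>i\<in>UNIV. of_real (v $ i) * N i t)" for t
    have 1: "integrable lborel M" unfolding M_def using Ni by auto
    have "l1norm M \<le> (LINT t|lborel. (\<Sum>i\<in>UNIV. \<bar>v $ i\<bar> * cmod (N i t)))"
      unfolding l1norm_def M_def
      by (intro integral_mono) (use Ni in \<open>auto intro!: sum_norm_le simp: norm_mult\<close>)
    also have "\<dots> = (\<Sum>i\<in>UNIV. \<bar>v $ i\<bar> * l1norm (N i))"
      unfolding l1norm_def by (subst Bochner_Integration.integral_sum) (use Ni in auto)
    also have "\<dots> \<le> (\<Sum>i\<in>UNIV. norm v * l1norm (N i))"
      by (intro sum_mono mult_right_mono component_le_norm_cart l1norm_nonneg)
    finally have 2: "l1norm M \<le> K * norm v" by (simp add: K_def sum_distrib_left mult.commute)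
    have "fourier M l = of_real (v \<bullet> l)" if "l \<in> S" for l
    proof -
      have "fourier M l = (\<Sum>i\<in>UNIV. of_real (v $ i) * fourier (N i) l)"
        unfolding fourier_def M_def sum_distrib_right mult.assoc integral_mult_right_zero[symmetric]
        by (rule Bochner_Integration.integral_sum) (use Ni in \<open>auto intro!: integrable_mult_cis\<close>)
      then show ?thesis by (simp add: NF[OF that] inner_vec_def)
    qed
    with 1 2 show "\<exists>N. integrable lborel N \<and> l1norm N \<le> K * norm v \<and> (\<forall>l\<in>S. fourier N l = of_real (v \<bullet> l))" by blast
  qed
qed

section \<open>Complex translations of band-limited functions\<close>

lemma
  fixes u :: "nat \<Rightarrow> real^'n \<Rightarrow> complex"
  assumes i: "\<And>k. integrable lborel (u k)" and s: "\<And>t. summable (\<lambda>k. cmod (u k t))"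
    and F: "\<And>t. (\<lambda>k. u k t) sums F t"
    and b: "\<And>k. l1norm (u k) \<le> c k" and c: "summable c"
  shows integrable_l1_series: "integrable lborel F"
    and l1norm_l1_series: "l1norm F \<le> (\<Sum>k. c k)"
    and fourier_l1_series: "(\<lambda>k. fourier (u k) l) sums fourier F l"
proof -
  have F': "F = (\<lambda>t. \<Sum>k. u k t)" using F by (auto simp: sums_iff)
  have sl: "summable (\<lambda>k. l1norm (u k))"
    by (rule summable_comparison_test[OF _ c]) (use b in \<open>auto intro!: exI[of _ 0] simp: abs_of_nonneg[OF l1norm_nonneg]\<close>)
  then have sn: "summable (\<lambda>k. LINT t|lborel. norm (u k t))" by (simp add: l1norm_def)
  show iF: "integrable lborel F" unfolding F' by (rule integrable_suminf[OF i]) (use s sn in auto)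
  have nn: "integrable lborel (\<lambda>t. \<Sum>k. cmod (u k t))" "(LINT t|lborel. (\<Sum>k. cmod (u k t))) = (\<Sum>k. l1norm (u k))"
    unfolding l1norm_def
    by (rule integrable_suminf integral_suminf; use i s sn in auto)+
  have "l1norm F \<le> (LINT t|lborel. (\<Sum>k. cmod (u k t)))"
    unfolding l1norm_def by (rule integral_mono) (use iF nn s in \<open>auto simp: F' summable_norm\<close>)
  also have "\<dots> \<le> (\<Sum>k. c k)" unfolding nn by (rule suminf_le[OF b sl c])
  finally show "l1norm F \<le> (\<Sum>k. c k)" .
  have "(\<lambda>k. LINT t|lborel. u k t * cis (- (t \<bullet> l))) sums (LINT t|lborel. (\<Sum>k. u k t * cis (- (t \<bullet> l))))"
    by (rule sums_integral) (use s sn i in \<open>auto intro!: integrable_mult_cis simp: norm_mult\<close>)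
  moreover have "(\<Sum>k. u k t * cis (- (t \<bullet> l))) = F t * cis (- (t \<bullet> l))" for t
    using sums_mult2[OF F] by (simp add: sums_iff)
  ultimately show "(\<lambda>k. fourier (u k) l) sums fourier F l" by (simp add: fourier_def)
qed

text \<open>\<open>cshift v z f\<close> is the translate \<open>f (t + z v)\<close> along a complex multiple of \<open>v\<close> (analytic continuation).\<close>

definition cshift :: "real^'n \<Rightarrow> complex \<Rightarrow> (real^'n \<Rightarrow> complex) \<Rightarrow> real^'n \<Rightarrow> complex" where
  "cshift v z f = inv_fourier (\<lambda>l. exp (\<i> * z * of_real (v \<bullet> l)) * fourier f l)"

text \<open>This is \<open>(- \<i> D) ^ k f\<close> with \<open>D\<close> the derivative along
  \<open>v\<close>, formed on the frequency side so that no differentiability has to be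
  discussed.\<close>

definition symbol_power :: "real^'n \<Rightarrow> nat \<Rightarrow> (real^'n \<Rightarrow> complex) \<Rightarrow> real^'n \<Rightarrow> complex" where
  "symbol_power v k f = inv_fourier (\<lambda>l. of_real (v \<bullet> l) ^ k * fourier f l)"

definition dir_deriv :: "real^'n \<Rightarrow> (real^'n \<Rightarrow> complex) \<Rightarrow> real^'n \<Rightarrow> complex" where
  "dir_deriv v f = (\<lambda>t. \<i> * symbol_power v 1 f t)"

text \<open>On frequencies in \<open>S\<close> the multiplier \<open>v \<bullet> l\<close> is
  convolution with \<open>N\<close>. Iterating this gives the geometric norm bound that makes the
  exponential series converge in L1.\<close>

lemma symbol_power_band_limited:
  fixes S :: "(real^'n) set"
  assumes N: "integrable lborel N" "\<And>l. l \<in> S \<Longrightarrow> fourier N l = of_real (v \<bullet> l)"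
    and f: "band_limited S f"
  shows "band_limited S (symbol_power v k f) \<and> (\<forall>l. fourier (symbol_power v k f) l = of_real (v \<bullet> l) ^ k * fourier f l) \<and>
     l1norm (symbol_power v k f) \<le> l1norm N ^ k * l1norm f"
proof (induction k)
  case 0
  have "symbol_power v 0 f = f" using band_limitedD(4)[OF f] by (auto simp: symbol_power_def)
  then show ?case using f by simp
next
  case (Suc k)
  let ?g = "symbol_power v k f"
  have g: "band_limited S ?g" and gi: "integrable lborel ?g" using Suc band_limitedD(2) by blast+
  have F: "fourier N l * fourier ?g l = of_real (v \<bullet> l) ^ Suc k * fourier f l" for l
  proof (cases "l \<in> S")
    case True then show ?thesis using Suc N(2) by simp
  next
    case False then show ?thesis using Suc band_limitedD(3)[OF f] by simp
  qed
  have eq: "symbol_power v (Suc k) f = conv N ?g"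
    unfolding symbol_power_def[of v "Suc k"] F[symmetric] by (intro ext conv_eq_inv_fourier[symmetric, OF N(1) g])
  have "l1norm (conv N ?g) \<le> l1norm N * l1norm ?g" by (rule l1norm_conv[OF N(1) gi])
  also have "\<dots> \<le> l1norm N * (l1norm N ^ k * l1norm f)" using Suc by (intro mult_left_mono l1norm_nonneg) auto
  finally show ?case unfolding eq using band_limited_conv[OF N(1) g] fourier_conv[OF N(1) gi] F by simp
qed

text \<open>Expand the exponential inside the inverse transform; since \<open>S\<close> is bounded,
  an exponential series times \<open>cmod (fourier f l)\<close> dominates. Pointwise convergence to
  a named limit is what \<open>integrable_l1_series\<close> asks for.\<close>

lemma cshift_sums:
  fixes S :: "(real^'n) set"
  assumes f: "band_limited S f"
  shows "summable (\<lambda>k. cmod ((\<i> * z) ^ k / fact k * symbol_power v k f t))"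
    and "(\<lambda>k. (\<i> * z) ^ k / fact k * symbol_power v k f t) sums cshift v z f t"
proof -
  obtain c where c: "\<And>l. l \<in> S \<Longrightarrow> norm l \<le> c" using band_limitedD(1)[OF f] by (auto simp: bounded_iff)
  define C where "C = norm v * \<bar>c\<bar>"
  have C: "\<bar>v \<bullet> l\<bar> \<le> C" if "l \<in> S" for l
  proof -
    have "norm l \<le> \<bar>c\<bar>" using c[OF that] by linarith
    then show ?thesis unfolding C_def using Cauchy_Schwarz_ineq2[of v l] mult_left_mono[of "norm l" "\<bar>c\<bar>" "norm v"] by force
  qed
  let ?w = "\<lambda>k l. (\<i> * z) ^ k / fact k * (of_real (v \<bullet> l) ^ k * fourier f l * cis (t \<bullet> l))"
  let ?c = "complex_of_real ((2 * pi) ^ CARD('n))"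
  have fi: "integrable lborel (fourier f)" using band_limited_integrable_symbol[OF f, of "\<lambda>_. 1"] by simp
  have pi: "integrable lborel (\<lambda>l. of_real (v \<bullet> l) ^ k * fourier f l * cis (t \<bullet> l))" for k
    by (rule integrable_mult_cis, rule band_limited_integrable_symbol[OF f]) (auto intro!: continuous_intros)
  have wi: "integrable lborel (?w k)" for k by (rule integrable_mult_right[OF pi])
  have ptw: "cmod (?w k l) \<le> (cmod z * C) ^ k / fact k * cmod (fourier f l)" for k l
  proof (cases "l \<in> S")
    case True
    have "\<bar>v \<bullet> l\<bar> ^ k \<le> C ^ k" using C[OF True] by (rule power_mono) simp
    then have "cmod z ^ k / fact k * (\<bar>v \<bullet> l\<bar> ^ k * cmod (fourier f l)) \<le> cmod z ^ k / fact k * (C ^ k * cmod (fourier f l))"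
      by (intro mult_left_mono mult_right_mono) auto
    then show ?thesis by (simp add: norm_mult norm_divide norm_power power_mult_distrib)
  next
    case False then show ?thesis using band_limitedD(3)[OF f] by simp
  qed
  have sx: "summable (\<lambda>k. (cmod z * C) ^ k / fact k * L)" for L :: real
    using summable_mult2[OF summable_exp_generic[of "cmod z * C"], of L] by (simp add: divide_inverse mult_ac)
  have ib: "(LINT l|lborel. cmod (?w k l)) \<le> (cmod z * C) ^ k / fact k * (LINT l|lborel. cmod (fourier f l))" for k
    unfolding integral_mult_right_zero[symmetric] by (intro integral_mono ptw) (use wi fi in auto)
  have sn: "summable (\<lambda>k. LINT l|lborel. norm (?w k l))"
    by (rule summable_comparison_test[OF _ sx]) (use ib in auto)
  have eq: "(LINT l|lborel. ?w k l) / ?c = (\<i> * z) ^ k / fact k * symbol_power v k f t" for k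
    by (simp only: integral_mult_right_zero symbol_power_def inv_fourier_def times_divide_eq_right)
  have "(\<lambda>k. LINT l|lborel. ?w k l) sums (LINT l|lborel. (\<Sum>k. ?w k l))"
  proof (rule sums_integral[OF wi _ sn], rule AE_I2)
    fix l
    show "summable (\<lambda>k. norm (?w k l))"
      by (rule summable_comparison_test'[OF sx[of "cmod (fourier f l)"], of 0]) (simp only: real_norm_def abs_norm_cancel ptw)
  qed
  moreover have "(\<Sum>k. ?w k l) = exp (\<i> * z * of_real (v \<bullet> l)) * fourier f l * cis (t \<bullet> l)" for l
  proof -
    have "(\<lambda>k. (\<i> * z * of_real (v \<bullet> l)) ^ k /\<^sub>R fact k * (fourier f l * cis (t \<bullet> l))) sums (exp (\<i> * z * of_real (v \<bullet> l)) * (fourier f l * cis (t \<bullet> l)))"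
      by (intro sums_mult2 exp_converges)
    moreover have "?w k l = (\<i> * z * of_real (v \<bullet> l)) ^ k /\<^sub>R fact k * (fourier f l * cis (t \<bullet> l))" for k
      by (simp add: power_mult_distrib scaleR_conv_of_real divide_inverse mult_ac)
    ultimately show ?thesis by (simp only: sums_iff mult.assoc)
  qed
  ultimately have "(\<lambda>k. LINT l|lborel. ?w k l) sums (LINT l|lborel. exp (\<i> * z * of_real (v \<bullet> l)) * fourier f l * cis (t \<bullet> l))" by (simp only:)
  from sums_divide[OF this, of ?c]
  show "(\<lambda>k. (\<i> * z) ^ k / fact k * symbol_power v k f t) sums cshift v z f t"
    unfolding eq by (simp only: cshift_def inv_fourier_def)
  show "summable (\<lambda>k. cmod ((\<i> * z) ^ k / fact k * symbol_power v k f t))"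
  proof (rule summable_comparison_test)
    show "summable (\<lambda>k. (LINT l|lborel. norm (?w k l)) / cmod ?c)" using sn by (rule summable_divide)
    have "cmod ((\<i> * z) ^ k / fact k * symbol_power v k f t) \<le> (LINT l|lborel. norm (?w k l)) / cmod ?c" for k
      unfolding eq[symmetric] norm_divide by (intro divide_right_mono integral_norm_bound norm_ge_zero)
    then show "\<exists>N. \<forall>k\<ge>N. norm (cmod ((\<i> * z) ^ k / fact k * symbol_power v k f t)) \<le> (LINT l|lborel. norm (?w k l)) / cmod ?c"
      by (simp only: real_norm_def abs_norm_cancel) blast
  qed
qed

text \<open>The tail from index 2 is the error of a first-order expansion;
  \<open>fact k \<le> fact (k + 2)\<close> bounds it by \<open>x^2\<close> times the whole
  series.\<close>

lemma exp_series_bounds: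
  fixes x L :: real assumes "x \<ge> 0" "L \<ge> 0"
  shows "summable (\<lambda>k. x ^ k / fact k * L)" "(\<Sum>k. x ^ k / fact k * L) = exp x * L"
    "summable (\<lambda>k. x ^ (k + 2) / fact (k + 2) * L)" "(\<Sum>k. x ^ (k + 2) / fact (k + 2) * L) \<le> x\<^sup>2 * exp x * L"
proof -
  have s: "(\<lambda>k. x ^ k / fact k * L) sums (exp x * L)"
    using sums_mult2[OF exp_converges[of x], of L] by (simp add: divide_inverse mult_ac)
  then show 1: "summable (\<lambda>k. x ^ k / fact k * L)" and "(\<Sum>k. x ^ k / fact k * L) = exp x * L"
    by (auto simp: sums_iff)
  show 2: "summable (\<lambda>k. x ^ (k + 2) / fact (k + 2) * L)"
    using summable_ignore_initial_segment[OF 1, of 2] .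
  have s2: "(\<lambda>k. x\<^sup>2 * (x ^ k / fact k * L)) sums (x\<^sup>2 * (exp x * L))" by (rule sums_mult[OF s])
  have "(\<Sum>k. x ^ (k + 2) / fact (k + 2) * L) \<le> (\<Sum>k. x\<^sup>2 * (x ^ k / fact k * L))"
  proof (rule suminf_le[OF _ 2])
    fix k
    have "fact k \<le> (fact (k + 2) :: real)" by (rule fact_mono) simp
    then have "x ^ (k + 2) / fact (k + 2) \<le> x ^ (k + 2) / fact k"
      using assms by (intro divide_left_mono) auto
    then have "x ^ (k + 2) / fact (k + 2) * L \<le> x ^ (k + 2) / fact k * L" using assms by (intro mult_right_mono)
    then show "x ^ (k + 2) / fact (k + 2) * L \<le> x\<^sup>2 * (x ^ k / fact k * L)" by (simp add: power_add power2_eq_square mult_ac)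
  qed (use s2 in \<open>auto simp: sums_iff\<close>)
  also have "\<dots> = x\<^sup>2 * exp x * L" using s2 by (simp add: sums_iff mult.assoc)
  finally show "(\<Sum>k. x ^ (k + 2) / fact (k + 2) * L) \<le> x\<^sup>2 * exp x * L" .
qed

text \<open>One \<open>K\<close>, depending on the frequency set only, serves all directions, shifts
  and functions. The last estimate, a first-order expansion with quadratic error, is the form in
  which analyticity is used later. The growth factor depends on the band and is therefore of no use
  uniformly along an approximate identity.\<close>

lemma cshift_bounds:
  fixes S :: "(real^'n) set"
  assumes S: "bounded S"
  obtains K where "K \<ge> 0"
    and "\<And>v z f l. band_limited S f \<Longrightarrow> band_limited S (cshift v z f) \<and>
       fourier (cshift v z f) l = exp (\<i> * z * of_real (v \<bullet> l)) * fourier f l \<and>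
       band_limited S (dir_deriv v f) \<and>
       l1norm (dir_deriv v f) \<le> K * norm v * l1norm f \<and>
       l1norm (cshift v z f) \<le> exp (K * norm v * cmod z) * l1norm f \<and>
       l1norm (\<lambda>t. cshift v z f t - f t - z * dir_deriv v f t) \<le> (K * norm v * cmod z)\<^sup>2 * exp (K * norm v * cmod z) * l1norm f"
proof -
  obtain K where K: "K \<ge> 0"
    and N: "\<And>v. \<exists>N. integrable lborel N \<and> l1norm N \<le> K * norm v \<and> (\<forall>l\<in>S. fourier N l = of_real (v \<bullet> l))"
    using coordinate_multiplier[OF S] by metis
  show ?thesis
  proof (rule that[OF K])
    fix v z f l assume f: "band_limited S f"
    obtain N where N: "integrable lborel N" "l1norm N \<le> K * norm v" "\<And>l. l \<in> S \<Longrightarrow> fourier N l = of_real (v \<bullet> l)"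
      using N[of v] by blast
    define x where "x = K * norm v * cmod z"
    have x0: "x \<ge> 0" using K by (simp add: x_def)
    note L0 = l1norm_nonneg[of f]
    define g where "g k = symbol_power v k f" for k
    have g: "band_limited S (g k)" "fourier (g k) l = of_real (v \<bullet> l) ^ k * fourier f l" "l1norm (g k) \<le> l1norm N ^ k * l1norm f" for k l
      using symbol_power_band_limited[OF N(1,3) f] by (auto simp: g_def)
    have g0: "g 0 = f" by (rule band_limited_eqI[OF g(1) f]) (simp add: g(2))
    define u where "u k t = (\<i> * z) ^ k / fact k * g k t" for k t
    have ui: "integrable lborel (u k)" for k unfolding u_def using band_limitedD(2)[OF g(1)] by simp
    have us: "summable (\<lambda>k. cmod (u k t))" "(\<lambda>k. u k t) sums cshift v z f t" for t
      unfolding u_def g_def by (rule cshift_sums[OF f])+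
    have ub: "l1norm (u k) \<le> x ^ k / fact k * l1norm f" for k
    proof -
      have "l1norm (g k) \<le> (K * norm v) ^ k * l1norm f"
        using g(3)[of k] N(2) l1norm_nonneg[of N]
        by (meson L0 mult_right_mono order_trans power_mono)
      then have "cmod z ^ k / fact k * l1norm (g k) \<le> cmod z ^ k / fact k * ((K * norm v) ^ k * l1norm f)"
        by (intro mult_left_mono) auto
      moreover have "l1norm (u k) = cmod z ^ k / fact k * l1norm (g k)"
        unfolding u_def l1norm_cmult by (simp add: norm_divide norm_power norm_mult)
      ultimately show ?thesis by (simp add: x_def power_mult_distrib mult_ac)
    qed
    note E = exp_series_bounds[OF x0 L0]
    have ci: "integrable lborel (cshift v z f)" by (rule integrable_l1_series[OF ui us ub E(1)])
    have cl: "l1norm (cshift v z f) \<le> exp x * l1norm f"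
      using l1norm_l1_series[OF ui us ub E(1)] E(2) by simp
    have cf: "fourier (cshift v z f) l = exp (\<i> * z * of_real (v \<bullet> l)) * fourier f l" for l
    proof -
      have "(\<lambda>k. fourier (u k) l) sums fourier (cshift v z f) l" by (rule fourier_l1_series[OF ui us ub E(1)])
      moreover have "fourier (u k) l = (\<i> * z * of_real (v \<bullet> l)) ^ k /\<^sub>R fact k * fourier f l" for k
        unfolding u_def fourier_cmult g(2) by (simp add: power_mult_distrib scaleR_conv_of_real divide_inverse mult_ac)
      moreover have "(\<lambda>k. (\<i> * z * of_real (v \<bullet> l)) ^ k /\<^sub>R fact k * fourier f l) sums (exp (\<i> * z * of_real (v \<bullet> l)) * fourier f l)"
        by (intro sums_mult2 exp_converges)
      ultimately show ?thesis using sums_unique2 by simp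
    qed
    have cb: "band_limited S (cshift v z f)"
      unfolding band_limited_def
    proof (intro conjI allI impI)
      show "fourier (cshift v z f) l = 0" if "l \<notin> S" for l using cf band_limitedD(3)[OF f that] by simp
      show "cshift v z f t = inv_fourier (fourier (cshift v z f)) t" for t
        unfolding cf[abs_def] by (simp add: cshift_def)
    qed (use S ci in auto)
    have db: "band_limited S (dir_deriv v f)"
      unfolding dir_deriv_def using band_limited_cmult[OF g(1)[of 1]] by (simp add: g_def)
    have dl: "l1norm (dir_deriv v f) \<le> K * norm v * l1norm f"
      using g(3)[of 1] mult_right_mono[OF N(2) L0] by (simp add: dir_deriv_def l1norm_cmult g_def)
    \<comment> \<open>The series begins with \<open>f\<close> and \<open>z\<close> times the
      derivative, so the remainder is the series from index 2.\<close>
    have u1: "u 1 = (\<lambda>t. z * dir_deriv v f t)" by (simp add: fun_eq_iff u_def g_def dir_deriv_def)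
    have u0: "u 0 = f" by (simp add: fun_eq_iff u_def g0)
    have us2: "summable (\<lambda>k. cmod (u (k + 2) t))" "(\<lambda>k. u (k + 2) t) sums (cshift v z f t - f t - z * dir_deriv v f t)" for t
    proof -
      show "summable (\<lambda>k. cmod (u (k + 2) t))" using summable_ignore_initial_segment[OF us(1)] .
      have "(\<lambda>k. u (k + 2) t) sums (cshift v z f t - (\<Sum>i<2. u i t))" by (rule sums_split_initial_segment[OF us(2)])
      then show "(\<lambda>k. u (k + 2) t) sums (cshift v z f t - f t - z * dir_deriv v f t)"
        using fun_cong[OF u0, of t] fun_cong[OF u1, of t] by (simp add: numeral_2_eq_2 diff_diff_eq)
    qed
    have "l1norm (\<lambda>t. cshift v z f t - f t - z * dir_deriv v f t) \<le> (\<Sum>k. x ^ (k + 2) / fact (k + 2) * l1norm f)"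
      by (rule l1norm_l1_series[OF ui us2 ub E(3)])
    with E(4) cb cf db dl cl show "band_limited S (cshift v z f) \<and>
       fourier (cshift v z f) l = exp (\<i> * z * of_real (v \<bullet> l)) * fourier f l \<and>
       band_limited S (dir_deriv v f) \<and>
       l1norm (dir_deriv v f) \<le> K * norm v * l1norm f \<and>
       l1norm (cshift v z f) \<le> exp (K * norm v * cmod z) * l1norm f \<and>
       l1norm (\<lambda>t. cshift v z f t - f t - z * dir_deriv v f t) \<le> (K * norm v * cmod z)\<^sup>2 * exp (K * norm v * cmod z) * l1norm f"
      by (simp add: x_def)
  qed
qed

lemma
  assumes "band_limited S f"
  shows band_limited_cshift: "band_limited S (cshift v z f)"
    and fourier_cshift: "fourier (cshift v z f) l = exp (\<i> * z * of_real (v \<bullet> l)) * fourier f l"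
    and band_limited_dir_deriv: "band_limited S (dir_deriv v f)"
  using cshift_bounds[OF band_limitedD(1)[OF assms]] assms by metis+

lemma cshift_cshift:
  assumes "band_limited S f"
  shows "cshift v w (cshift v z f) = cshift v (w + z) f"
  by (rule band_limited_eqI[OF band_limited_cshift[OF band_limited_cshift[OF assms]] band_limited_cshift[OF assms]])
     (simp add: fourier_cshift[OF assms] fourier_cshift[OF band_limited_cshift[OF assms]] exp_add algebra_simps)

lemma cshift_0: "band_limited S f \<Longrightarrow> cshift v 0 f = f"
  by (rule band_limited_eqI[of S _ S]) (simp_all add: band_limited_cshift fourier_cshift)

lemma cshift_of_real:
  assumes "band_limited S f" shows "cshift v (of_real r) f t = f (t + r *\<^sub>R v)"
proof -
  have "exp (\<i> * of_real r * of_real (v \<bullet> l)) * fourier f l * cis (t \<bullet> l) = fourier f l * cis ((t + r *\<^sub>R v) \<bullet> l)" for l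
    by (simp add: cis_conv_exp inner_add_left exp_add algebra_simps)
  then show ?thesis using band_limitedD(4)[OF assms, of "t + r *\<^sub>R v"]
    by (simp only: cshift_def inv_fourier_def)
qed

text \<open>The modulus \<open>w\<close> sees \<open>v\<close> and \<open>z\<close> only through
  \<open>norm v * cmod z\<close>. One function therefore covers real translations in all directions
  (\<open>z = 1\<close>, \<open>v\<close> small) as well as imaginary shifts along a fixed
  direction.\<close>

lemma l1norm_cshift_diff:
  fixes f :: "real^'n \<Rightarrow> complex"
  assumes f: "band_limited S f"
  obtains w where "continuous_on UNIV w" "w 0 = 0" "\<And>v z. l1norm (\<lambda>t. cshift v z f t - f t) \<le> w (norm v * cmod z)"
proof (rule cshift_bounds[OF band_limitedD(1)[OF f]])
  fix K :: real
  assume K: "\<And>v z f l. band_limited S f \<Longrightarrow> band_limited S (cshift v z f) \<and>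
       fourier (cshift v z f) l = exp (\<i> * z * of_real (v \<bullet> l)) * fourier f l \<and>
       band_limited S (dir_deriv v f) \<and>
       l1norm (dir_deriv v f) \<le> K * norm v * l1norm f \<and>
       l1norm (cshift v z f) \<le> exp (K * norm v * cmod z) * l1norm f \<and>
       l1norm (\<lambda>t. cshift v z f t - f t - z * dir_deriv v f t) \<le> (K * norm v * cmod z)\<^sup>2 * exp (K * norm v * cmod z) * l1norm f"
  define w where "w x = (K * x)\<^sup>2 * exp (K * x) * l1norm f + K * x * l1norm f" for x
  show thesis
  proof (rule that[of w])
    show "continuous_on UNIV w" unfolding w_def by (intro continuous_intros)
    fix v z
    let ?h = "\<lambda>t. cshift v z f t - f t - z * dir_deriv v f t"
    have i: "integrable lborel f" "integrable lborel (cshift v z f)" "integrable lborel (dir_deriv v f)"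
      using band_limitedD(2) f band_limited_cshift[OF f] band_limited_dir_deriv[OF f] by blast+
    have "l1norm (\<lambda>t. cshift v z f t - f t) = l1norm (\<lambda>t. ?h t + z * dir_deriv v f t)" by simp
    also have "\<dots> \<le> l1norm ?h + cmod z * l1norm (dir_deriv v f)"
      unfolding l1norm_cmult[symmetric] by (rule l1norm_add) (use i in auto)
    also have "\<dots> \<le> w (norm v * cmod z)"
    proof -
      have "cmod z * l1norm (dir_deriv v f) \<le> cmod z * (K * norm v * l1norm f)"
        using K[OF f, of v z] by (intro mult_left_mono) auto
      then have "cmod z * l1norm (dir_deriv v f) \<le> K * (norm v * cmod z) * l1norm f" by (simp only: mult_ac)
      moreover have "l1norm ?h \<le> (K * (norm v * cmod z))\<^sup>2 * exp (K * (norm v * cmod z)) * l1norm f"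
        using K[OF f, of v z] by (simp only: mult.assoc)
      ultimately show ?thesis unfolding w_def by (rule add_mono[rotated])
    qed
    finally show "l1norm (\<lambda>t. cshift v z f t - f t) \<le> w (norm v * cmod z)" .
  qed (simp add: w_def)
qed

lemma cshift_l1norm_bounds:
  fixes S :: "(real^'n) set"
  assumes S: "bounded S"
  obtains K where "K \<ge> 0"
    and "\<And>z f. band_limited S f \<Longrightarrow> l1norm (cshift v z f) \<le> exp (K * cmod z) * l1norm f"
    and "\<And>f. band_limited S f \<Longrightarrow> l1norm (dir_deriv v f) \<le> K * l1norm f"
    and "\<And>z f. band_limited S f \<Longrightarrow>
      l1norm (\<lambda>t. cshift v z f t - f t - z * dir_deriv v f t) \<le> (K * cmod z)\<^sup>2 * exp (K * cmod z) * l1norm f"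
proof (rule cshift_bounds[OF S])
  fix K :: real
  assume K: "K \<ge> 0" "\<And>v z f l. band_limited S f \<Longrightarrow> band_limited S (cshift v z f) \<and>
       fourier (cshift v z f) l = exp (\<i> * z * of_real (v \<bullet> l)) * fourier f l \<and>
       band_limited S (dir_deriv v f) \<and>
       l1norm (dir_deriv v f) \<le> K * norm v * l1norm f \<and>
       l1norm (cshift v z f) \<le> exp (K * norm v * cmod z) * l1norm f \<and>
       l1norm (\<lambda>t. cshift v z f t - f t - z * dir_deriv v f t) \<le> (K * norm v * cmod z)\<^sup>2 * exp (K * norm v * cmod z) * l1norm f"
  show thesis by (rule that[of "K * norm v"]) (use K in auto)
qed

text \<open>The Fourier transform of \<open>set_kernel r K\<close> is the indicator function of \<open>K\<close> averaged over cubes of side \<open>2 r\<close>.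
  Being additive in \<open>K\<close>, these kernels replace a partition of unity.\<close>

definition set_kernel :: "real \<Rightarrow> (real^'n) set \<Rightarrow> real^'n \<Rightarrow> complex" where
  "set_kernel r K t = integral K (\<lambda>l. cis (t \<bullet> l)) *
     (\<Prod>i\<in>UNIV. (LINT x|lborel. affine_window (- r) r (1 / (2 * r)) 0 x * cis (t $ i * x)) / (2 * pi))"

lemma box_kernel_eq_set_kernel:
  fixes a b :: "real^'n"
  shows "box_kernel r a b = set_kernel r (cbox a b)"
proof
  fix t
  have ind: "(\<Prod>i\<in>UNIV. affine_window (a $ i) (b $ i) 1 0 (l $ i)) = indicator (cbox a b) l" for l
  proof (cases "l \<in> cbox a b")
    case True
    then show ?thesis by (auto simp: mem_box_cart affine_window_def intro!: prod.neutral)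
  next
    case False
    then obtain i where "\<not> (a $ i \<le> l $ i \<and> l $ i \<le> b $ i)" by (auto simp: mem_box_cart)
    then have "affine_window (a $ i) (b $ i) 1 0 (l $ i) = 0" by (simp add: affine_window_def)
    then have "\<exists>i\<in>UNIV. affine_window (a $ i) (b $ i) 1 0 (l $ i) = 0" by (rule bexI) simp
    then have "(\<Prod>i\<in>UNIV. affine_window (a $ i) (b $ i) 1 0 (l $ i)) = 0" by (intro prod_zero finite)
    then show ?thesis using False by simp
  qed
  have "(\<Prod>i\<in>UNIV. LINT x|lborel. affine_window (a $ i) (b $ i) 1 0 x * cis (t $ i * x))
     = (LINT l|lborel. (\<Prod>i\<in>UNIV. affine_window (a $ i) (b $ i) 1 0 (l $ i) * cis (t $ i * l $ i)))"
    by (rule integral_lborel_vec_prod[symmetric]) (rule integrable_mult_cis[OF integrable_affine_window], measurable)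
  also have "\<dots> = (LINT l|lborel. indicator (cbox a b) l *\<^sub>R cis (t \<bullet> l))"
    by (intro Bochner_Integration.integral_cong refl)
       (simp only: prod.distrib ind cis_inner_vec, simp split: split_indicator)
  also have "\<dots> = integral (cbox a b) (\<lambda>l. cis (t \<bullet> l))"
  proof -
    have "set_integrable lborel (cbox a b) (\<lambda>l. cis (t \<bullet> l))"
      unfolding set_integrable_def by (rule borel_integrable_compact) (auto intro!: continuous_intros)
    from set_borel_integral_eq_integral(2)[OF this] show ?thesis by (simp add: set_lebesgue_integral_def)
  qed
  finally show "box_kernel r a b t = set_kernel r (cbox a b) t"
    by (simp add: box_kernel_def set_kernel_def window_kernel_def prod.distrib prod_dividef)
qed

lemma set_kernel_tagged_division:
  assumes "p tagged_division_of cbox a b"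
  shows "set_kernel r (cbox a b) t = (\<Sum>(x, K)\<in>p. set_kernel r K t)"
proof -
  have "integral (cbox a b) (\<lambda>l. cis (t \<bullet> l)) = (\<Sum>(x, K)\<in>p. integral K (\<lambda>l. cis (t \<bullet> l)))"
    by (rule integral_combine_tagged_division_topdown[OF _ assms])
       (intro integrable_continuous continuous_intros)
  then show ?thesis by (simp add: set_kernel_def sum_distrib_right case_prod_unfold)
qed

text \<open>In frequency this recentres the transform at \<open>\<gamma>\<close> and stretches it by
  \<open>r\<close>. Large \<open>r\<close> with \<open>\<gamma> = 0\<close> yields an approximate
  identity; small \<open>r\<close> yields cutoffs to small balls around
  \<open>\<gamma>\<close>.\<close>

definition dilate :: "real \<Rightarrow> real^'n \<Rightarrow> (real^'n \<Rightarrow> complex) \<Rightarrow> real^'n \<Rightarrow> complex" where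
  "dilate r \<gamma> f t = of_real (r ^ CARD('n)) * f (r *\<^sub>R t) * cis (\<gamma> \<bullet> t)"

lemma integrable_scale:
  fixes f :: "real^'n \<Rightarrow> 'b::{banach,second_countable_topology}"
  assumes "r > 0" "integrable lborel f"
  shows "integrable lborel (\<lambda>t. f (r *\<^sub>R t))" "r ^ CARD('n) *\<^sub>R (LINT t|lborel. f (r *\<^sub>R t)) = (LINT t|lborel. f t)"
  using lborel_integrable_affine[of r f 0] lborel_integral_affine[of r f 0] assms by auto

lemma integrable_dilate:
  assumes "r > 0" "integrable lborel f" shows "integrable lborel (dilate r \<gamma> f)"
  unfolding dilate_def[abs_def]
  by (rule integrable_mult_cis) (use integrable_scale(1)[OF assms] in auto)

lemma fourier_dilate:
  fixes f :: "real^'n \<Rightarrow> complex"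
  assumes r: "r > 0" and f: "integrable lborel f"
  shows "fourier (dilate r \<gamma> f) l = fourier f ((1 / r) *\<^sub>R (l - \<gamma>))"
proof -
  let ?h = "\<lambda>x. f x * cis (- (x \<bullet> ((1 / r) *\<^sub>R (l - \<gamma>))))"
  have i: "integrable lborel ?h" by (rule integrable_mult_cis) (use f in auto)
  have "fourier (dilate r \<gamma> f) l = (LINT t|lborel. of_real (r ^ CARD('n)) * ?h (r *\<^sub>R t))"
    unfolding fourier_def dilate_def
    by (intro Bochner_Integration.integral_cong refl)
       (use r in \<open>simp add: mult.assoc cis_mult inner_diff_right inner_commute\<close>)
  also have "\<dots> = of_real (r ^ CARD('n)) * (LINT t|lborel. ?h (r *\<^sub>R t))"
    by (rule integral_mult_right_zero)
  also have "\<dots> = (LINT t|lborel. ?h t)"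
    using integrable_scale(2)[OF r i] by (simp only: scaleR_conv_of_real)
  finally show ?thesis by (simp add: fourier_def)
qed

lemma band_limited_dilate:
  fixes f :: "real^'n \<Rightarrow> complex"
  assumes r: "r > 0" and f: "band_limited S f"
  shows "band_limited ((\<lambda>l. \<gamma> + r *\<^sub>R l) ` S) (dilate r \<gamma> f)"
proof -
  note fi = band_limitedD(2)[OF f]
  have F: "fourier (dilate r \<gamma> f) = (\<lambda>l. fourier f ((1 / r) *\<^sub>R (l - \<gamma>)))"
    by (rule ext) (rule fourier_dilate[OF r fi])
  have G: "integrable lborel (fourier f)" using band_limited_integrable_symbol[OF f, of "\<lambda>_. 1"] by simp
  have inv: "dilate r \<gamma> f t = inv_fourier (fourier (dilate r \<gamma> f)) t" for t
  proof -
    let ?h = "\<lambda>l. fourier f ((1 / r) *\<^sub>R (l - \<gamma>)) * cis (t \<bullet> l)"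
    have sc: "((1 / r) *\<^sub>R (l - \<gamma>)) = - ((1 / r) *\<^sub>R \<gamma>) + (1 / r) *\<^sub>R l" for l
      by (simp add: scaleR_diff_right)
    have "integrable lborel (\<lambda>l. fourier f ((1 / r) *\<^sub>R (l - \<gamma>)))"
      unfolding sc by (rule lborel_integrable_affine[OF _ G]) (use r in auto)
    then have hi: "integrable lborel ?h" by (rule integrable_mult_cis) simp
    have "(LINT l|lborel. ?h l) = of_real (r ^ CARD('n)) * (LINT l|lborel. (fourier f l * cis ((r *\<^sub>R t) \<bullet> l)) * cis (\<gamma> \<bullet> t))"
    proof -
      have hh: "?h (\<gamma> + r *\<^sub>R l) = (fourier f l * cis ((r *\<^sub>R t) \<bullet> l)) * cis (\<gamma> \<bullet> t)" for l
      proof -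
        have "(1 / r) *\<^sub>R (\<gamma> + r *\<^sub>R l - \<gamma>) = l" using r by simp
        then show ?thesis by (simp only: mult.assoc cis_mult) (simp add: inner_add_right inner_commute add.commute)
      qed
      have "(LINT l|lborel. ?h l) = \<bar>r\<bar> ^ DIM(real^'n) *\<^sub>R (LINT l|lborel. ?h (\<gamma> + r *\<^sub>R l))"
        by (rule lborel_integral_affine[OF _ hi]) (use r in simp)
      then show ?thesis unfolding hh using r by (simp add: scaleR_conv_of_real[where 'a = complex])
    qed
    also have "\<dots> = of_real (r ^ CARD('n)) * ((LINT l|lborel. fourier f l * cis ((r *\<^sub>R t) \<bullet> l)) * cis (\<gamma> \<bullet> t))"
      by (simp only: integral_mult_left_zero)
    finally show ?thesis unfolding F dilate_def band_limitedD(4)[OF f, of "r *\<^sub>R t"] inv_fourier_def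
      by (simp add: mult_ac)
  qed
  have "fourier (dilate r \<gamma> f) l = 0" if "l \<notin> (\<lambda>l. \<gamma> + r *\<^sub>R l) ` S" for l
  proof -
    have "l = \<gamma> + r *\<^sub>R ((1 / r) *\<^sub>R (l - \<gamma>))" using r by simp
    then have "(1 / r) *\<^sub>R (l - \<gamma>) \<notin> S" using that by blast
    then show ?thesis unfolding F by (rule band_limitedD(3)[OF f])
  qed
  moreover have "bounded ((\<lambda>l. \<gamma> + r *\<^sub>R l) ` S)"
    using bounded_translation[OF bounded_scaling[OF band_limitedD(1)[OF f], of r], of \<gamma>] by (simp add: image_image)
  ultimately show ?thesis unfolding band_limited_def using inv integrable_dilate[OF r fi] by blast
qed

text \<open>Up to the phase \<open>cis (\<gamma> \<bullet> u)\<close>, translating the dilate by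
  \<open>u\<close> is translating \<open>f\<close> by \<open>r u\<close>, and the norm is scale
  invariant. For small \<open>r\<close> the dilate is thus almost an eigenfunction of translation by
  \<open>u\<close>.\<close>

lemma l1norm_dilate_translate_diff:
  fixes f :: "real^'n \<Rightarrow> complex"
  assumes r: "r > 0" and f: "integrable lborel f"
  shows "l1norm (\<lambda>s. dilate r \<gamma> f (s + u) - cis (\<gamma> \<bullet> u) * dilate r \<gamma> f s) = l1norm (\<lambda>s. f (s + r *\<^sub>R u) - f s)"
proof -
  let ?h = "\<lambda>s. cmod (f (s + r *\<^sub>R u) - f s)"
  have i: "integrable lborel ?h"
    by (intro integrable_norm Bochner_Integration.integrable_diff f lborel_integrable_translate)
  have "cmod (dilate r \<gamma> f (s + u) - cis (\<gamma> \<bullet> u) * dilate r \<gamma> f s) = r ^ CARD('n) * ?h (r *\<^sub>R s)" for s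
  proof -
    have "dilate r \<gamma> f (s + u) - cis (\<gamma> \<bullet> u) * dilate r \<gamma> f s = of_real (r ^ CARD('n)) * cis (\<gamma> \<bullet> (s + u)) * (f (r *\<^sub>R s + r *\<^sub>R u) - f (r *\<^sub>R s))"
      by (simp add: dilate_def inner_add_right scaleR_add_right cis_mult[symmetric] algebra_simps)
    then show ?thesis using r by (simp add: norm_mult norm_power)
  qed
  then show ?thesis unfolding l1norm_def using integrable_scale(2)[OF r i] by simp
qed

text \<open>For \<open>e = \<plusminus>1\<close> the Fourier transform is \<open>exp (- e s (l\<^sub>1 + \<dots> + l\<^sub>d))\<close> wherever all \<open>e l\<^sub>i \<ge> - 1\<close>,
  which is a neighbourhood of the orthant, while the \<open>L\<^sup>1\<close> norm depends only on \<open>s\<close> and \<open>d\<close>.\<close>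

definition tilted_poisson :: "real \<Rightarrow> real \<Rightarrow> real^'n \<Rightarrow> complex" where
  "tilted_poisson e s t = (\<Prod>i\<in>UNIV. of_real (exp s) * poisson_kernel s (t $ i) * cis (- (e * t $ i)))"

lemma
  assumes s: "s > 0"
  shows integrable_tilted_poisson: "integrable lborel (tilted_poisson e s :: real^'n \<Rightarrow> complex)"
    and l1norm_tilted_poisson: "l1norm (tilted_poisson e s :: real^'n \<Rightarrow> complex) = exp s ^ CARD('n)"
    and fourier_tilted_poisson: "fourier (tilted_poisson e s) (l :: real^'n) = of_real (\<Prod>i\<in>UNIV. exp (s - s * \<bar>l $ i + e\<bar>))"
proof -
  let ?k = "\<lambda>u. of_real (exp s) * poisson_kernel s u * cis (- (e * u))"
  have k: "integrable lborel (?k)"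
    by (rule integrable_mult_cis) (use integrable_poisson_kernel[OF s] in auto)
  have eq: "tilted_poisson e s = (\<lambda>t::real^'n. \<Prod>i\<in>UNIV. ?k (t $ i))" by (simp add: fun_eq_iff tilted_poisson_def)
  show "integrable lborel (tilted_poisson e s :: real^'n \<Rightarrow> complex)"
    unfolding eq by (rule integrable_lborel_vec_prod[of "\<lambda>_. ?k", OF k])
  have "(LINT u|lborel. cmod (?k u)) = exp s"
    using poisson_kernel_l1norm[OF s] by (simp add: norm_mult)
  then show "l1norm (tilted_poisson e s :: real^'n \<Rightarrow> complex) = exp s ^ CARD('n)"
    unfolding eq l1norm_prod[of "\<lambda>_. ?k", OF k] by simp
  have "(LINT u|lborel. ?k u * cis (- (u * x))) = of_real (exp (s - s * \<bar>x + e\<bar>))" for x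
  proof -
    have "(LINT u|lborel. ?k u * cis (- (u * x))) = (LINT u|lborel. of_real (exp s) * (poisson_kernel s u * cis (- (u * (x + e)))))"
      by (intro Bochner_Integration.integral_cong refl) (simp add: mult.assoc cis_mult algebra_simps)
    also have "\<dots> = of_real (exp s) * of_real (exp (- (s * \<bar>x + e\<bar>)))"
      by (simp only: integral_mult_right_zero poisson_kernel_fourier[OF s])
    finally show ?thesis by (simp only: of_real_mult[symmetric] exp_add[symmetric] add_uminus_conv_diff)
  qed
  then show "fourier (tilted_poisson e s) (l :: real^'n) = of_real (\<Prod>i\<in>UNIV. exp (s - s * \<bar>l $ i + e\<bar>))"
    unfolding eq fourier_prod[of "\<lambda>_. ?k", OF k] by simp
qed

text \<open>For such \<open>l\<close> one has \<open>\<bar>l $ i + e\<bar> = e * l $ i + 1\<close>: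
  the kink of the Poisson symbol sits at \<open>l $ i = - e\<close>, one unit outside the orthant,
  and the factor \<open>exp s\<close> pays for that unit.\<close>

lemma fourier_tilted_poisson_orthant:
  fixes l :: "real^'n"
  assumes s: "s > 0" and e: "e = 1 \<or> e = -1" and l: "\<And>i. - 1 \<le> e * l $ i"
  shows "fourier (tilted_poisson e s) l = exp (\<i> * (\<i> * of_real (e * s)) * of_real ((\<chi> i. 1) \<bullet> l))"
proof -
  have "s - s * \<bar>l $ i + e\<bar> = - (e * s) * l $ i" for i
    using l[of i] e by (auto simp: algebra_simps abs_if)
  then have "(\<Prod>i\<in>UNIV. exp (s - s * \<bar>l $ i + e\<bar>)) = exp (- (e * s) * ((\<chi> i. 1) \<bullet> l))"
    by (simp add: inner_vec_def exp_sum[symmetric] sum_distrib_left sum_negf)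
  then show ?thesis by (simp add: fourier_tilted_poisson[OF s] exp_of_real[symmetric] mult.assoc[symmetric] del: exp_of_real)
qed

section \<open>Modules over the convolution algebra\<close>

text \<open>The instances are the operator spaces \<open>cops\<close>. The ambient type offers real
  scalars only, so complex multiplication is built from \<open>J\<close>; limits taken in the type
  stay in \<open>M\<close> because \<open>M\<close> is closed.\<close>

locale banach_l1_module =
  fixes M :: "'m::banach set" and J :: "'m \<Rightarrow> 'm" and sc :: "complex \<Rightarrow> 'm \<Rightarrow> 'm"
    and T :: "real^'n \<Rightarrow> 'm \<Rightarrow> 'm" and act :: "(real^'n \<Rightarrow> complex) \<Rightarrow> 'm \<Rightarrow> 'm"
  assumes l1: "l1_module M sc T act"
    and J: "bounded_linear J" and JJ: "\<And>x. J (J x) = - x"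
    and sc: "\<And>c x. sc c x = Re c *\<^sub>R x + Im c *\<^sub>R J x"
    and norm_sc: "\<And>c x. norm (sc c x) = cmod c * norm x"
    and subspace_M: "subspace M" and closed_M: "closed M"
begin

lemmas rep = l1[unfolded l1_module_def isometric_rep_def, THEN conjunct1]
  and axs = l1[unfolded l1_module_def, THEN conjunct2]

lemmas act_mem = axs[THEN conjunct1, rule_format]
  and act_add_fun = axs[THEN conjunct2, THEN conjunct1, rule_format]
  and act_cmult_fun = axs[THEN conjunct2, THEN conjunct2, THEN conjunct1, rule_format]
  and act_add = axs[THEN conjunct2, THEN conjunct2, THEN conjunct2, THEN conjunct1, rule_format]
  and act_sc = axs[THEN conjunct2, THEN conjunct2, THEN conjunct2, THEN conjunct2, THEN conjunct1, rule_format]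
  and act_conv = axs[THEN conjunct2, THEN conjunct2, THEN conjunct2, THEN conjunct2, THEN conjunct2, THEN conjunct1, rule_format]
  and norm_act = axs[THEN conjunct2, THEN conjunct2, THEN conjunct2, THEN conjunct2, THEN conjunct2, THEN conjunct2, THEN conjunct1, rule_format]
  and T_act_translate = axs[THEN conjunct2, THEN conjunct2, THEN conjunct2, THEN conjunct2, THEN conjunct2, THEN conjunct2, THEN conjunct2, THEN conjunct1, rule_format, THEN conjunct1]
  and T_act = axs[THEN conjunct2, THEN conjunct2, THEN conjunct2, THEN conjunct2, THEN conjunct2, THEN conjunct2, THEN conjunct2, THEN conjunct1, rule_format, THEN conjunct2]
  and act_integral = axs[THEN conjunct2, THEN conjunct2, THEN conjunct2, THEN conjunct2, THEN conjunct2, THEN conjunct2, THEN conjunct2, THEN conjunct2, THEN conjunct2, rule_format]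
  and T_mem = rep[THEN conjunct1, rule_format]
  and T_add = rep[THEN conjunct2, THEN conjunct1, rule_format]
  and T_sc = rep[THEN conjunct2, THEN conjunct2, THEN conjunct1, rule_format]
  and norm_T = rep[THEN conjunct2, THEN conjunct2, THEN conjunct2, THEN conjunct1, rule_format]
  and T_0 = rep[THEN conjunct2, THEN conjunct2, THEN conjunct2, THEN conjunct2, THEN conjunct1, rule_format]

lemma M_diff: "x \<in> M \<Longrightarrow> y \<in> M \<Longrightarrow> x - y \<in> M"
  and M_minus: "x \<in> M \<Longrightarrow> - x \<in> M"
  and M_0: "0 \<in> M"
  using subspace_M by (auto intro: subspace_diff subspace_neg subspace_0)

lemma J_add: "J (x + y) = J x + J y" and J_scaleR: "J (r *\<^sub>R x) = r *\<^sub>R J x" and J_diff: "J (x - y) = J x - J y"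
  using J by (auto simp: bounded_linear_def linear_add linear_scale linear_diff)

lemma sc_add: "sc c (x + y) = sc c x + sc c y"
  and sc_diff: "sc c (x - y) = sc c x - sc c y"
  and sc_mult: "sc (c * d) x = sc c (sc d x)"
  and sc_1: "sc 1 x = x" and sc_minus1: "sc (- 1) x = - x" and sc_0: "sc 0 x = 0"
  and sc_of_real: "sc (of_real r) x = r *\<^sub>R x"
  by (simp_all add: sc J_add J_diff J_scaleR JJ algebra_simps)

lemma bounded_linear_sc: "bounded_linear (\<lambda>c. sc c x)"
proof (rule bounded_linear_intro)
  show "norm (sc c x) \<le> norm c * norm x" for c by (simp add: norm_sc)
qed (simp_all add: sc algebra_simps)

lemma act_diff_fun:
  assumes "integrable lborel f" "integrable lborel g" "x \<in> M"
  shows "act (\<lambda>t. f t - g t) x = act f x - act g x"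
  using act_add_fun[OF assms(1) _ assms(3), of "\<lambda>t. - 1 * g t"] act_cmult_fun[OF assms(2,3), of "-1"] assms
  by (simp add: sc_minus1)

lemma act_zero_fun: "x \<in> M \<Longrightarrow> act (\<lambda>t. 0) x = 0"
  using act_cmult_fun[of "\<lambda>_. 0" x 0] by (simp add: sc_0)

lemma act_sum_fun:
  assumes "finite I" "x \<in> M" "\<And>i. i \<in> I \<Longrightarrow> integrable lborel (f i)"
  shows "act (\<lambda>t. \<Sum>i\<in>I. f i t) x = (\<Sum>i\<in>I. act (f i) x)"
  using assms(1,3) by (induction I) (auto simp: act_zero_fun assms(2) act_add_fun)

lemma act_minus: "integrable lborel f \<Longrightarrow> x \<in> M \<Longrightarrow> act f (- x) = - act f x"
  using act_sc[of f x "-1"] by (simp add: sc_minus1)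

lemma act_diff: "integrable lborel f \<Longrightarrow> x \<in> M \<Longrightarrow> y \<in> M \<Longrightarrow> act f (x - y) = act f x - act f y"
  using act_add[of f x "- y"] act_minus[of f y] by (simp add: M_minus)

lemma act_0: "integrable lborel f \<Longrightarrow> act f 0 = 0"
  using act_diff[of f 0 0] M_0 by simp

lemma T_diff: "x \<in> M \<Longrightarrow> y \<in> M \<Longrightarrow> T t (x - y) = T t x - T t y"
  using T_add[of x "- y" t] T_sc[of y t "-1"] by (simp add: sc_minus1 M_minus)

lemma norm_T_diff: "x \<in> M \<Longrightarrow> y \<in> M \<Longrightarrow> norm (T t x - T t y) = norm (x - y)"
  using norm_T[OF M_diff, of x y t] by (simp add: T_diff)

lemma act_act_commute:
  assumes "integrable lborel f" "integrable lborel g" "x \<in> M"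
  shows "act f (act g x) = act g (act f x)"
  using act_conv[OF assms] act_conv[OF assms(2,1,3)] conv_commute[of f g] by simp

lemma tendsto_act:
  assumes f: "integrable lborel f" and x: "\<And>n. x n \<in> M" "(x \<longlongrightarrow> y) F" and y: "y \<in> M"
  shows "((\<lambda>n. act f (x n)) \<longlongrightarrow> act f y) F"
proof -
  have "((\<lambda>n. l1norm f * norm (x n - y)) \<longlongrightarrow> l1norm f * 0) F"
    by (intro tendsto_intros) (use x(2) in \<open>simp add: tendsto_norm_zero LIM_zero\<close>)
  then have "((\<lambda>n. l1norm f * norm (x n - y)) \<longlongrightarrow> 0) F" by simp
  then have "((\<lambda>n. act f (x n) - act f y) \<longlongrightarrow> 0) F"
    by (rule Lim_null_comparison[rotated])
       (use norm_act[OF f M_diff[OF x(1) y]] in \<open>auto simp: act_diff[OF f x(1) y]\<close>)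
  then show ?thesis by (rule LIM_zero_cancel)
qed

section \<open>Approximate eigenvectors and approximate identities\<close>

lemma continuous_T_act:
  assumes f: "integrable lborel f" and x: "x \<in> M" and c: "continuous_on UNIV (\<lambda>t. T t x)"
  shows "continuous_on UNIV (\<lambda>t. T t (act f x))"
proof -
  have "isCont (\<lambda>t. act f (T t x)) t" for t
    unfolding isCont_def
    by (rule tendsto_act[OF f]) (use c x T_mem in \<open>auto simp: continuous_on_eq_continuous_at isCont_def\<close>)
  then show ?thesis by (simp add: T_act[OF f x] continuous_at_imp_continuous_on)
qed

text \<open>If \<open>x\<close> were an eigenvector,
  \<open>T (- t) x = cis (- (t \<bullet> \<gamma>)) x\<close>, then \<open>f\<close> would act on it
  as the scalar \<open>fourier f \<gamma>\<close>; the defect \<open>w\<close> is integrated against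
  \<open>f\<close>. It is used with \<open>\<gamma> = 0\<close> for approximate identities and with
  general \<open>\<gamma>\<close> in \<open>local_vanishing\<close>.\<close>

lemma norm_act_minus_fourier_le:
  assumes f: "integrable lborel f" and x: "x \<in> M" and c: "continuous_on UNIV (\<lambda>t. T t x)"
    and w: "\<And>t. norm (T (- t) x - sc (cis (- (t \<bullet> \<gamma>))) x) \<le> w t" and i: "integrable lborel (\<lambda>t. cmod (f t) * w t)"
  shows "norm (act f x - sc (fourier f \<gamma>) x) \<le> (LINT t|lborel. cmod (f t) * w t)"
proof -
  have "((\<lambda>t. f t * cis (- (t \<bullet> \<gamma>))) has_integral fourier f \<gamma>) UNIV"
    unfolding fourier_def by (rule has_integral_integral_lborel, rule integrable_mult_cis) (use f in auto)
  from has_integral_linear[OF this bounded_linear_sc[of x]]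
  have "((\<lambda>t. sc (f t) (sc (cis (- (t \<bullet> \<gamma>))) x)) has_integral sc (fourier f \<gamma>) x) UNIV"
    by (simp add: o_def sc_mult)
  from has_integral_diff[OF act_integral[OF x c f] this]
  have 1: "((\<lambda>t. sc (f t) (T (- t) x - sc (cis (- (t \<bullet> \<gamma>))) x)) has_integral (act f x - sc (fourier f \<gamma>) x)) UNIV"
    by (simp add: sc_diff)
  have 2: "((\<lambda>t. cmod (f t) * w t) has_integral (LINT t|lborel. cmod (f t) * w t)) UNIV"
    by (rule has_integral_integral_lborel[OF i])
  show ?thesis
    using has_integral_norm_bound_integral_component[OF 1 2, of 1] w by (simp add: norm_sc mult_left_mono)
qed

text \<open>A substitution moves the dilation from the kernel to the orbit, where continuity at 0
  gives convergence and \<open>2 * norm x\<close> a dominating bound.\<close>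

lemma act_dilate_tendsto:
  assumes \<phi>: "integrable lborel \<phi>" "fourier \<phi> 0 = 1" and x: "x \<in> M" and c: "continuous_on UNIV (\<lambda>t. T t x)"
  shows "(\<lambda>n. act (dilate (real (Suc n)) 0 \<phi>) x) \<longlonglongrightarrow> x"
proof -
  define w where "w t = norm (T (- t) x - x)" for t
  have wc: "continuous_on UNIV w"
    unfolding w_def by (intro continuous_intros continuous_on_compose2[OF c]) auto
  then have [measurable]: "w \<in> borel_measurable borel" by (rule borel_measurable_continuous_onI)
  have wb: "\<bar>w t\<bar> \<le> 2 * norm x" for t
    unfolding w_def using norm_triangle_ineq4[of "T (- t) x" x] norm_T[OF x] by simp
  have [measurable]: "\<phi> \<in> borel_measurable borel" using \<phi> borel_measurable_integrable by auto
  have fw: "integrable lborel (\<lambda>t. cmod (f t) * w (v *\<^sub>R t))" if f: "integrable lborel f" for f v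
  proof -
    have [measurable]: "f \<in> borel_measurable borel" using f borel_measurable_integrable by auto
    show ?thesis
      by (rule Bochner_Integration.integrable_bound[of lborel "\<lambda>t. cmod (f t) * (2 * norm x)"])
         (use f wb in \<open>auto simp: abs_mult intro!: AE_I2 mult_left_mono\<close>)
  qed
  have bound: "norm (act (dilate (real (Suc n)) 0 \<phi>) x - x) \<le> (LINT t|lborel. cmod (\<phi> t) * w (inverse (real (Suc n)) *\<^sub>R t))" for n
  proof -
    let ?r = "real (Suc n)" let ?f = "dilate ?r 0 \<phi>"
    have r: "?r > 0" by simp
    note fi = integrable_dilate[OF r \<phi>(1), of 0]
    have i: "integrable lborel (\<lambda>t. cmod (?f t) * w t)" using fw[OF fi, of 1] by simp
    have "norm (act ?f x - sc (fourier ?f 0) x) \<le> (LINT t|lborel. cmod (?f t) * w t)"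
      by (rule norm_act_minus_fourier_le[OF fi x c _ i]) (simp add: w_def sc_1)
    also have "fourier ?f 0 = 1" using fourier_dilate[OF r \<phi>(1), of 0 0] \<phi>(2) by simp
    also have "(LINT t|lborel. cmod (?f t) * w t) = (LINT t|lborel. cmod (\<phi> t) * w (inverse ?r *\<^sub>R t))"
    proof -
      have "cmod (?f t) * w t = ?r ^ CARD('n) *\<^sub>R (\<lambda>s. cmod (\<phi> s) * w (inverse ?r *\<^sub>R s)) (?r *\<^sub>R t)" for t
        using r by (simp add: dilate_def norm_mult norm_power del: of_nat_Suc)
      then show ?thesis using integrable_scale(2)[OF r fw[OF \<phi>(1), of "inverse ?r"]]
        by (simp only: integral_scaleR_right)
    qed
    finally show ?thesis by (simp add: sc_1)
  qed
  have "(\<lambda>n. LINT t|lborel. cmod (\<phi> t) * w (inverse (real (Suc n)) *\<^sub>R t)) \<longlonglongrightarrow> (LINT t|lborel. cmod (\<phi> t) * 0)"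
  proof (rule integral_dominated_convergence[where w = "\<lambda>t. cmod (\<phi> t) * (2 * norm x)"])
    show "AE t in lborel. (\<lambda>n. cmod (\<phi> t) * w (inverse (real (Suc n)) *\<^sub>R t)) \<longlonglongrightarrow> cmod (\<phi> t) * 0"
    proof (rule AE_I2)
      fix t :: "real^'n"
      have "(\<lambda>n. inverse (real (Suc n)) *\<^sub>R t) \<longlonglongrightarrow> 0 *\<^sub>R t" by (rule tendsto_scaleR[OF LIMSEQ_inverse_real_of_nat tendsto_const])
      then have "(\<lambda>n. w (inverse (real (Suc n)) *\<^sub>R t)) \<longlonglongrightarrow> w 0"
        using wc by (intro isCont_tendsto_compose[of _ w]) (auto simp: continuous_on_eq_continuous_at)
      moreover have "w 0 = 0" by (simp add: w_def T_0[OF x])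
      ultimately show "(\<lambda>n. cmod (\<phi> t) * w (inverse (real (Suc n)) *\<^sub>R t)) \<longlonglongrightarrow> cmod (\<phi> t) * 0"
        by (intro tendsto_intros) simp
    qed
  qed (use \<phi> wb in \<open>auto simp: abs_mult intro!: mult_left_mono\<close>)
  then have "(\<lambda>n. LINT t|lborel. cmod (\<phi> t) * w (inverse (real (Suc n)) *\<^sub>R t)) \<longlonglongrightarrow> 0" by simp
  then have "(\<lambda>n. act (dilate (real (Suc n)) 0 \<phi>) x - x) \<longlonglongrightarrow> 0"
    by (rule Lim_null_comparison[rotated]) (use bound in auto)
  then show ?thesis by (rule LIM_zero_cancel)
qed

section \<open>Beurling spectrum and functional calculus\<close>

lemma closed_beurling_spec: "closed (beurling_spec act x)"
proof -
  have "beurling_spec act x = (\<Inter>f\<in>{f. integrable lborel f \<and> act f x = 0}. fourier f -` {0})"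
    by (auto simp: beurling_spec_def)
  also have "closed \<dots>"
  proof (intro closed_INT ballI)
    fix f assume "f \<in> {f. integrable lborel f \<and> act f x = 0}"
    then have "continuous_on UNIV (fourier f)" using continuous_fourier by blast
    then show "closed (fourier f -` {0})" by (intro continuous_closed_vimage) (auto simp: continuous_on_eq_continuous_at)
  qed
  finally show ?thesis .
qed

text \<open>The formal annihilator, \<open>\<psi>\<close> minus the unit mass at 0, is not an
  integrable function. Convolved with some \<open>k\<close> whose transform is 1 at \<open>l\<close>
  it becomes one, and the definition of the spectrum applies.\<close>

lemma beurling_spec_subset:
  assumes \<psi>: "integrable lborel \<psi>" and x: "x \<in> M" and eq: "act \<psi> x = x"
  shows "beurling_spec act x \<subseteq> {l. fourier \<psi> l = 1}"
proof (clarify)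
  fix l assume l: "l \<in> beurling_spec act x"
  obtain k S where k: "band_limited S k" "fourier k l = 1" using band_limited_plateau[of "{l}"] by (metis bounded_insert bounded_empty singletonI)
  note ki = band_limitedD(2)[OF k(1)]
  have "act (\<lambda>t. conv k \<psi> t - k t) x = 0"
    using act_diff_fun[OF integrable_conv[OF ki \<psi>] ki x] act_conv[OF ki \<psi> x] eq by simp
  then have "fourier (\<lambda>t. conv k \<psi> t - k t) l = 0"
    using l integrable_conv[OF ki \<psi>] ki unfolding beurling_spec_def by auto
  moreover have "fourier (\<lambda>t. conv k \<psi> t - k t) l = fourier k l * fourier \<psi> l - fourier k l"
    using fourier_add[OF integrable_conv[OF ki \<psi>], of "\<lambda>t. -1 * k t" l] fourier_cmult[of "-1" k l] ki
    by (simp add: fourier_conv[OF ki \<psi>])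
  ultimately show "fourier \<psi> l = 1" using k(2) by simp
qed

text \<open>The calculus asks for a cutoff equal to 1 near the spectrum of
  \<open>act \<phi> x\<close>, which \<open>\<phi>\<close> itself need not be. The plateau
  \<open>\<psi>\<close> fixes \<open>act \<phi> x\<close> and so confines its spectrum to
  \<open>S'\<close>; the wider plateau \<open>\<eta>\<close>, equal to 1 on a ball around
  \<open>S'\<close>, is then an admissible cutoff, and \<open>cshift v z \<eta>\<close> has the
  symbol \<open>h\<close> times that of \<open>\<eta>\<close>.\<close>

lemma diamond_graph_cshift:
  assumes \<phi>: "band_limited S \<phi>" and x: "x \<in> M"
    and h: "\<And>l. h l = exp (\<i> * z * of_real (v \<bullet> l))"
  shows "(act \<phi> x, act (cshift v z \<phi>) x) \<in> diamond_graph M act h"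
proof -
  note \<phi>i = band_limitedD(2)[OF \<phi>]
  obtain \<psi> S' where \<psi>: "band_limited S' \<psi>" "\<And>l. l \<in> S \<Longrightarrow> fourier \<psi> l = 1"
    using band_limited_plateau[OF band_limitedD(1)[OF \<phi>]] by blast
  note \<psi>i = band_limitedD(2)[OF \<psi>(1)]
  obtain e where e: "S' \<subseteq> ball 0 e" using band_limitedD(1)[OF \<psi>(1)] bounded_subset_ballD by blast
  obtain \<eta> S'' where \<eta>: "band_limited S'' \<eta>" "\<And>l::real^'n. l \<in> ball 0 e \<Longrightarrow> fourier \<eta> l = 1"
    using band_limited_plateau[OF bounded_ball[of "0::real^'n" e]] by metis
  note \<eta>i = band_limitedD(2)[OF \<eta>(1)]
  define y where "y = act \<phi> x"
  have y: "y \<in> M" unfolding y_def by (rule act_mem[OF \<phi>i x])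
  have "act \<psi> y = y" unfolding y_def using act_conv[OF \<psi>i \<phi>i x] conv_absorb[OF \<psi>i \<phi> \<psi>(2)] by simp
  then have "beurling_spec act y \<subseteq> {l. fourier \<psi> l = 1}" by (rule beurling_spec_subset[OF \<psi>i y])
  also have "\<dots> \<subseteq> S'" using band_limitedD(3)[OF \<psi>(1)] zero_neq_one by fastforce
  finally have sub: "beurling_spec act y \<subseteq> ball 0 e" using e by blast
  have comp: "compact (beurling_spec act y)"
    using closed_beurling_spec bounded_subset[OF bounded_ball sub] by (simp add: compact_eq_bounded_closed)
  have "{l. fourier \<eta> l \<noteq> 0} \<subseteq> S''" using band_limitedD(3)[OF \<eta>(1)] by auto
  then have comp2: "compact (closure {l. fourier \<eta> l \<noteq> 0})"
    unfolding compact_closure by (rule bounded_subset[OF band_limitedD(1)[OF \<eta>(1)]])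
  have S1: "fourier \<eta> l * fourier \<phi> l = fourier \<phi> l" for l
  proof (cases "l \<in> S")
    case True
    then have "fourier \<psi> l \<noteq> 0" using \<psi>(2) by simp
    then have "l \<in> S'" using band_limitedD(3)[OF \<psi>(1)] by blast
    then show ?thesis using \<eta>(2) e by auto
  qed (simp add: band_limitedD(3)[OF \<phi>])
  have "conv (cshift v z \<eta>) \<phi> = cshift v z \<phi>"
    by (rule conv_eqI[OF _ \<phi> band_limited_cshift[OF \<phi>]])
       (use band_limited_cshift[OF \<eta>(1)] band_limitedD(2) S1 in \<open>auto simp: fourier_cshift[OF \<phi>] fourier_cshift[OF \<eta>(1)] mult.assoc\<close>)
  then have eq: "act (cshift v z \<phi>) x = act (cshift v z \<eta>) y"
    unfolding y_def using act_conv[OF band_limitedD(2)[OF band_limited_cshift[OF \<eta>(1)]] \<phi>i x] by metis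
  show ?thesis
    unfolding diamond_graph_def eq y_def[symmetric] mem_Collect_eq
    by (rule exI[of _ y], rule exI[of _ "cshift v z \<eta>"], intro conjI refl y comp band_limitedD(2)[OF band_limited_cshift[OF \<eta>(1)]],
        rule exI[of _ \<eta>], rule exI[of _ "ball 0 e"])
       (use \<eta>i comp2 sub \<eta>(2) in \<open>auto simp: fourier_cshift[OF \<eta>(1)] h\<close>)
qed

end

lemma band_limited_0: "band_limited {} (\<lambda>_. 0)"
  by (simp add: band_limited_def fourier_def inv_fourier_def)

context banach_l1_module begin

text \<open>For \<open>z\<close> with spectrum in a small ball around \<open>\<gamma>\<close>, \<open>f z\<close> is close to \<open>fourier f \<gamma> z\<close> relative to \<open>norm z\<close>, so
  \<open>f z = 0\<close> forces \<open>z = 0\<close>. This replaces Wiener's local inversion in the convolution algebra.\<close>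

lemma local_vanishing:
  assumes f: "integrable lborel f" "fourier f \<gamma> \<noteq> 0"
    and y: "y \<in> M" "continuous_on UNIV (\<lambda>t. T t y)" and fy: "act f y = 0"
  obtains d where "d > 0" "\<And>\<tau> S. band_limited S \<tau> \<Longrightarrow> S \<subseteq> ball \<gamma> d \<Longrightarrow> act \<tau> y = 0"
proof -
  have bb: "bounded (ball (0::real^'n) 1)" by simp
  obtain \<psi> S' where \<psi>: "band_limited S' \<psi>" "\<And>l::real^'n. l \<in> ball 0 1 \<Longrightarrow> fourier \<psi> l = 1"
    using band_limited_plateau[OF bb] by metis
  note \<psi>i = band_limitedD(2)[OF \<psi>(1)]
  obtain w :: "real \<Rightarrow> real" where w: "continuous_on UNIV w" "w 0 = 0"
      "\<And>v z. l1norm (\<lambda>t. cshift v z \<psi> t - \<psi> t) \<le> w (norm v * cmod z)"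
    by (rule l1norm_cshift_diff[OF \<psi>(1)], rule that)
  \<comment> \<open>Capping the modulus at \<open>2 * l1norm \<psi>\<close> keeps it bounded, so
    that it can be integrated against a merely integrable \<open>f\<close>.\<close>
  define W where "W v = min (w (norm v)) (2 * l1norm \<psi>)" for v :: "real^'n"
  have Wc: "continuous_on UNIV W"
    unfolding W_def by (intro continuous_intros continuous_on_compose2[OF w(1)]) auto
  then have [measurable]: "W \<in> borel_measurable borel" by (rule borel_measurable_continuous_onI)
  have W0: "W 0 = 0" using l1norm_nonneg[of \<psi>] by (simp add: W_def w(2))
  have W: "l1norm (\<lambda>t. \<psi> (t + v) - \<psi> t) \<le> W v" for v
  proof -
    have "l1norm (\<lambda>t. \<psi> (t + v) + (- 1) * \<psi> t) \<le> l1norm (\<lambda>t. \<psi> (t + v)) + l1norm (\<lambda>t. (- 1) * \<psi> t)"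
      by (rule l1norm_add[OF lborel_integrable_translate[OF \<psi>i] integrable_mult_right[OF \<psi>i]])
    then show ?thesis using w(3)[of v 1] cshift_of_real[OF \<psi>(1), of v 1] l1norm_cmult[of "-1" \<psi>] by (simp add: W_def l1norm_translate[OF \<psi>i])
  qed
  have Wb: "\<bar>W v\<bar> \<le> 2 * l1norm \<psi>" for v
  proof -
    have "0 \<le> W v" using W[of v] l1norm_nonneg order_trans by blast
    then show ?thesis by (simp add: W_def)
  qed
  have [measurable]: "f \<in> borel_measurable borel" using f borel_measurable_integrable by auto
  have fW: "integrable lborel (\<lambda>t. cmod (f t) * W (r *\<^sub>R (- t)))" for r
    by (rule Bochner_Integration.integrable_bound[of lborel "\<lambda>t. cmod (f t) * (2 * l1norm \<psi>)"])
       (use f Wb in \<open>auto simp: abs_mult abs_of_nonneg[OF l1norm_nonneg] intro!: AE_I2 mult_left_mono\<close>)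
  have "(\<lambda>n. LINT t|lborel. cmod (f t) * W (inverse (real (Suc n)) *\<^sub>R (- t))) \<longlonglongrightarrow> (LINT t|lborel. cmod (f t) * 0)"
  proof (rule integral_dominated_convergence[where w = "\<lambda>t. cmod (f t) * (2 * l1norm \<psi>)"])
    show "AE t in lborel. (\<lambda>n. cmod (f t) * W (inverse (real (Suc n)) *\<^sub>R (- t))) \<longlonglongrightarrow> cmod (f t) * 0"
    proof (rule AE_I2)
      fix t :: "real^'n"
      have "(\<lambda>n. inverse (real (Suc n)) *\<^sub>R (- t)) \<longlonglongrightarrow> 0 *\<^sub>R (- t)"
        by (rule tendsto_scaleR[OF LIMSEQ_inverse_real_of_nat tendsto_const])
      then have "(\<lambda>n. W (inverse (real (Suc n)) *\<^sub>R (- t))) \<longlonglongrightarrow> W 0"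
        using Wc by (intro isCont_tendsto_compose[of _ W]) (auto simp: continuous_on_eq_continuous_at)
      then show "(\<lambda>n. cmod (f t) * W (inverse (real (Suc n)) *\<^sub>R (- t))) \<longlonglongrightarrow> cmod (f t) * 0"
        unfolding W0 by (rule tendsto_mult[OF tendsto_const])
    qed
    show "AE t in lborel. norm (cmod (f t) * W (inverse (real (Suc n)) *\<^sub>R (- t))) \<le> cmod (f t) * (2 * l1norm \<psi>)" for n
      unfolding real_norm_def abs_mult abs_norm_cancel by (intro AE_I2 mult_left_mono Wb norm_ge_zero)
  qed (use f in auto)
  then have "(\<lambda>n. LINT t|lborel. cmod (f t) * W (inverse (real (Suc n)) *\<^sub>R (- t))) \<longlonglongrightarrow> 0"
    by (simp only: mult_zero_right integral_zero)
  from order_tendstoD(2)[OF this, of "cmod (fourier f \<gamma>)"] f(2)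
  have "\<forall>\<^sub>F n in sequentially. (LINT t|lborel. cmod (f t) * W (inverse (real (Suc n)) *\<^sub>R (- t))) < cmod (fourier f \<gamma>)"
    by (simp only: zero_less_norm_iff not_False_eq_True)
  from eventually_happens'[OF sequentially_bot this] obtain n where n: "(LINT t|lborel. cmod (f t) * W (inverse (real (Suc n)) *\<^sub>R (- t))) < cmod (fourier f \<gamma>)"
    by blast
  \<comment> \<open>At this scale \<open>act f z\<close> differs from
    \<open>fourier f \<gamma>\<close> times \<open>z\<close> by strictly less than
    \<open>cmod (fourier f \<gamma>) * norm z\<close>, unless \<open>z = 0\<close>.\<close>
  define r where "r = inverse (real (Suc n))"
  have r: "r > 0" by (simp add: r_def)
  show ?thesis
  proof (rule that[OF r])
    fix \<tau> S assume \<tau>: "band_limited S \<tau>" and S: "S \<subseteq> ball \<gamma> r"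
    note \<tau>i = band_limitedD(2)[OF \<tau>]
    define \<psi>r where "\<psi>r = dilate r \<gamma> \<psi>"
    have \<psi>ri: "integrable lborel \<psi>r" unfolding \<psi>r_def by (rule integrable_dilate[OF r \<psi>i])
    define z where "z = act \<tau> y"
    have z: "z \<in> M" "continuous_on UNIV (\<lambda>t. T t z)"
      unfolding z_def by (rule act_mem[OF \<tau>i y(1)], rule continuous_T_act[OF \<tau>i y])
    have fz: "act f z = 0"
      unfolding z_def act_act_commute[OF f(1) \<tau>i y(1)] fy by (rule act_0[OF \<tau>i])
    have "fourier \<psi>r l = 1" if "l \<in> S" for l
    proof -
      have "norm (l - \<gamma>) < r" using that S by (auto simp: dist_norm norm_minus_commute)
      then have "(1 / r) *\<^sub>R (l - \<gamma>) \<in> ball 0 1" using r by (simp add: divide_simps)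
      then show ?thesis unfolding \<psi>r_def fourier_dilate[OF r \<psi>i] by (rule \<psi>(2))
    qed
    then have "conv \<psi>r \<tau> = \<tau>" by (rule conv_absorb[OF \<psi>ri \<tau>])
    then have abs: "act \<psi>r z = z" unfolding z_def using act_conv[OF \<psi>ri \<tau>i y(1)] by simp
    \<comment> \<open>Since \<open>\<psi>r\<close> fixes \<open>z\<close>, moving \<open>z\<close>
      amounts to moving \<open>\<psi>r\<close>, whose deviation from a pure phase is bounded by
      \<open>W\<close>.\<close>
    have diff: "norm (T (- t) z - sc (cis (- (t \<bullet> \<gamma>))) z) \<le> W (r *\<^sub>R (- t)) * norm z" for t
    proof -
      let ?g = "\<lambda>s. \<psi>r (s + - t) - cis (\<gamma> \<bullet> (- t)) * \<psi>r s"
      have i: "integrable lborel (\<lambda>s. \<psi>r (s + - t))" "integrable lborel (\<lambda>s. cis (\<gamma> \<bullet> (- t)) * \<psi>r s)"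
        by (rule lborel_integrable_translate[OF \<psi>ri], rule integrable_mult_right[OF \<psi>ri])
      have "T (- t) z = act (\<lambda>s. \<psi>r (s + - t)) z"
        using T_act_translate[OF \<psi>ri z(1), of "-t"] abs by simp
      moreover have "sc (cis (- (t \<bullet> \<gamma>))) z = act (\<lambda>s. cis (\<gamma> \<bullet> (- t)) * \<psi>r s) z"
        using act_cmult_fun[OF \<psi>ri z(1)] abs by (simp add: inner_commute)
      ultimately have "T (- t) z - sc (cis (- (t \<bullet> \<gamma>))) z = act ?g z"
        using act_diff_fun[OF i z(1)] by simp
      then have "norm (T (- t) z - sc (cis (- (t \<bullet> \<gamma>))) z) \<le> l1norm ?g * norm z"
        using norm_act[OF Bochner_Integration.integrable_diff[OF i] z(1)] by simp
      also have "l1norm ?g = l1norm (\<lambda>s. \<psi> (s + r *\<^sub>R (- t)) - \<psi> s)"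
        unfolding \<psi>r_def by (rule l1norm_dilate_translate_diff[OF r \<psi>i])
      also have "\<dots> * norm z \<le> W (r *\<^sub>R (- t)) * norm z" by (intro mult_right_mono W norm_ge_zero)
      finally show ?thesis .
    qed
    have "norm (act f z - sc (fourier f \<gamma>) z) \<le> (LINT t|lborel. cmod (f t) * (W (r *\<^sub>R (- t)) * norm z))"
      by (rule norm_act_minus_fourier_le[OF f(1) z diff]) (use integrable_mult_left[OF fW, of r] in \<open>simp add: mult.assoc\<close>)
    also have "\<dots> = (LINT t|lborel. cmod (f t) * W (r *\<^sub>R (- t))) * norm z"
      by (simp only: mult.assoc[symmetric] integral_mult_left_zero)
    finally have "cmod (fourier f \<gamma>) * norm z \<le> (LINT t|lborel. cmod (f t) * W (r *\<^sub>R (- t))) * norm z"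
      by (simp add: fz norm_sc)
    then have "\<not> 0 < norm z" using n[folded r_def] mult_right_le_imp_le[of _ "norm z"] by (meson not_le)
    then have "norm z = 0" by simp
    then show "act \<tau> y = 0" by (simp add: z_def)
  qed
qed

text \<open>Every \<open>\<gamma>\<close> has a ball such that kernels with frequencies in it kill
  \<open>y = act h x\<close>: near the spectrum because the transform of \<open>h\<close> vanishes
  there, elsewhere by \<open>local_vanishing\<close>. Compactness enters through a fine tagged
  division of a large box: the kernels of the cells kill \<open>y\<close>, and their sum is a kernel
  with symbol 1 on \<open>S\<close>, which fixes \<open>y\<close>.\<close>

lemma act_eq_0_of_fourier_vanishes_near_spec:
  assumes x: "x \<in> M" "continuous_on UNIV (\<lambda>t. T t x)" and h: "band_limited S h"
    and V: "open V" "beurling_spec act x \<subseteq> V" "\<And>l. l \<in> V \<Longrightarrow> fourier h l = 0"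
  shows "act h x = 0"
proof -
  note hi = band_limitedD(2)[OF h]
  define y where "y = act h x"
  have y: "y \<in> M" "continuous_on UNIV (\<lambda>t. T t y)"
    unfolding y_def by (rule act_mem[OF hi x(1)], rule continuous_T_act[OF hi x])
  have "\<exists>d>0. \<forall>\<tau> S. band_limited S \<tau> \<longrightarrow> S \<subseteq> ball \<gamma> d \<longrightarrow> act \<tau> y = 0" for \<gamma>
  proof (cases "\<gamma> \<in> beurling_spec act x")
    case True
    then obtain d where d: "d > 0" "ball \<gamma> d \<subseteq> V" using V(1,2) open_contains_ball by blast
    have "act \<tau> y = 0" if \<tau>: "band_limited S' \<tau>" and S': "S' \<subseteq> ball \<gamma> d" for \<tau> S'
    proof -
      have "conv \<tau> h = (\<lambda>_. 0)"
      proof (rule conv_eqI[OF band_limitedD(2)[OF \<tau>] h band_limited_0])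
        fix l
        have "fourier \<tau> l * fourier h l = 0"
          using V(3) band_limitedD(3)[OF \<tau>] S' d(2) by (cases "l \<in> S'") auto
        then show "fourier (\<lambda>_. 0) l = fourier \<tau> l * fourier h l" by (simp add: fourier_def)
      qed
      then show ?thesis unfolding y_def using act_conv[OF band_limitedD(2)[OF \<tau>] hi x(1)] act_zero_fun[OF x(1)] by simp
    qed
    then show ?thesis using d(1) by blast
  next
    case False
    then obtain f where f: "integrable lborel f" "act f x = 0" "fourier f \<gamma> \<noteq> 0" by (auto simp: beurling_spec_def)
    have "act f y = 0" unfolding y_def act_act_commute[OF f(1) hi x(1)] f(2) by (rule act_0[OF hi])
    then show ?thesis using local_vanishing[OF f(1,3) y] by metis
  qed
  then obtain d where d: "\<And>\<gamma>. d \<gamma> > 0" "\<And>\<gamma> \<tau> S. band_limited S \<tau> \<Longrightarrow> S \<subseteq> ball \<gamma> (d \<gamma>) \<Longrightarrow> act \<tau> y = 0" by metis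
  obtain c where c: "\<And>l. l \<in> S \<Longrightarrow> norm l \<le> c" using band_limitedD(1)[OF h] by (auto simp: bounded_iff)
  define A where "A = (\<chi> i::'n. \<bar>c\<bar> + 1)"
  \<comment> \<open>Cells use only half of the radius; the other half absorbs the widening of the
    frequency support by the averaging radius \<open>r\<close>.\<close>
  have "gauge (\<lambda>\<gamma>. ball \<gamma> (d \<gamma> / 2))" using d(1) by (simp add: gauge_def)
  then obtain p where p: "p tagged_division_of cbox (- A) A" "(\<lambda>\<gamma>. ball \<gamma> (d \<gamma> / 2)) fine p"
    using fine_division_exists by blast
  have fin: "finite p" using p(1) by (rule tagged_division_of_finite)
  \<comment> \<open>Inserting 1 keeps the set nonempty and forces \<open>r \<le> 1\<close>, so that
    the margin 1 in \<open>A\<close> suffices for the plateau to cover \<open>S\<close>.\<close>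
  define m where "m = Min (insert 1 ((d \<circ> fst) ` p))"
  have m: "m > 0" "m \<le> 1" "\<And>\<gamma> K. (\<gamma>, K) \<in> p \<Longrightarrow> m \<le> d \<gamma>"
    unfolding m_def using fin d(1) by (auto intro!: Min_le simp: image_iff) force
  \<comment> \<open>The Euclidean norm is at most the sum of the coordinates, so widening by
    \<open>r\<close> in each coordinate moves a point by at most \<open>CARD('n) * r\<close>, which
    this choice keeps below \<open>m / 2\<close>.\<close>
  define r where "r = m / (2 * (real CARD('n) + 1))"
  have r: "r > 0" "r \<le> 1" and rm: "real CARD('n) * r < m / 2"
    using m by (simp_all add: r_def field_simps)
  have piece: "integrable lborel (set_kernel r K)" "act (set_kernel r K) y = 0" if K: "(\<gamma>, K) \<in> p" for \<gamma> K
  proof -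
    obtain a b where ab: "K = cbox a b" using tagged_division_ofD(4)[OF p(1) K] by blast
    have "\<gamma> \<in> cbox a b" using tagged_division_ofD(2)[OF p(1) K] ab by simp
    then have le: "a $ i \<le> b $ i" for i using order_trans by (auto simp: mem_box_cart)
    have sub: "cbox a b \<subseteq> ball \<gamma> (d \<gamma> / 2)" using p(2) K ab by (auto simp: fine_def)
    note bl = band_limited_box_kernel[OF r(1) le, unfolded box_kernel_eq_set_kernel, folded ab]
    show "integrable lborel (set_kernel r K)" by (rule band_limitedD(2)[OF bl])
    have "cbox (\<chi> i. a $ i - r) (\<chi> i. b $ i + r) \<subseteq> ball \<gamma> (d \<gamma>)"
    proof
      fix l assume l: "l \<in> cbox (\<chi> i. a $ i - r) (\<chi> i. b $ i + r)"
      \<comment> \<open>Clamping each coordinate gives the point of the cell nearest to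
        \<open>l\<close>.\<close>
      define k where "k = (\<chi> i. max (a $ i) (min (b $ i) (l $ i)))"
      have "k \<in> cbox a b" using le by (auto simp: mem_box_cart k_def)
      then have 1: "dist \<gamma> k < d \<gamma> / 2" using sub by auto
      have "\<bar>(k - l) $ i\<bar> \<le> r" for i using l le[of i] r by (auto simp: mem_box_cart k_def dest!: spec[of _ i])
      then have "norm (k - l) \<le> real CARD('n) * r"
        using norm_le_l1_cart[of "k - l"] sum_bounded_above[of UNIV "\<lambda>i. \<bar>(k - l) $ i\<bar>" r] by fastforce
      also have "\<dots> < d \<gamma> / 2" using rm m(3)[OF K] by simp
      finally have "dist k l < d \<gamma> / 2" by (simp add: dist_norm)
      with 1 show "l \<in> ball \<gamma> (d \<gamma>)" using dist_triangle[of \<gamma> l k] by simp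
    qed
    then show "act (set_kernel r K) y = 0" by (rule d(2)[OF bl])
  qed
  have A: "(- A) $ i \<le> A $ i" for i by (simp add: A_def)
  note bl = band_limited_box_kernel[OF r(1) A, unfolded box_kernel_eq_set_kernel]
  note ki = band_limitedD(2)[OF bl]
  have "set_kernel r (cbox (- A) A) = (\<lambda>t. \<Sum>q\<in>p. set_kernel r (snd q) t)"
    using set_kernel_tagged_division[OF p(1), of r] by (simp add: case_prod_unfold fun_eq_iff)
  then have "act (set_kernel r (cbox (- A) A)) y = act (\<lambda>t. \<Sum>q\<in>p. set_kernel r (snd q) t) y"
    by simp
  also have "\<dots> = (\<Sum>q\<in>p. act (set_kernel r (snd q)) y)"
    by (rule act_sum_fun[OF fin y(1)]) (use piece in force)
  also have "\<dots> = 0" by (rule sum.neutral) (use piece in force)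
  finally have 0: "act (set_kernel r (cbox (- A) A)) y = 0" .
  have "conv (set_kernel r (cbox (- A) A)) h = h"
  proof (rule conv_absorb[OF ki h])
    fix l assume "l \<in> S"
    then have "\<bar>l $ i\<bar> \<le> \<bar>c\<bar>" for i using c[of l] component_le_norm_cart[of l i] by linarith
    then have "- \<bar>c\<bar> \<le> l $ i" "l $ i \<le> \<bar>c\<bar>" for i by (simp_all only: abs_le_iff minus_le_iff)
    then have "(- A) $ i + r \<le> l $ i \<and> l $ i \<le> A $ i - r" for i
      using r(2) by (simp add: A_def) (smt (verit))
    then have "l \<in> cbox (\<chi> i. (- A) $ i + r) (\<chi> i. A $ i - r)" by (simp only: mem_box_cart vec_lambda_beta simp_thms)
    from fourier_box_kernel_inside[OF r(1) A this]
    show "fourier (set_kernel r (cbox (- A) A)) l = 1" by (simp only: box_kernel_eq_set_kernel)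
  qed
  then show ?thesis using act_conv[OF ki hi x(1)] 0 by (simp add: y_def)
qed

end

section \<open>Operators and coupled modules\<close>

context banach_l1_module begin

text \<open>The estimates of \<open>cshift_bounds\<close> carry a constant depending on the
  frequency sets. Near the spectrum of \<open>x\<close> the multiplier of the shift equals the
  symbol of \<open>tilted_poisson e s\<close>, so the shifted function acts on \<open>x\<close> as
  that kernel acts on \<open>act f x\<close>, with norm \<open>exp s ^ CARD('n)\<close> whatever
  \<open>S\<close> and \<open>S'\<close> are. Two frequency sets occur because members of an
  approximate identity have different bands.\<close>

lemma norm_act_cshift_diff_le:
  assumes x: "x \<in> M" "continuous_on UNIV (\<lambda>t. T t x)"
    and e: "e = 1 \<or> e = -1" and spec: "beurling_spec act x \<subseteq> {l. \<forall>i. 0 \<le> e * l $ i}" and s: "s \<ge> 0"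
    and f: "band_limited S f" and g: "band_limited S' g"
  shows "norm (act (cshift (\<chi> i. 1) (\<i> * of_real (e * s)) f) x - act (cshift (\<chi> i. 1) (\<i> * of_real (e * s)) g) x)
    \<le> exp s ^ CARD('n) * norm (act f x - act g x)"
proof (cases "s = 0")
  case True
  then show ?thesis using cshift_0[OF f] cshift_0[OF g] by simp
next
  case False
  then have s: "s > 0" using s by simp
  let ?z = "\<i> * of_real (e * s)" let ?v = "(\<chi> i. 1) :: real^'n" let ?p = "tilted_poisson e s :: real^'n \<Rightarrow> complex"
  note pi = integrable_tilted_poisson[OF s, of e, where 'n = 'n]
  have eq: "act (cshift ?v ?z f) x = act ?p (act f x)" if f: "band_limited S f" for S f
  proof -
    note fi = band_limitedD(2)[OF f]
    note c = band_limited_cshift[OF f, of ?v ?z]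
    note d = band_limited_conv[OF pi f]
    have "band_limited S (\<lambda>t. cshift ?v ?z f t + (- 1) * conv ?p f t)"
      by (rule band_limited_add[OF c band_limited_cmult[OF d]])
    then have h: "band_limited S (\<lambda>t. cshift ?v ?z f t - conv ?p f t)" by simp
    \<comment> \<open>On this neighbourhood of the spectrum the two symbols agree; here the unit
      tilt is used.\<close>
    have V: "open {l::real^'n. \<forall>i. - 1 < e * l $ i}"
    proof -
      have "{l::real^'n. \<forall>i. - 1 < e * l $ i} = (\<Inter>i. {l. - 1 < e * l $ i})" by auto
      also have "open \<dots>" by (intro open_INT finite_UNIV ballI finite open_Collect_less continuous_intros)
      finally show ?thesis .
    qed
    have "act (\<lambda>t. cshift ?v ?z f t - conv ?p f t) x = 0"
    proof (rule act_eq_0_of_fourier_vanishes_near_spec[OF x h V])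
      show "beurling_spec act x \<subseteq> {l. \<forall>i. - 1 < e * l $ i}"
        using spec by (force intro: less_le_trans[of "- 1" 0])
      fix l :: "real^'n" assume l: "l \<in> {l. \<forall>i. - 1 < e * l $ i}"
      have "fourier (\<lambda>t. cshift ?v ?z f t - conv ?p f t) l = fourier (cshift ?v ?z f) l - fourier (conv ?p f) l"
        using fourier_add[OF band_limitedD(2)[OF c] integrable_mult_right[OF band_limitedD(2)[OF d]], of "-1" l]
          fourier_cmult[of "-1" "conv ?p f" l] by simp
      also have "\<dots> = 0"
        using fourier_tilted_poisson_orthant[OF s e, of l] l
        by (simp add: fourier_cshift[OF f] fourier_conv[OF pi fi] less_imp_le)
      finally show "fourier (\<lambda>t. cshift ?v ?z f t - conv ?p f t) l = 0" .
    qed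
    then show ?thesis
      using act_diff_fun[OF band_limitedD(2)[OF c] band_limitedD(2)[OF d] x(1)] act_conv[OF pi fi x(1)] by simp
  qed
  have m: "act f x \<in> M" "act g x \<in> M" using act_mem[OF _ x(1)] band_limitedD(2) f g by blast+
  show ?thesis
    unfolding eq[OF f] eq[OF g] act_diff[OF pi m, symmetric] l1norm_tilted_poisson[OF s, of e, where 'n = 'n, symmetric]
    by (rule norm_act[OF pi M_diff[OF m]])
qed

text \<open>Each \<open>T t\<close> is isometric, so the orbit maps converge uniformly in
  \<open>t\<close>.\<close>

lemma continuous_T_limit:
  assumes x: "\<And>n::nat. x n \<in> M" "\<And>n. continuous_on UNIV (\<lambda>t. T t (x n))" and lim: "x \<longlonglongrightarrow> y" and y: "y \<in> M"
  shows "continuous_on UNIV (\<lambda>t. T t y)"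
proof (rule uniform_limit_theorem[where f = "\<lambda>n t. T t (x n)" and F = sequentially])
  show "uniform_limit UNIV (\<lambda>n t. T t (x n)) (\<lambda>t. T t y) sequentially"
    unfolding uniform_limit_iff
  proof (intro allI impI)
    fix e :: real assume "e > 0"
    then have "\<forall>\<^sub>F n in sequentially. dist (x n) y < e" using lim by (rule tendstoD[rotated])
    then show "\<forall>\<^sub>F n in sequentially. \<forall>t\<in>UNIV. dist (T t (x n)) (T t y) < e"
      by eventually_elim (simp add: dist_norm norm_T_diff[OF x(1) y])
  qed
qed (use x in auto)

end

section \<open>Complex-linear operators and their inverses\<close>

lemma cops_iff: "A \<in> cops JX JY \<longleftrightarrow> (\<forall>v. A (JX v) = JY (A v))"
  by (simp add: cops_def)

lemma complex_structure_bounded_linear: "complex_structure J \<Longrightarrow> bounded_linear J"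
  by (simp add: complex_structure_def)

lemma opsc_apply: "complex_structure JY \<Longrightarrow> opsc JY c A v = Re c *\<^sub>R A v + Im c *\<^sub>R JY (A v)"
  by (simp add: opsc_def blinfun.add_left blinfun.scaleR_left bounded_linear_Blinfun_apply complex_structure_bounded_linear)

lemma norm_opsc:
  assumes J: "complex_structure JY" shows "norm (opsc JY c A) = cmod c * norm A"
proof (rule antisym)
  have n: "norm (opsc JY c A v) = cmod c * norm (A v)" for v
    using J by (simp add: opsc_apply complex_structure_def)
  show "norm (opsc JY c A) \<le> cmod c * norm A"
    by (rule norm_blinfun_bound) (auto simp: n mult.assoc intro!: mult_left_mono norm_blinfun)
  show "cmod c * norm A \<le> norm (opsc JY c A)"
  proof (cases "c = 0")
    case False
    have "norm A \<le> norm (opsc JY c A) / cmod c"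
    proof (rule norm_blinfun_bound)
      fix v
      have "cmod c * norm (A v) \<le> norm (opsc JY c A) * norm v" using norm_blinfun[of "opsc JY c A" v] by (simp add: n)
      then show "norm (A v) \<le> norm (opsc JY c A) / cmod c * norm v" using False by (simp add: field_simps)
    qed simp
    then show ?thesis using False by (simp add: field_simps)
  qed simp
qed

lemma closed_cops:
  assumes "complex_structure JY" shows "closed (cops JX JY)"
proof -
  have "cops JX JY = (\<Inter>v. {A. blinfun_apply A (JX v) = JY (blinfun_apply A v)})" by (auto simp: cops_def)
  also have "closed \<dots>"
    by (intro closed_INT ballI closed_Collect_eq continuous_intros
        bounded_linear.continuous_on[OF complex_structure_bounded_linear[OF assms]])
  finally show ?thesis .
qed

lemma banach_l1_module_cops:
  fixes JX :: "'x::real_normed_vector \<Rightarrow> 'x" and JY :: "'y::banach \<Rightarrow> 'y"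
  assumes JY: "complex_structure JY" and l1: "l1_module (cops JX JY) (opsc JY) T act"
  shows "banach_l1_module (cops JX JY) (\<lambda>A. Blinfun JY o\<^sub>L A) (opsc JY) T act"
proof -
  note bl = complex_structure_bounded_linear[OF JY]
  interpret JY: bounded_linear JY by (rule bl)
  have 1: "bounded_linear (\<lambda>A :: 'x \<Rightarrow>\<^sub>L 'y. Blinfun JY o\<^sub>L A)"
    by (rule bounded_bilinear.bounded_linear_right[OF bounded_bilinear_blinfun_compose])
  have 2: "Blinfun JY o\<^sub>L (Blinfun JY o\<^sub>L x) = - x" for x :: "'x \<Rightarrow>\<^sub>L 'y"
    using JY by (intro blinfun_eqI) (simp add: bounded_linear_Blinfun_apply[OF bl] blinfun.minus_left complex_structure_def)
  have 3: "subspace (cops JX JY)"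
    by (rule subspaceI) (auto simp: cops_iff blinfun.add_left blinfun.scaleR_left JY.add JY.scaleR JY.zero)
  show ?thesis
    by (rule banach_l1_module.intro[OF l1 1 2 _ norm_opsc[OF JY] 3 closed_cops[OF JY]]) (simp add: opsc_def)
qed

text \<open>The resolvent identity. Continuity, convergence and first-order expansion of inverses
  all go through it.\<close>

lemma inverse_diff_eq:
  assumes "B1 o\<^sub>L A1 = id_blinfun" "A2 o\<^sub>L B2 = id_blinfun"
  shows "B1 - B2 = B1 o\<^sub>L (A2 - A1) o\<^sub>L B2"
proof (rule blinfun_eqI)
  fix y
  have "A2 (B2 y) = y" "B1 (A1 (B2 y)) = B2 y"
    using assms by (metis blinfun_apply_blinfun_compose id_blinfun.rep_eq id_apply)+
  then show "(B1 - B2) y = (B1 o\<^sub>L (A2 - A1) o\<^sub>L B2) y" by (simp add: blinfun.diff_left blinfun.diff_right)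
qed

lemma norm_compose3_le:
  assumes "norm P \<le> p" "norm Q \<le> q" "norm R \<le> r" "p \<ge> 0" "q \<ge> 0"
  shows "norm (P o\<^sub>L Q o\<^sub>L R) \<le> p * q * r"
proof -
  have "norm (P o\<^sub>L Q o\<^sub>L R) \<le> norm (P o\<^sub>L Q) * norm R" by (rule norm_blinfun_compose)
  also have "\<dots> \<le> (norm P * norm Q) * norm R" by (intro mult_right_mono norm_blinfun_compose norm_ge_zero)
  also have "\<dots> \<le> p * q * r" using assms by (intro mult_mono) auto
  finally show ?thesis .
qed

text \<open>\<open>A' x = y\<close> means \<open>x = B (y - E x)\<close>, and \<open>small\<close>
  makes the right side a contraction in \<open>x\<close> with factor 1/2. Banach's fixed point
  theorem gives bijectivity, the factor 1/2 gives the bound \<open>2 * norm B\<close>, and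
  uniqueness of solutions transfers complex linearity from \<open>A'\<close> to its inverse.\<close>

lemma cops_inverse_perturbation:
  fixes A A' :: "'x::banach \<Rightarrow>\<^sub>L 'y::banach"
  assumes B: "B \<in> cops JY JX" and A': "A' \<in> cops JX JY"
    and inv: "B o\<^sub>L A = id_blinfun" "A o\<^sub>L B = id_blinfun" and small: "norm B * norm (A' - A) \<le> 1 / 2"
  obtains B' where "B' \<in> cops JY JX" "B' o\<^sub>L A' = id_blinfun" "A' o\<^sub>L B' = id_blinfun" "norm B' \<le> 2 * norm B"
proof -
  define E where "E = A' - A"
  have BA: "B (A x) = x" and AB: "A (B y) = y" for x y
    using inv by (metis blinfun_apply_blinfun_compose id_blinfun.rep_eq id_apply)+
  have BE: "norm (B (E x)) \<le> 1 / 2 * norm x" for x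
  proof -
    have "norm (B (E x)) \<le> norm B * (norm E * norm x)"
      by (rule order_trans[OF norm_blinfun]) (intro mult_left_mono norm_blinfun norm_ge_zero)
    also have "\<dots> = (norm B * norm E) * norm x" by simp
    also have "\<dots> \<le> 1 / 2 * norm x" using small by (intro mult_right_mono) (auto simp: E_def)
    finally show ?thesis .
  qed
  have iff: "A' x = y \<longleftrightarrow> B (y - E x) = x" for x y
    using BA[of x] AB[of "y - E x"] by (auto simp: E_def blinfun.diff_left algebra_simps)
  have ex: "\<exists>!x. A' x = y" for y
    unfolding iff
  proof (rule banach_fix_type[of "1 / 2"])
    show "\<forall>x z. dist (B (y - E x)) (B (y - E z)) \<le> 1 / 2 * dist x z"
    proof (intro allI)
      fix x z
      have "B (y - E x) - B (y - E z) = B (E (z - x))" by (simp add: blinfun.diff_right)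
      then show "dist (B (y - E x)) (B (y - E z)) \<le> 1 / 2 * dist x z"
        using BE[of "z - x"] by (simp add: dist_norm norm_minus_commute)
    qed
  qed auto
  then obtain g where g: "\<And>y. A' (g y) = y" by metis
  have gu: "A' x = y \<Longrightarrow> g y = x" for x y using ex g by metis
  have gb: "norm (g y) \<le> norm y * (2 * norm B)" for y
  proof -
    have "g y = B y - B (E (g y))" using g[of y] iff[of "g y" y] by (simp add: blinfun.diff_right)
    then have "norm (g y) \<le> norm (B y) + norm (B (E (g y)))" by (metis norm_triangle_ineq4)
    also have "\<dots> \<le> norm B * norm y + 1 / 2 * norm (g y)" by (intro add_mono norm_blinfun BE)
    finally show ?thesis by (simp add: algebra_simps)
  qed
  have gl: "bounded_linear g"
    by (rule bounded_linear_intro[of _ "2 * norm B"])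
       (auto intro!: gu gb simp: blinfun.add_right blinfun.scaleR_right g)
  define B' where "B' = Blinfun g"
  have B'g: "B' y = g y" for y by (simp add: B'_def bounded_linear_Blinfun_apply[OF gl])
  show ?thesis
  proof (rule that[of B'])
    show "B' \<in> cops JY JX" using A' by (auto simp: cops_iff B'g g intro!: gu)
    show "B' o\<^sub>L A' = id_blinfun" "A' o\<^sub>L B' = id_blinfun" by (auto intro!: blinfun_eqI simp: B'g g gu)
    show "norm B' \<le> 2 * norm B" by (rule norm_blinfun_bound) (use gb in \<open>auto simp: B'g mult.commute\<close>)
  qed
qed

text \<open>The derivative of inversion is \<open>- b a' b\<close>. The error splits into
  \<open>(b - b1) (a1 - a) b\<close>, where both differences are of order \<open>z\<close>, and
  \<open>b\<close> times the Taylor remainder of \<open>a\<close> times \<open>b\<close>; these give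
  the two terms of the constant.\<close>

lemma inverse_first_order:
  assumes JX: "complex_structure JX" and JY: "complex_structure JY" and b: "b \<in> cops JY JX"
    and inv: "b o\<^sub>L a = id_blinfun" "a o\<^sub>L b = id_blinfun" and inv1: "b1 o\<^sub>L a1 = id_blinfun" "a1 o\<^sub>L b1 = id_blinfun"
    and n: "norm b \<le> k" "norm b1 \<le> k"
    and d: "norm (a1 - a) \<le> c * cmod z" and d2: "norm (a1 - a - opsc JY z a') \<le> c' * (cmod z)\<^sup>2"
    and c: "c \<ge> 0" "c' \<ge> 0"
  shows "norm (b1 - b + opsc JX z (b o\<^sub>L a' o\<^sub>L b)) \<le> (k ^ 3 * c\<^sup>2 + k\<^sup>2 * c') * (cmod z)\<^sup>2"
proof -
  have k: "k \<ge> 0" using n(1) norm_ge_zero order_trans by blast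
  \<comment> \<open>Complex linearity of \<open>b\<close> lets the scalar \<open>z\<close> pass
    through it. Real and imaginary increments therefore share the same coefficient
    \<open>b a' b\<close>, which is the Cauchy-Riemann relation.\<close>
  have lin: "b o\<^sub>L opsc JY z a' o\<^sub>L b = opsc JX z (b o\<^sub>L a' o\<^sub>L b)"
    using b by (intro blinfun_eqI) (simp add: opsc_apply[OF JX] opsc_apply[OF JY] blinfun.add_right blinfun.scaleR_right cops_iff)
  have e1: "b1 - b = b1 o\<^sub>L (a - a1) o\<^sub>L b" by (rule inverse_diff_eq[OF inv1(1) inv(2)])
  have eq: "b1 - b + opsc JX z (b o\<^sub>L a' o\<^sub>L b) = ((b - b1) o\<^sub>L (a1 - a) o\<^sub>L b) - (b o\<^sub>L (a1 - a - opsc JY z a') o\<^sub>L b)"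
    unfolding lin[symmetric]
    by (subst e1) (intro blinfun_eqI, simp add: blinfun.diff_left blinfun.diff_right blinfun.add_left blinfun.add_right algebra_simps)
  have nX: "norm ((b - b1) o\<^sub>L (a1 - a) o\<^sub>L b) \<le> (k * (c * cmod z) * k) * (c * cmod z) * k"
  proof (rule norm_compose3_le[OF _ d n(1)])
    show "norm (b - b1) \<le> k * (c * cmod z) * k"
      unfolding norm_minus_commute[of b b1] e1
      by (rule norm_compose3_le) (use n d k c in \<open>auto simp: norm_minus_commute\<close>)
  qed (use k c in auto)
  have nY: "norm (b o\<^sub>L (a1 - a - opsc JY z a') o\<^sub>L b) \<le> k * (c' * (cmod z)\<^sup>2) * k"
    by (rule norm_compose3_le[OF n(1) d2 n(1)]) (use k c in auto)
  have "norm (b1 - b + opsc JX z (b o\<^sub>L a' o\<^sub>L b)) \<le> (k * (c * cmod z) * k) * (c * cmod z) * k + k * (c' * (cmod z)\<^sup>2) * k"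
    unfolding eq by (rule order_trans[OF norm_triangle_ineq4 add_mono[OF nX nY]])
  also have "\<dots> = (k ^ 3 * c\<^sup>2 + k\<^sup>2 * c') * (cmod z)\<^sup>2" by (simp add: algebra_simps power2_eq_square power3_eq_cube)
  finally show ?thesis .
qed

text \<open>Quadratic increments force a vanishing derivative, so in the contour shift only
  first-order terms have to cancel.\<close>

lemma constant_of_quadratic_increments:
  fixes d :: "real \<Rightarrow> 'a::real_normed_vector"
  assumes "\<And>x y. x \<in> {a..b} \<Longrightarrow> y \<in> {a..b} \<Longrightarrow> norm (d y - d x) \<le> C * (y - x)\<^sup>2" "a \<le> b"
  shows "d a = d b"
proof (rule has_derivative_zero_unique[of "{a..b}" d])
  fix x assume x: "x \<in> {a..b}"
  show "(d has_derivative (\<lambda>h. 0)) (at x within {a..b})"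
  proof (rule has_derivativeI_sandwich[of 1 _ _ _ _ "\<lambda>y. C * norm (y - x)"])
    show "((\<lambda>y. C * norm (y - x)) \<longlongrightarrow> 0) (at x within {a..b})"
      by (intro tendsto_eq_intros) auto
    fix y assume y: "y \<in> {a..b}" "y \<noteq> x"
    have "norm (d y - d x) / norm (y - x) \<le> C * (y - x)\<^sup>2 / norm (y - x)"
      by (intro divide_right_mono assms x y) simp
    also have "\<dots> = C * norm (y - x)"
    proof -
      have "(y - x)\<^sup>2 = norm (y - x) * norm (y - x)" "norm (y - x) \<noteq> 0" using y(2) by (simp_all add: power2_eq_square)
      then show ?thesis by (metis nonzero_mult_div_cancel_right mult.assoc)
    qed
    finally show "norm (d y - d x - 0) / norm (y - x) \<le> C * norm (y - x)" by simp
  qed auto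
qed (use assms(2) in auto)

lemma nonpos_of_le_small_multiples:
  fixes x C :: real assumes "\<And>r. 0 < r \<Longrightarrow> r \<le> 1 \<Longrightarrow> x \<le> C * r" shows "x \<le> 0"
proof (rule LIMSEQ_le_const)
  show "(\<lambda>n. C * inverse (real (Suc n))) \<longlonglongrightarrow> 0"
    using tendsto_mult[OF tendsto_const LIMSEQ_inverse_real_of_nat, of C] by simp
  show "\<exists>N. \<forall>n\<ge>N. x \<le> C * inverse (real (Suc n))"
    using assms by (auto intro!: exI[of _ 0] simp: inverse_le_1_iff)
qed

section \<open>Coupled modules: inverses along real and complex orbits\<close>

locale coupled_l1_modules =
  fixes JX :: "'x::banach \<Rightarrow> 'x" and JY :: "'y::banach \<Rightarrow> 'y"
    and TXY :: "real^'n \<Rightarrow> ('x \<Rightarrow>\<^sub>L 'y) \<Rightarrow> ('x \<Rightarrow>\<^sub>L 'y)"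
    and TYX :: "real^'n \<Rightarrow> ('y \<Rightarrow>\<^sub>L 'x) \<Rightarrow> ('y \<Rightarrow>\<^sub>L 'x)"
    and mXY :: "(real^'n \<Rightarrow> complex) \<Rightarrow> ('x \<Rightarrow>\<^sub>L 'y) \<Rightarrow> ('x \<Rightarrow>\<^sub>L 'y)"
    and mYX :: "(real^'n \<Rightarrow> complex) \<Rightarrow> ('y \<Rightarrow>\<^sub>L 'x) \<Rightarrow> ('y \<Rightarrow>\<^sub>L 'x)"
  assumes JX: "complex_structure JX" and JY: "complex_structure JY"
    and modXY: "l1_module (cops JX JY) (opsc JY) TXY mXY"
    and modYX: "l1_module (cops JY JX) (opsc JX) TYX mYX"
    and T_inverse: "\<And>t C D. C \<in> cops JX JY \<Longrightarrow> D \<in> cops JY JX \<Longrightarrow>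
        D o\<^sub>L C = id_blinfun \<Longrightarrow> C o\<^sub>L D = id_blinfun \<Longrightarrow>
        TYX t D o\<^sub>L TXY t C = id_blinfun \<and> TXY t C o\<^sub>L TYX t D = id_blinfun"
begin

sublocale XY: banach_l1_module "cops JX JY" "\<lambda>A. Blinfun JY o\<^sub>L A" "opsc JY" TXY mXY
  by (rule banach_l1_module_cops[OF JY modXY])

sublocale YX: banach_l1_module "cops JY JX" "\<lambda>A. Blinfun JX o\<^sub>L A" "opsc JX" TYX mYX
  by (rule banach_l1_module_cops[OF JX modYX])

text \<open>The translated pair is again mutually inverse by \<open>T_inverse\<close>, so the
  resolvent identity applies to it; isometry bounds both outer factors by
  \<open>norm D\<close>.\<close>

lemma continuous_T_inverse:
  assumes C: "C \<in> cops JX JY" and D: "D \<in> cops JY JX" and inv: "D o\<^sub>L C = id_blinfun" "C o\<^sub>L D = id_blinfun"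
    and c: "continuous_on UNIV (\<lambda>t. TXY t C)"
  shows "continuous_on UNIV (\<lambda>t. TYX t D)"
proof -
  have "isCont (\<lambda>t. TYX t D) t" for t
  proof -
    have "((\<lambda>s. norm D * norm (TXY t C - TXY s C) * norm D) \<longlongrightarrow> norm D * norm (TXY t C - TXY t C) * norm D) (at t)"
      using c by (intro tendsto_intros) (auto simp: continuous_on_eq_continuous_at isCont_def)
    then have "((\<lambda>s. norm D * norm (TXY t C - TXY s C) * norm D) \<longlongrightarrow> 0) (at t)" by simp
    then have "((\<lambda>s. TYX s D - TYX t D) \<longlongrightarrow> 0) (at t)"
    proof (rule Lim_null_comparison[rotated], intro always_eventually allI)
      fix s
      have "TYX s D - TYX t D = TYX s D o\<^sub>L (TXY t C - TXY s C) o\<^sub>L TYX t D"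
        by (rule inverse_diff_eq) (use T_inverse[OF C D inv] in auto)
      also have "norm \<dots> \<le> norm D * norm (TXY t C - TXY s C) * norm D"
        by (rule norm_compose3_le) (simp_all add: YX.norm_T[OF D])
      finally show "norm (TYX s D - TYX t D) \<le> norm D * norm (TXY t C - TXY s C) * norm D" .
    qed
    then show ?thesis unfolding isCont_def by (rule LIM_zero_cancel)
  qed
  then show ?thesis by (simp add: continuous_at_imp_continuous_on)
qed

text \<open>Contour shift: \<open>\<sigma> \<mapsto> f\<^bsub>s-\<sigma>\<^esub> b\<^bsub>\<sigma>\<^esub>\<close> is constant, because moving \<open>\<sigma>\<close> by \<open>h\<close> and translating by
  the imaginary amount \<open>i e h\<close> agree to first order (Cauchy--Riemann).\<close>

lemma act_cshift_inverse:
  assumes A: "A \<in> cops JX JY" and g: "band_limited S' g" and f: "band_limited S f"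
    and e: "e = 1 \<or> e = -1" and s: "s \<ge> 0"
    and b: "\<And>\<sigma>. 0 \<le> \<sigma> \<Longrightarrow> \<sigma> \<le> s \<Longrightarrow> b \<sigma> \<in> cops JY JX \<and> norm (b \<sigma>) \<le> k \<and>
        b \<sigma> o\<^sub>L mXY (cshift v (\<i> * of_real (e * \<sigma>)) g) A = id_blinfun \<and>
        mXY (cshift v (\<i> * of_real (e * \<sigma>)) g) A o\<^sub>L b \<sigma> = id_blinfun"
  shows "mYX (cshift v (\<i> * of_real (e * s)) f) (b 0) = mYX f (b s)"
proof -
  obtain K' where K': "K' \<ge> 0"
    "\<And>z f. band_limited S' f \<Longrightarrow> l1norm (cshift v z f) \<le> exp (K' * cmod z) * l1norm f"
    "\<And>f. band_limited S' f \<Longrightarrow> l1norm (dir_deriv v f) \<le> K' * l1norm f"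
    "\<And>z f. band_limited S' f \<Longrightarrow>
      l1norm (\<lambda>t. cshift v z f t - f t - z * dir_deriv v f t) \<le> (K' * cmod z)\<^sup>2 * exp (K' * cmod z) * l1norm f"
    by (rule cshift_l1norm_bounds[OF band_limitedD(1)[OF g], of v], rule that)
  obtain K where K: "K \<ge> 0"
    "\<And>z f. band_limited S f \<Longrightarrow> l1norm (cshift v z f) \<le> exp (K * cmod z) * l1norm f"
    "\<And>f. band_limited S f \<Longrightarrow> l1norm (dir_deriv v f) \<le> K * l1norm f"
    "\<And>z f. band_limited S f \<Longrightarrow>
      l1norm (\<lambda>t. cshift v z f t - f t - z * dir_deriv v f t) \<le> (K * cmod z)\<^sup>2 * exp (K * cmod z) * l1norm f"
    by (rule cshift_l1norm_bounds[OF band_limitedD(1)[OF f], of v], rule that)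
  define Z where "Z \<sigma> = \<i> * complex_of_real (e * \<sigma>)" for \<sigma>
  have Zn: "cmod (Z h) = \<bar>h\<bar>" for h using e by (auto simp: Z_def norm_mult)
  have Zadd: "Z (x + y) = Z x + Z y" for x y by (simp add: Z_def algebra_simps)
  define G where "G \<sigma> = cshift v (Z \<sigma>) g" for \<sigma>
  define a where "a \<sigma> = mXY (G \<sigma>) A" for \<sigma>
  define a' where "a' \<sigma> = mXY (dir_deriv v (G \<sigma>)) A" for \<sigma>
  define q where "q \<sigma> = b \<sigma> o\<^sub>L a' \<sigma> o\<^sub>L b \<sigma>" for \<sigma>
  have Gb: "band_limited S' (G \<sigma>)" and Db: "band_limited S' (dir_deriv v (G \<sigma>))" for \<sigma>
    unfolding G_def using band_limited_cshift[OF g] band_limited_dir_deriv by blast+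
  have Gsh: "cshift v (Z h) (G \<sigma>) = G (\<sigma> + h)" for \<sigma> h
    unfolding G_def cshift_cshift[OF g] by (simp add: Zadd add.commute)
  have aM: "a \<sigma> \<in> cops JX JY" "a' \<sigma> \<in> cops JX JY" for \<sigma>
    unfolding a_def a'_def using XY.act_mem[OF _ A] band_limitedD(2)[OF Gb] band_limitedD(2)[OF Db] by auto
  have bM: "b \<sigma> \<in> cops JY JX" and bn: "norm (b \<sigma>) \<le> k" and ba: "b \<sigma> o\<^sub>L a \<sigma> = id_blinfun" "a \<sigma> o\<^sub>L b \<sigma> = id_blinfun"
    if "0 \<le> \<sigma>" "\<sigma> \<le> s" for \<sigma>
    using b[OF that] by (auto simp: a_def G_def Z_def)
  have qM: "q \<sigma> \<in> cops JY JX" if "0 \<le> \<sigma>" "\<sigma> \<le> s" for \<sigma>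
    using bM[OF that] aM(2)[of \<sigma>] by (simp add: q_def cops_iff)
  have k: "k \<ge> 0" using bn[of 0] s norm_ge_zero order_trans by blast
  define F where "F = exp (K' * s) * l1norm g"
  have F0: "F \<ge> 0" by (simp add: F_def l1norm_nonneg)
  have Gn: "l1norm (G \<sigma>) \<le> F" if "0 \<le> \<sigma>" "\<sigma> \<le> s" for \<sigma>
  proof -
    have "l1norm (G \<sigma>) \<le> exp (K' * \<sigma>) * l1norm g" using K'(2)[OF g, of "Z \<sigma>"] that by (simp add: G_def Zn)
    also have "\<dots> \<le> F" unfolding F_def using that K'(1) by (intro mult_right_mono l1norm_nonneg) (simp add: mult_left_mono)
    finally show ?thesis .
  qed
  \<comment> \<open>\<open>c1\<close> bounds the Taylor remainder of \<open>a\<close>,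
    \<open>c2\<close> its derivative, and \<open>c3\<close> is a Lipschitz constant for steps of
    length at most \<open>s + 1\<close>; \<open>Q\<close> is the resulting constant of
    \<open>inverse_first_order\<close>.\<close>
  define c1 where "c1 = K'\<^sup>2 * exp (K' * (s + 1)) * F * norm A"
  define c2 where "c2 = K' * F * norm A"
  define c3 where "c3 = c2 + c1 * (s + 1)"
  have c0: "c1 \<ge> 0" "c2 \<ge> 0" "c3 \<ge> 0" using K'(1) F0 s by (simp_all add: c1_def c2_def c3_def)
  define Q where "Q = k ^ 3 * c3\<^sup>2 + k\<^sup>2 * c1"
  have Q0: "Q \<ge> 0" using k c0 by (simp add: Q_def)
  \<comment> \<open>The step \<open>w\<close> is an arbitrary complex number because it is taken
    real, of size at most 1, in \<open>deriv\<close>, and imaginary, of size at most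
    \<open>s\<close>, in the contour shift; the bound \<open>s + 1\<close> admits both.\<close>
  have fo: "norm (b1 - b \<sigma> + opsc JX w (q \<sigma>)) \<le> Q * (cmod w)\<^sup>2"
    if \<sigma>: "0 \<le> \<sigma>" "\<sigma> \<le> s" and w: "cmod w \<le> s + 1"
      and inv1: "b1 o\<^sub>L mXY (cshift v w (G \<sigma>)) A = id_blinfun" "mXY (cshift v w (G \<sigma>)) A o\<^sub>L b1 = id_blinfun"
      and n1: "norm b1 \<le> k" for \<sigma> w b1
  proof -
    note i = band_limitedD(2)[OF band_limited_cshift[OF Gb[of \<sigma>], of v w]] band_limitedD(2)[OF Gb[of \<sigma>]] band_limitedD(2)[OF Db[of \<sigma>]]
    let ?h = "\<lambda>t. cshift v w (G \<sigma>) t - G \<sigma> t - w * dir_deriv v (G \<sigma>) t"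
    have hi: "integrable lborel ?h" using i by simp
    have "mXY ?h A = mXY (cshift v w (G \<sigma>)) A - a \<sigma> - opsc JY w (a' \<sigma>)"
      using XY.act_diff_fun[OF Bochner_Integration.integrable_diff[OF i(1,2)] integrable_mult_right[OF i(3)] A, of w]
        XY.act_diff_fun[OF i(1,2) A] XY.act_cmult_fun[OF i(3) A, of w] by (simp add: a_def a'_def)
    moreover have "norm (mXY ?h A) \<le> c1 * (cmod w)\<^sup>2"
    proof -
      have "norm (mXY ?h A) \<le> l1norm ?h * norm A" by (rule XY.norm_act[OF hi A])
      also have "\<dots> \<le> ((K' * cmod w)\<^sup>2 * exp (K' * (s + 1)) * F) * norm A"
      proof (rule mult_right_mono)
        have "l1norm ?h \<le> (K' * cmod w)\<^sup>2 * exp (K' * cmod w) * l1norm (G \<sigma>)" by (rule K'(4)[OF Gb])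
        also have "\<dots> \<le> (K' * cmod w)\<^sup>2 * exp (K' * (s + 1)) * F"
          using Gn[OF \<sigma>] w K'(1) by (intro mult_mono) (auto simp: l1norm_nonneg mult_left_mono)
        finally show "l1norm ?h \<le> (K' * cmod w)\<^sup>2 * exp (K' * (s + 1)) * F" .
      qed simp
      also have "\<dots> = c1 * (cmod w)\<^sup>2" by (simp add: c1_def power_mult_distrib)
      finally show ?thesis .
    qed
    ultimately have d2: "norm (mXY (cshift v w (G \<sigma>)) A - a \<sigma> - opsc JY w (a' \<sigma>)) \<le> c1 * (cmod w)\<^sup>2" by simp
    have "norm (a' \<sigma>) \<le> c2"
    proof -
      have "norm (a' \<sigma>) \<le> l1norm (dir_deriv v (G \<sigma>)) * norm A" unfolding a'_def by (rule XY.norm_act[OF i(3) A])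
      also have "\<dots> \<le> (K' * F) * norm A"
        using K'(3)[OF Gb[of \<sigma>]] mult_left_mono[OF Gn[OF \<sigma>] K'(1)] by (intro mult_right_mono) auto
      finally show ?thesis by (simp add: c2_def)
    qed
    then have "norm (opsc JY w (a' \<sigma>)) \<le> cmod w * c2" unfolding XY.norm_sc by (intro mult_left_mono) auto
    moreover have "c1 * (cmod w)\<^sup>2 \<le> c1 * (s + 1) * cmod w"
      using mult_right_mono[OF w, of "cmod w"] c0(1) by (simp add: power2_eq_square mult.assoc mult_left_mono)
    ultimately have d1: "norm (mXY (cshift v w (G \<sigma>)) A - a \<sigma>) \<le> c3 * cmod w"
      using d2 norm_triangle_sub[of "mXY (cshift v w (G \<sigma>)) A - a \<sigma>" "opsc JY w (a' \<sigma>)"]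
      unfolding c3_def distrib_right by (simp add: mult.commute)
    show ?thesis unfolding Q_def q_def
      by (rule inverse_first_order[OF JX JY bM[OF \<sigma>] ba[OF \<sigma>] inv1 bn[OF \<sigma>] n1 d1 d2 c0(3,1)])
  qed
  \<comment> \<open>The Cauchy-Riemann equation in weak form. For a real step \<open>r\<close> the
    inverse of the shifted operator is the translate
    \<open>TYX (r *\<^sub>R v) (b \<sigma>)\<close>. Moving the translation onto \<open>f'\<close>
    produces the derivative of \<open>f'\<close>; expanding the inverse by \<open>fo\<close>
    produces \<open>- q \<sigma>\<close>. Dividing by \<open>r\<close> and letting it tend to 0
    identifies the two.\<close>
  have deriv: "mYX (dir_deriv v f') (b \<sigma>) + mYX f' (q \<sigma>) = 0" if f': "band_limited S f'" and \<sigma>: "0 \<le> \<sigma>" "\<sigma> \<le> s" for f' \<sigma>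
  proof -
    let ?X = "mYX (dir_deriv v f') (b \<sigma>) + mYX f' (q \<sigma>)"
    have "norm ?X \<le> (l1norm f' * Q + K\<^sup>2 * exp K * l1norm f' * k) * r" if r: "0 < r" "r \<le> 1" for r
    proof -
      let ?w = "complex_of_real r" let ?D = "dir_deriv v f'"
      note i = band_limitedD(2)[OF band_limited_cshift[OF f', of v ?w]] band_limitedD(2)[OF f'] band_limitedD(2)[OF band_limited_dir_deriv[OF f', of v]]
      have shG: "cshift v ?w (G \<sigma>) = (\<lambda>t. G \<sigma> (t + r *\<^sub>R v))" and shf: "cshift v ?w f' = (\<lambda>t. f' (t + r *\<^sub>R v))"
        by (auto simp: cshift_of_real[OF Gb] cshift_of_real[OF f'])
      have Ta: "TXY (r *\<^sub>R v) (a \<sigma>) = mXY (cshift v ?w (G \<sigma>)) A"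
        unfolding shG a_def by (rule XY.T_act_translate[OF band_limitedD(2)[OF Gb] A])
      let ?b1 = "TYX (r *\<^sub>R v) (b \<sigma>)"
      have b1M: "?b1 \<in> cops JY JX" by (rule YX.T_mem[OF bM[OF \<sigma>]])
      have "norm (?b1 - b \<sigma> + opsc JX ?w (q \<sigma>)) \<le> Q * (cmod ?w)\<^sup>2"
        by (rule fo[OF \<sigma>]) (use r s T_inverse[OF aM(1) bM[OF \<sigma>] ba[OF \<sigma>]] bn[OF \<sigma>] YX.norm_T[OF bM[OF \<sigma>]] in \<open>auto simp: Ta[symmetric]\<close>)
      then have u: "norm (?b1 - b \<sigma> + r *\<^sub>R q \<sigma>) \<le> Q * r\<^sup>2" by (simp only: YX.sc_of_real) simp
      have uM: "?b1 - b \<sigma> \<in> cops JY JX" "r *\<^sub>R q \<sigma> \<in> cops JY JX"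
        using YX.M_diff[OF b1M bM[OF \<sigma>]] subspace_scale[OF YX.subspace_M qM[OF \<sigma>]] by auto
      let ?h = "\<lambda>t. cshift v ?w f' t - f' t - ?w * ?D t"
      have hi: "integrable lborel ?h" using i by simp
      have e1: "mYX f' (?b1 - b \<sigma> + r *\<^sub>R q \<sigma>) = mYX (cshift v ?w f') (b \<sigma>) - mYX f' (b \<sigma>) + r *\<^sub>R mYX f' (q \<sigma>)"
        using YX.act_add[OF i(2) uM] YX.act_diff[OF i(2) b1M bM[OF \<sigma>]] YX.act_sc[OF i(2) qM[OF \<sigma>], of ?w]
          YX.T_act[OF i(2) bM[OF \<sigma>], of "r *\<^sub>R v"] YX.T_act_translate[OF i(2) bM[OF \<sigma>], of "r *\<^sub>R v"]
        by (simp add: YX.sc_of_real shf)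
      have e2: "mYX ?h (b \<sigma>) = mYX (cshift v ?w f') (b \<sigma>) - mYX f' (b \<sigma>) - r *\<^sub>R mYX ?D (b \<sigma>)"
        using YX.act_diff_fun[OF Bochner_Integration.integrable_diff[OF i(1,2)] integrable_mult_right[OF i(3)] bM[OF \<sigma>], of ?w]
          YX.act_diff_fun[OF i(1,2) bM[OF \<sigma>]] YX.act_cmult_fun[OF i(3) bM[OF \<sigma>], of ?w]
        by (simp add: YX.sc_of_real)
      have "r *\<^sub>R ?X = mYX f' (?b1 - b \<sigma> + r *\<^sub>R q \<sigma>) - mYX ?h (b \<sigma>)"
        unfolding e1 e2 by (simp add: algebra_simps)
      then have "r * norm ?X \<le> norm (mYX f' (?b1 - b \<sigma> + r *\<^sub>R q \<sigma>)) + norm (mYX ?h (b \<sigma>))"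
        using norm_triangle_ineq4[of "mYX f' (?b1 - b \<sigma> + r *\<^sub>R q \<sigma>)" "mYX ?h (b \<sigma>)"] r norm_scaleR[of r ?X] by simp
      also have "norm (mYX f' (?b1 - b \<sigma> + r *\<^sub>R q \<sigma>)) \<le> l1norm f' * (Q * r\<^sup>2)"
        by (rule order_trans[OF YX.norm_act[OF i(2) subspace_add[OF YX.subspace_M uM]]]) (intro mult_left_mono u l1norm_nonneg)
      also have "norm (mYX ?h (b \<sigma>)) \<le> (K\<^sup>2 * exp K * l1norm f' * k) * r\<^sup>2"
      proof -
        have "norm (mYX ?h (b \<sigma>)) \<le> l1norm ?h * norm (b \<sigma>)" by (rule YX.norm_act[OF hi bM[OF \<sigma>]])
        also have "\<dots> \<le> ((K * r)\<^sup>2 * exp (K * r) * l1norm f') * k"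
          using K(4)[OF f', of ?w] r bn[OF \<sigma>] by (intro mult_mono) (auto simp: l1norm_nonneg)
        also have "\<dots> \<le> ((K * r)\<^sup>2 * exp K * l1norm f') * k"
          using r K(1) k by (intro mult_right_mono mult_left_mono) (auto simp: l1norm_nonneg mult_left_le)
        also have "\<dots> = (K\<^sup>2 * exp K * l1norm f' * k) * r\<^sup>2" by (simp add: power_mult_distrib)
        finally show ?thesis .
      qed
      finally have "r * norm ?X \<le> r * ((l1norm f' * Q + K\<^sup>2 * exp K * l1norm f' * k) * r)"
        by (simp add: algebra_simps power2_eq_square)
      then show ?thesis using r(1) by (rule mult_left_le_imp_le)
    qed
    from nonpos_of_le_small_multiples[OF this] show ?thesis by simp
  qed
  define L where "L = exp (K * s) * l1norm f"
  define d where "d \<sigma> = mYX (cshift v (Z (s - \<sigma>)) f) (b \<sigma>)" for \<sigma>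
  have "d 0 = d s"
  proof (rule constant_of_quadratic_increments[OF _ s])
    fix \<sigma> \<sigma>' assume "\<sigma> \<in> {0..s}" "\<sigma>' \<in> {0..s}"
    then have \<sigma>: "0 \<le> \<sigma>" "\<sigma> \<le> s" and \<sigma>': "0 \<le> \<sigma>'" "\<sigma>' \<le> s" by auto
    define h where "h = \<sigma>' - \<sigma>"
    have h: "\<bar>h\<bar> \<le> s" using \<sigma> \<sigma>' by (auto simp: h_def)
    \<comment> \<open>The kernel is expanded at \<open>s - \<sigma>'\<close> and the inverse at
      \<open>\<sigma>\<close>; with these base points the increment of \<open>d\<close> splits
      without a product of increments.\<close>
    let ?f = "cshift v (Z (s - \<sigma>')) f" let ?D = "dir_deriv v ?f"
    note fb = band_limited_cshift[OF f, of v "Z (s - \<sigma>')"]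
    note i = band_limitedD(2)[OF band_limited_cshift[OF fb, of v "Z h"]] band_limitedD(2)[OF fb] band_limitedD(2)[OF band_limited_dir_deriv[OF fb, of v]]
    have sh: "cshift v (Z (s - \<sigma>)) f = cshift v (Z h) ?f"
      unfolding cshift_cshift[OF f] Zadd[symmetric] by (simp add: h_def)
    have fn: "l1norm ?f \<le> L"
    proof -
      have "l1norm ?f \<le> exp (K * (s - \<sigma>')) * l1norm f" using K(2)[OF f, of "Z (s - \<sigma>')"] \<sigma>' by (simp add: Zn)
      also have "\<dots> \<le> L" unfolding L_def using \<sigma>' K(1) by (intro mult_right_mono l1norm_nonneg) (simp add: mult_left_mono)
      finally show ?thesis .
    qed
    have "norm (b \<sigma>' - b \<sigma> + opsc JX (Z h) (q \<sigma>)) \<le> Q * (cmod (Z h))\<^sup>2"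
      by (rule fo[OF \<sigma>]) (use h ba[OF \<sigma>'] bn[OF \<sigma>'] in \<open>auto simp: Gsh Zn a_def h_def\<close>)
    then have u: "norm (b \<sigma>' - b \<sigma> + opsc JX (Z h) (q \<sigma>)) \<le> Q * h\<^sup>2" by (simp add: Zn)
    have uM: "b \<sigma>' - b \<sigma> \<in> cops JY JX" "opsc JX (Z h) (q \<sigma>) \<in> cops JY JX"
      using YX.M_diff[OF bM[OF \<sigma>'] bM[OF \<sigma>]] qM[OF \<sigma>] JX
      by (auto simp: cops_iff opsc_apply bounded_linear.linear[OF complex_structure_bounded_linear] linear_add linear_scale)
    let ?h = "\<lambda>t. cshift v (Z h) ?f t - ?f t - Z h * ?D t"
    have hi: "integrable lborel ?h" using i by simp
    have e1: "mYX ?f (b \<sigma>' - b \<sigma> + opsc JX (Z h) (q \<sigma>)) = d \<sigma>' - mYX ?f (b \<sigma>) + opsc JX (Z h) (mYX ?f (q \<sigma>))"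
      using YX.act_add[OF i(2) uM] YX.act_diff[OF i(2) bM[OF \<sigma>'] bM[OF \<sigma>]] YX.act_sc[OF i(2) qM[OF \<sigma>], of "Z h"]
      by (simp add: d_def)
    have e2: "mYX ?h (b \<sigma>) = d \<sigma> - mYX ?f (b \<sigma>) - opsc JX (Z h) (mYX ?D (b \<sigma>))"
      using YX.act_diff_fun[OF Bochner_Integration.integrable_diff[OF i(1,2)] integrable_mult_right[OF i(3)] bM[OF \<sigma>], of "Z h"]
        YX.act_diff_fun[OF i(1,2) bM[OF \<sigma>]] YX.act_cmult_fun[OF i(3) bM[OF \<sigma>], of "Z h"]
      by (simp add: d_def sh)
    \<comment> \<open>The first-order terms form \<open>Z h\<close> times the weak Cauchy-Riemann
      equation for \<open>?f\<close>, so only quadratic errors survive in \<open>dd\<close>.\<close>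
    have "opsc JX (Z h) (mYX ?D (b \<sigma>)) + opsc JX (Z h) (mYX ?f (q \<sigma>)) = 0"
      unfolding YX.sc_add[symmetric] deriv[OF fb \<sigma>] by (simp add: opsc_def)
    then have dd: "d \<sigma>' - d \<sigma> = mYX ?f (b \<sigma>' - b \<sigma> + opsc JX (Z h) (q \<sigma>)) - mYX ?h (b \<sigma>)"
      unfolding e1 e2 by (simp add: algebra_simps)
    have "norm (d \<sigma>' - d \<sigma>) \<le> norm (mYX ?f (b \<sigma>' - b \<sigma> + opsc JX (Z h) (q \<sigma>))) + norm (mYX ?h (b \<sigma>))"
      unfolding dd by (rule norm_triangle_ineq4)
    also have "norm (mYX ?f (b \<sigma>' - b \<sigma> + opsc JX (Z h) (q \<sigma>))) \<le> L * (Q * h\<^sup>2)"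
      by (rule order_trans[OF YX.norm_act[OF i(2) subspace_add[OF YX.subspace_M uM]]])
         (intro mult_mono u fn order_trans[OF l1norm_nonneg fn] norm_ge_zero)
    also have "norm (mYX ?h (b \<sigma>)) \<le> (K\<^sup>2 * exp (K * s) * L * k) * h\<^sup>2"
    proof -
      have "norm (mYX ?h (b \<sigma>)) \<le> l1norm ?h * norm (b \<sigma>)" by (rule YX.norm_act[OF hi bM[OF \<sigma>]])
      also have "\<dots> \<le> ((K * \<bar>h\<bar>)\<^sup>2 * exp (K * \<bar>h\<bar>) * l1norm ?f) * k"
        using K(4)[OF fb, of "Z h"] bn[OF \<sigma>] by (intro mult_mono) (auto simp: l1norm_nonneg Zn)
      also have "\<dots> \<le> ((K * \<bar>h\<bar>)\<^sup>2 * exp (K * s) * L) * k"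
        using h K(1) k fn by (intro mult_right_mono mult_mono) (auto simp: l1norm_nonneg mult_left_mono)
      also have "\<dots> = (K\<^sup>2 * exp (K * s) * L * k) * h\<^sup>2" by (simp add: power_mult_distrib)
      finally show ?thesis .
    qed
    finally show "norm (d \<sigma>' - d \<sigma>) \<le> (L * Q + K\<^sup>2 * exp (K * s) * L * k) * (\<sigma>' - \<sigma>)\<^sup>2"
      by (simp add: h_def algebra_simps)
  qed
  then show ?thesis using cshift_0[OF f, of v] by (simp add: d_def Z_def)
qed

end

section \<open>The common strip, the limits and the graph\<close>

context coupled_l1_modules begin

lemma inverse_in_fc_domain:
  assumes A: "A \<in> cops JX JY" and B: "B \<in> cops JY JX" and inv: "B o\<^sub>L A = id_blinfun" "A o\<^sub>L B = id_blinfun"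
    and Ac: "continuous_on UNIV (\<lambda>t. TXY t A)"
    and e: "e = 1 \<or> e = -1" and spec: "beurling_spec mXY A \<subseteq> {l. \<forall>i. 0 \<le> e * l $ i}"
  shows "\<exists>s>0. B \<in> fc_domain (cops JY JX) mYX (expo ((- (e * s)) *\<^sub>R (\<chi> i. 1)))"
proof -
  define v where "v = ((\<chi> i. 1) :: real^'n)"
  define Z where "Z \<sigma> = \<i> * complex_of_real (e * \<sigma>)" for \<sigma>
  have Zn: "cmod (Z h) = \<bar>h\<bar>" for h using e by (auto simp: Z_def norm_mult)
  obtain \<phi> S where \<phi>: "band_limited S \<phi>" "fourier \<phi> (0::real^'n) = 1"
    using band_limited_plateau[of "{0::real^'n}"] by (metis bounded_insert bounded_empty singletonI)
  define \<Phi> where "\<Phi> n = dilate (real (Suc n)) 0 \<phi>" for n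
  define R where "R n = (\<lambda>l. 0 + real (Suc n) *\<^sub>R l) ` S" for n
  have \<Phi>: "band_limited (R n) (\<Phi> n)" for n
    unfolding \<Phi>_def R_def by (rule band_limited_dilate[OF _ \<phi>(1)]) simp
  have \<Phi>i: "integrable lborel (\<Phi> n)" for n by (rule band_limitedD(2)[OF \<Phi>])
  have ci: "integrable lborel (cshift v z (\<Phi> n))" for z n by (rule band_limitedD(2)[OF band_limited_cshift[OF \<Phi>]])
  define a where "a n \<sigma> = mXY (cshift v (Z \<sigma>) (\<Phi> n)) A" for n \<sigma>
  have a0: "a n 0 = mXY (\<Phi> n) A" for n by (simp add: a_def Z_def cshift_0[OF \<Phi>])
  have aM: "a n \<sigma> \<in> cops JX JY" for n \<sigma> unfolding a_def by (rule XY.act_mem[OF ci A])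
  have alim: "(\<lambda>n. a n 0) \<longlonglongrightarrow> A"
    unfolding a0 \<Phi>_def by (rule XY.act_dilate_tendsto[OF band_limitedD(2)[OF \<phi>(1)] \<phi>(2) A Ac])
  \<comment> \<open>Heights are restricted to at most 1 in advance, so that one constant bounds
    \<open>exp \<sigma> ^ CARD('n)\<close>.\<close>
  define C where "C = exp (1::real) ^ CARD('n)"
  have C1: "C \<ge> 1" unfolding C_def by (intro one_le_power) simp
  have adiff: "norm (a n \<sigma> - a n' \<sigma>) \<le> C * norm (a n 0 - a n' 0)" if "0 \<le> \<sigma>" "\<sigma> \<le> 1" for n n' \<sigma>
  proof -
    have "norm (a n \<sigma> - a n' \<sigma>) \<le> exp \<sigma> ^ CARD('n) * norm (a n 0 - a n' 0)"
      unfolding a0 unfolding a_def Z_def v_def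
      by (rule XY.norm_act_cshift_diff_le[OF A Ac e spec that(1) \<Phi> \<Phi>])
    also have "\<dots> \<le> C * norm (a n 0 - a n' 0)"
      unfolding C_def using that by (intro mult_right_mono power_mono) auto
    finally show ?thesis .
  qed
  \<comment> \<open>\<open>2 * C + 2\<close> collects the three moves made in \<open>near\<close>:
    \<open>2 * C\<close> from index \<open>n\<close> to \<open>m\<close> at height
    \<open>\<sigma>\<close>, 1 from \<open>\<sigma>\<close> down to 0 at index \<open>m\<close>, and
    1 from \<open>a m 0\<close> to \<open>A\<close>. The other factors keep \<open>norm B\<close>
    times the total below the threshold 1/2 of \<open>cops_inverse_perturbation\<close>.\<close>
  define \<eta> where "\<eta> = 1 / (2 * (2 * C + 2) * (norm B + 1))"
  have \<eta>: "\<eta> > 0" using C1 by (simp add: \<eta>_def add_nonneg_pos)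
  have "\<forall>\<^sub>F n in sequentially. dist (a n 0) A < \<eta>" by (rule tendstoD[OF alim \<eta>])
  then obtain m where m: "\<And>n. n \<ge> m \<Longrightarrow> norm (a n 0 - A) \<le> \<eta>"
    unfolding eventually_sequentially dist_norm using less_imp_le by blast
  obtain w :: "real \<Rightarrow> real" where w: "continuous_on UNIV w" "w 0 = 0"
      "\<And>v z. l1norm (\<lambda>t. cshift v z (\<Phi> m) t - \<Phi> m t) \<le> w (norm v * cmod z)"
    by (rule l1norm_cshift_diff[OF \<Phi>[of m]], rule that)
  have "continuous_on UNIV (\<lambda>\<sigma>. w (norm v * \<sigma>) * norm A)"
    by (intro continuous_intros continuous_on_compose2[OF w(1)]) auto
  then have "isCont (\<lambda>\<sigma>. w (norm v * \<sigma>) * norm A) 0" by (simp add: continuous_on_eq_continuous_at)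
  then obtain d where d: "d > 0" "\<And>\<sigma>. \<bar>\<sigma>\<bar> < d \<Longrightarrow> \<bar>w (norm v * \<sigma>) * norm A\<bar> < \<eta>"
    unfolding continuous_at_eps_delta using \<eta> w(2) by (auto simp: dist_real_def)
  \<comment> \<open>The height is dictated by the single index \<open>m\<close> through its modulus
    \<open>w\<close>, together with the bound 1 needed in \<open>adiff\<close>, which carries the
    estimate to all later indices.\<close>
  define s where "s = min 1 (d / 2)"
  have s: "s > 0" "s \<le> 1" "s < d" using d(1) by (auto simp: s_def)
  have near: "norm (a n \<sigma> - A) \<le> (2 * C + 2) * \<eta>" if n: "n \<ge> m" and \<sigma>: "0 \<le> \<sigma>" "\<sigma> \<le> s" for n \<sigma>
  proof -
    have "norm (a n 0 - a m 0) \<le> norm (a n 0 - A) + norm (a m 0 - A)"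
      using norm_triangle_ineq4[of "a n 0 - A" "a m 0 - A"] by simp
    also have "\<dots> \<le> 2 * \<eta>" using m[OF n] m[of m] by simp
    finally have "C * norm (a n 0 - a m 0) \<le> C * (2 * \<eta>)" using C1 by (intro mult_left_mono) auto
    then have 1: "norm (a n \<sigma> - a m \<sigma>) \<le> C * (2 * \<eta>)" using adiff[of \<sigma> n m] \<sigma> s by linarith
    have "norm (a m \<sigma> - a m 0) \<le> l1norm (\<lambda>t. cshift v (Z \<sigma>) (\<Phi> m) t - \<Phi> m t) * norm A"
      unfolding a0 unfolding a_def XY.act_diff_fun[OF ci \<Phi>i A, symmetric]
      by (rule XY.norm_act[OF Bochner_Integration.integrable_diff[OF ci \<Phi>i] A])
    also have "\<dots> \<le> w (norm v * \<sigma>) * norm A"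
      using w(3)[of v "Z \<sigma>"] \<sigma> by (intro mult_right_mono) (auto simp: Zn)
    also have "\<dots> \<le> \<eta>" using d(2)[of \<sigma>] \<sigma> s by (simp add: abs_less_iff less_imp_le)
    finally have 2: "norm (a m \<sigma> - a m 0) \<le> \<eta>" .
    have "a n \<sigma> - A = (a n \<sigma> - a m \<sigma>) + (a m \<sigma> - a m 0) + (a m 0 - A)" by simp
    then have "norm (a n \<sigma> - A) \<le> norm (a n \<sigma> - a m \<sigma>) + norm (a m \<sigma> - a m 0) + norm (a m 0 - A)"
      by (metis norm_triangle_ineq norm_triangle_mono order_refl)
    then show ?thesis using 1 2 m[of m] by (simp add: algebra_simps)
  qed
  have "\<exists>b'. b' \<in> cops JY JX \<and> norm b' \<le> 2 * norm B \<and> b' o\<^sub>L a n \<sigma> = id_blinfun \<and> a n \<sigma> o\<^sub>L b' = id_blinfun"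
    if n: "n \<ge> m" and \<sigma>: "0 \<le> \<sigma>" "\<sigma> \<le> s" for n \<sigma>
  proof -
    have "norm B * norm (a n \<sigma> - A) \<le> (norm B + 1) * ((2 * C + 2) * \<eta>)"
      using near[OF n \<sigma>] by (intro mult_mono) auto
    also have "\<dots> = 1 / 2"
    proof -
      have "norm B + 1 \<noteq> 0" "2 * C + 2 \<noteq> 0" using C1 norm_ge_zero[of B] by linarith+
      then show ?thesis by (simp add: \<eta>_def)
    qed
    finally show ?thesis using cops_inverse_perturbation[OF B aM inv] by metis
  qed
  then obtain b where b: "\<And>n \<sigma>. n \<ge> m \<Longrightarrow> 0 \<le> \<sigma> \<Longrightarrow> \<sigma> \<le> s \<Longrightarrow>
      b n \<sigma> \<in> cops JY JX \<and> norm (b n \<sigma>) \<le> 2 * norm B \<and> b n \<sigma> o\<^sub>L a n \<sigma> = id_blinfun \<and> a n \<sigma> o\<^sub>L b n \<sigma> = id_blinfun"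
    by metis
  have b0: "b (n + m) 0 \<in> cops JY JX" "norm (b (n + m) 0) \<le> 2 * norm B" "b (n + m) 0 o\<^sub>L a (n + m) 0 = id_blinfun" for n
    using b[of "n + m" 0] s by auto
  have bs: "b (n + m) s \<in> cops JY JX" "norm (b (n + m) s) \<le> 2 * norm B" "b (n + m) s o\<^sub>L a (n + m) s = id_blinfun"
    "a (n + m) s o\<^sub>L b (n + m) s = id_blinfun" for n
    using b[of "n + m" s] s by auto
  have blim: "(\<lambda>n. b (n + m) 0) \<longlonglongrightarrow> B"
  proof -
    have "(\<lambda>n. a (n + m) 0) \<longlonglongrightarrow> A" using alim by (rule LIMSEQ_ignore_initial_segment)
    then have "(\<lambda>n. 2 * norm B * norm (A - a (n + m) 0) * norm B) \<longlonglongrightarrow> 2 * norm B * norm (A - A) * norm B" by (intro tendsto_intros)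
    then have "(\<lambda>n. 2 * norm B * norm (A - a (n + m) 0) * norm B) \<longlonglongrightarrow> 0" by simp
    then have "(\<lambda>n. b (n + m) 0 - B) \<longlonglongrightarrow> 0"
    proof (rule Lim_null_comparison[rotated], intro always_eventually allI)
      fix n
      show "norm (b (n + m) 0 - B) \<le> 2 * norm B * norm (A - a (n + m) 0) * norm B"
        unfolding inverse_diff_eq[OF b0(3) inv(2)] by (rule norm_compose3_le[OF b0(2)]) auto
    qed
    then show ?thesis by (rule LIM_zero_cancel)
  qed
  \<comment> \<open>The Cauchy property at height \<open>s\<close> is inherited from height 0 by the
    resolvent identity and \<open>adiff\<close>. The summand 1 makes \<open>?k\<close>
    positive.\<close>
  have "Cauchy (\<lambda>n. b (n + m) s)"
  proof (rule CauchyI)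
    fix \<epsilon> :: real assume \<epsilon>: "\<epsilon> > 0"
    let ?k = "2 * norm B * C * (2 * norm B) + 1"
    have k: "?k > 0" using C1 by (intro add_nonneg_pos) auto
    have "Cauchy (\<lambda>n. a n 0)" using alim by (rule LIMSEQ_imp_Cauchy)
    then obtain M where M: "\<And>i j. i \<ge> M \<Longrightarrow> j \<ge> M \<Longrightarrow> norm (a i 0 - a j 0) < \<epsilon> / ?k"
      using CauchyD[of _ "\<epsilon> / ?k"] \<epsilon> k by (metis divide_pos_pos)
    have "norm (b (i + m) s - b (j + m) s) < \<epsilon>" if "i \<ge> M" "j \<ge> M" for i j
    proof -
      have ij: "norm (a (j + m) 0 - a (i + m) 0) < \<epsilon> / ?k" using that by (intro M) auto
      have "norm (b (i + m) s - b (j + m) s) \<le> 2 * norm B * (C * norm (a (j + m) 0 - a (i + m) 0)) * (2 * norm B)"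
        unfolding inverse_diff_eq[OF bs(3) bs(4)]
        by (rule norm_compose3_le[OF bs(2) adiff bs(2)]) (use s C1 in auto)
      also have "\<dots> \<le> ?k * norm (a (j + m) 0 - a (i + m) 0)" by (simp add: algebra_simps)
      also have "\<dots> < ?k * (\<epsilon> / ?k)" using k ij by (intro mult_strict_left_mono)
      also have "\<dots> = \<epsilon>" using k by simp
      finally show ?thesis .
    qed
    then show "\<exists>M. \<forall>i\<ge>M. \<forall>j\<ge>M. norm (b (i + m) s - b (j + m) s) < \<epsilon>" by blast
  qed
  then obtain Bs where Bs: "(\<lambda>n. b (n + m) s) \<longlonglongrightarrow> Bs" by (metis Cauchy_convergent_iff convergent_def)
  have BsM: "Bs \<in> cops JY JX" using closed_sequentially[OF YX.closed_M _ Bs] bs(1) by blast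
  \<comment> \<open>Needed for \<open>mYX (\<Phi> j) Bs\<close> to tend to \<open>Bs\<close>:
    continuity passes from the regularized operators to their inverses and on to the limit.\<close>
  have Bsc: "continuous_on UNIV (\<lambda>t. TYX t Bs)"
  proof (rule YX.continuous_T_limit[OF bs(1) _ Bs BsM])
    fix n
    have "continuous_on UNIV (\<lambda>t. TXY t (a (n + m) s))" unfolding a_def by (rule XY.continuous_T_act[OF ci A Ac])
    then show "continuous_on UNIV (\<lambda>t. TYX t (b (n + m) s))" by (rule continuous_T_inverse[OF aM bs(1,3,4)])
  qed
  have Bc: "continuous_on UNIV (\<lambda>t. TYX t B)" by (rule continuous_T_inverse[OF A B inv Ac])
  \<comment> \<open>The kernel \<open>\<Phi> j\<close> acting on the inverses is kept apart from the
    index \<open>n\<close> that regularizes \<open>A\<close>: for fixed \<open>j\<close> the action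
    is continuous, so \<open>n\<close> can go to infinity first.\<close>
  have eq: "mYX (cshift v (Z s) (\<Phi> j)) B = mYX (\<Phi> j) Bs" for j
  proof -
    have "mYX (cshift v (Z s) (\<Phi> j)) (b (n + m) 0) = mYX (\<Phi> j) (b (n + m) s)" for n
      unfolding Z_def
      by (rule act_cshift_inverse[OF A \<Phi>[of "n + m"] \<Phi> e, of s _ "2 * norm B"])
         (use s b[of "n + m"] in \<open>auto simp: a_def Z_def\<close>)
    moreover have "(\<lambda>n. mYX (cshift v (Z s) (\<Phi> j)) (b (n + m) 0)) \<longlonglongrightarrow> mYX (cshift v (Z s) (\<Phi> j)) B"
      by (rule YX.tendsto_act[OF ci b0(1) blim B])
    moreover have "(\<lambda>n. mYX (\<Phi> j) (b (n + m) s)) \<longlonglongrightarrow> mYX (\<Phi> j) Bs"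
      by (rule YX.tendsto_act[OF \<Phi>i bs(1) Bs BsM])
    ultimately show ?thesis using LIMSEQ_unique by simp
  qed
  \<comment> \<open>Both coordinates of the graph points converge, the second because
    \<open>eq\<close> rewrites it as \<open>mYX (\<Phi> j) Bs\<close>.\<close>
  have "(B, Bs) \<in> closure (diamond_graph (cops JY JX) mYX (expo ((- (e * s)) *\<^sub>R v)))"
    unfolding closure_sequential
  proof (intro exI conjI allI)
    show "(mYX (\<Phi> j) B, mYX (cshift v (Z s) (\<Phi> j)) B) \<in> diamond_graph (cops JY JX) mYX (expo ((- (e * s)) *\<^sub>R v))" for j
    proof (rule YX.diamond_graph_cshift[OF \<Phi> B])
      have "\<i> * Z s * complex_of_real (v \<bullet> l) = complex_of_real ((- (e * s)) * (v \<bullet> l))" for l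
        by (simp add: Z_def mult.assoc[symmetric])
      then show "expo ((- (e * s)) *\<^sub>R v) l = exp (\<i> * Z s * complex_of_real (v \<bullet> l))" for l
        by (simp only: expo_def inner_scaleR_left exp_of_real)
    qed
    have "(\<lambda>j. mYX (\<Phi> j) B) \<longlonglongrightarrow> B" "(\<lambda>j. mYX (\<Phi> j) Bs) \<longlonglongrightarrow> Bs"
      unfolding \<Phi>_def
      by (rule YX.act_dilate_tendsto[OF band_limitedD(2)[OF \<phi>(1)] \<phi>(2) B Bc],
          rule YX.act_dilate_tendsto[OF band_limitedD(2)[OF \<phi>(1)] \<phi>(2) BsM Bsc])
    then show "(\<lambda>j. (mYX (\<Phi> j) B, mYX (cshift v (Z s) (\<Phi> j)) B)) \<longlonglongrightarrow> (B, Bs)"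
      unfolding eq by (rule tendsto_Pair)
  qed
  then show ?thesis using s(1) by (auto simp: fc_domain_def v_def)
qed

end

theorem mainTheorem9:
  fixes JX :: "'x::banach \<Rightarrow> 'x" and JY :: "'y::banach \<Rightarrow> 'y"
    and TXY :: "real^'n \<Rightarrow> ('x \<Rightarrow>\<^sub>L 'y) \<Rightarrow> ('x \<Rightarrow>\<^sub>L 'y)"
    and TYX :: "real^'n \<Rightarrow> ('y \<Rightarrow>\<^sub>L 'x) \<Rightarrow> ('y \<Rightarrow>\<^sub>L 'x)"
    and TXX :: "real^'n \<Rightarrow> ('x \<Rightarrow>\<^sub>L 'x) \<Rightarrow> ('x \<Rightarrow>\<^sub>L 'x)"
    and TYY :: "real^'n \<Rightarrow> ('y \<Rightarrow>\<^sub>L 'y) \<Rightarrow> ('y \<Rightarrow>\<^sub>L 'y)"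
    and mXY :: "(real^'n \<Rightarrow> complex) \<Rightarrow> ('x \<Rightarrow>\<^sub>L 'y) \<Rightarrow> ('x \<Rightarrow>\<^sub>L 'y)"
    and mYX :: "(real^'n \<Rightarrow> complex) \<Rightarrow> ('y \<Rightarrow>\<^sub>L 'x) \<Rightarrow> ('y \<Rightarrow>\<^sub>L 'x)"
    and mXX :: "(real^'n \<Rightarrow> complex) \<Rightarrow> ('x \<Rightarrow>\<^sub>L 'x) \<Rightarrow> ('x \<Rightarrow>\<^sub>L 'x)"
    and mYY :: "(real^'n \<Rightarrow> complex) \<Rightarrow> ('y \<Rightarrow>\<^sub>L 'y) \<Rightarrow> ('y \<Rightarrow>\<^sub>L 'y)"
    and A :: "'x \<Rightarrow>\<^sub>L 'y" and B :: "'y \<Rightarrow>\<^sub>L 'x"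
  assumes JX: "complex_structure JX" and JY: "complex_structure JY"
    and modXY: "l1_module (cops JX JY) (opsc JY) TXY mXY"
    and modYX: "l1_module (cops JY JX) (opsc JX) TYX mYX"
    and modXX: "l1_module (cops JX JX) (opsc JX) TXX mXX"
    and modYY: "l1_module (cops JY JY) (opsc JY) TYY mYY"
    and mult_XXX: "\<And>t C D. C \<in> cops JX JX \<Longrightarrow> D \<in> cops JX JX \<Longrightarrow> TXX t (D o\<^sub>L C) = TXX t D o\<^sub>L TXX t C"
    and mult_XXY: "\<And>t C D. C \<in> cops JX JX \<Longrightarrow> D \<in> cops JX JY \<Longrightarrow> TXY t (D o\<^sub>L C) = TXY t D o\<^sub>L TXX t C"
    and mult_XYX: "\<And>t C D. C \<in> cops JX JY \<Longrightarrow> D \<in> cops JY JX \<Longrightarrow> TXX t (D o\<^sub>L C) = TYX t D o\<^sub>L TXY t C"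
    and mult_XYY: "\<And>t C D. C \<in> cops JX JY \<Longrightarrow> D \<in> cops JY JY \<Longrightarrow> TXY t (D o\<^sub>L C) = TYY t D o\<^sub>L TXY t C"
    and mult_YXX: "\<And>t C D. C \<in> cops JY JX \<Longrightarrow> D \<in> cops JX JX \<Longrightarrow> TYX t (D o\<^sub>L C) = TXX t D o\<^sub>L TYX t C"
    and mult_YXY: "\<And>t C D. C \<in> cops JY JX \<Longrightarrow> D \<in> cops JX JY \<Longrightarrow> TYY t (D o\<^sub>L C) = TXY t D o\<^sub>L TYX t C"
    and mult_YYX: "\<And>t C D. C \<in> cops JY JY \<Longrightarrow> D \<in> cops JY JX \<Longrightarrow> TYX t (D o\<^sub>L C) = TYX t D o\<^sub>L TYY t C"
    and mult_YYY: "\<And>t C D. C \<in> cops JY JY \<Longrightarrow> D \<in> cops JY JY \<Longrightarrow> TYY t (D o\<^sub>L C) = TYY t D o\<^sub>L TYY t C"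
    and coupled: "\<And>C D. C \<in> cops JX JY \<Longrightarrow> D \<in> cops JY JX \<Longrightarrow>
        ((D o\<^sub>L C = id_blinfun \<and> C o\<^sub>L D = id_blinfun) \<longleftrightarrow>
         (\<forall>t. TYX t D o\<^sub>L TXY t C = id_blinfun \<and> TXY t C o\<^sub>L TYX t D = id_blinfun))"
    and A_op: "A \<in> cops JX JY" and B_op: "B \<in> cops JY JX"
    and A_cont: "continuous_on UNIV (\<lambda>t. TXY t A)"
    and inv: "B o\<^sub>L A = id_blinfun" "A o\<^sub>L B = id_blinfun"
  shows "(beurling_spec mXY A \<subseteq> {l. \<forall>i. 0 \<le> l $ i} \<longrightarrow>
            (\<exists>\<alpha>. (\<forall>i. 0 < \<alpha> $ i) \<and> continuous_on UNIV (\<lambda>t. TYX t B) \<and>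
                 B \<in> fc_domain (cops JY JX) mYX (expo (- \<alpha>))))
       \<and> (beurling_spec mXY A \<subseteq> {l. \<forall>i. l $ i \<le> 0} \<longrightarrow>
            (\<exists>\<alpha>. (\<forall>i. 0 < \<alpha> $ i) \<and> continuous_on UNIV (\<lambda>t. TYX t B) \<and>
                 B \<in> fc_domain (cops JY JX) mYX (expo \<alpha>)))"
proof -
  interpret coupled_l1_modules JX JY TXY TYX mXY mYX
    by (rule coupled_l1_modules.intro[OF JX JY modXY modYX]) (use coupled in blast)
  note dom = inverse_in_fc_domain[OF A_op B_op inv A_cont]
  have cont: "continuous_on UNIV (\<lambda>t. TYX t B)"
    by (rule continuous_T_inverse[OF A_op B_op inv A_cont])
  show ?thesis
  proof (intro conjI impI)
    assume "beurling_spec mXY A \<subseteq> {l. \<forall>i. 0 \<le> l $ i}"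
    then obtain s where "s > 0" "B \<in> fc_domain (cops JY JX) mYX (expo ((- (1 * s)) *\<^sub>R (\<chi> i. 1)))"
      using dom[of 1] by auto
    then show "\<exists>\<alpha>. (\<forall>i. 0 < \<alpha> $ i) \<and> continuous_on UNIV (\<lambda>t. TYX t B) \<and>
        B \<in> fc_domain (cops JY JX) mYX (expo (- \<alpha>))"
      using cont by (intro exI[of _ "s *\<^sub>R (\<chi> i. 1)"]) auto
  next
    assume "beurling_spec mXY A \<subseteq> {l. \<forall>i. l $ i \<le> 0}"
    then obtain s where "s > 0" "B \<in> fc_domain (cops JY JX) mYX (expo ((- (- 1 * s)) *\<^sub>R (\<chi> i. 1)))"
      using dom[of "- 1"] by auto
    then show "\<exists>\<alpha>. (\<forall>i. 0 < \<alpha> $ i) \<and> continuous_on UNIV (\<lambda>t. TYX t B) \<and>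
        B \<in> fc_domain (cops JY JX) mYX (expo \<alpha>)"
      using cont by (intro exI[of _ "s *\<^sub>R (\<chi> i. 1)"]) auto
  qed
qed

end
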